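(* Let $\mu$ be a probability distribution on $\mathbb{R}$ with finite first moment such that, for every $t_0\in[0,1)$, the variance of the posterior distribution $\mu_{t,z}$ is bounded over $(t,z)\in[0,t_0]\times\mathbb{R}$. Let $\mathcal{C}$ be the continuation region of the problem of optimally stopping a Brownian bridge with unknown pinning point with prior $\mu$. (i) If, for every $t\in[0,1)$, $h(t,z)-z$ is decreasing in $z$ (equivalently, for every $t\ge0$, $f(t,y)-y/(1+t)$ is decreasing in $y$), then there exists a boundary $b:[0,1)\to[-\infty,\infty]$ such that $\mathcal{C}=\{(t,z)\in[0,1)\times\mathbb{R}:z<b(t)\}$. (ii) If, for every $t\in[0,1)$, $h(t,z)-z$ is increasing in $z$ (equivalently, for every $t\ge0$, $f(t,y)-y/(1+t)$ is increasing in $y$), then there exists a boundary $b:[0,1)\to[-\infty,\infty]$ such that $\mathcal{C}=\{(t,z)\in[0,1)\times\mathbb{R}:z>b(t)\}$.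
   Context: "Decreasing" and "increasing" are understood in the weak sense. For $(t,z)\in[0,1)\times\mathbb{R}$, $$\mu_{t,z}(du):=\frac{e^{\frac{uz}{1-t}-\frac{tu^2}{2(1-t)}}\,\mu(du)}{\int_{\mathbb{R}}e^{\frac{uz}{1-t}-\frac{tu^2}{2(1-t)}}\,\mu(du)},\qquad h(t,z):=\int_{\mathbb{R}}u\,\mu_{t,z}(du),$$ and for $s\ge0$, $y\in\mathbb{R}$, $$f(s,y):=\frac{\int_{\mathbb{R}}u\,e^{uy-u^2s/2}\,\mu(du)}{\int_{\mathbb{R}}e^{uy-u^2s/2}\,\mu(du)},$$ so that $h(t,z)=f\left(\frac{t}{1-t},\frac{z}{1-t}\right)$. The process $Z^{t,z}$ is the solution of $$dZ_{t+s}=\frac{h(t+s,Z_{t+s})-Z_{t+s}}{1-(t+s)}\,ds+d\hat W_{t+s},\quad0\le s<1-t,\qquad Z_t=z,$$ with $\hat W$ a standard Brownian motion, extended to time $1$ by its a.s. limit; equivalently, in law, it is a Brownian bridge started at time $t$ from $z$ whose (unknown) pinning point at time $1$ has distribution $\mu_{t,z}$. The value function is $$v(t,z)=\sup_{\tau\in\mathcal{T}^Z_{1-t}}\mathbb{E}[Z^{t,z}_{t+\tau}],\qquad(t,z)\in[0,1)\times\mathbb{R},$$ where $\mathcal{T}^Z_{1-t}$ is the set of $[0,1-t]$-valued stopping times with respect to the filtration generated by $s\mapsto Z^{t,z}_{t+s}$. The continuation region is $\mathcal{C}:=\{(t,z)\in[0,1)\times\mathbb{R}:v(t,z)>z\}$.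 *)

theory Defs
  imports "HOL-Probability.Probability"
begin

section \<open>Posterior distribution of the pinning point\<close>

text \<open>
  At \<open>t = 0\<close> the normalising integral is the Laplace transform of \<open>\<mu>\<close>. It is finite whenever the
  posterior variances are bounded over small \<open>t > 0\<close> and all \<open>z\<close>; for \<open>t > 0\<close> it is always finite.
\<close>

definition posterior :: "real measure \<Rightarrow> real \<Rightarrow> real \<Rightarrow> real measure" where
  "posterior \<mu> t z = density \<mu> (\<lambda>u. ennreal
     (exp (u * z / (1 - t) - t * u\<^sup>2 / (2 * (1 - t)))
      / (\<integral>u'. exp (u' * z / (1 - t) - t * u'\<^sup>2 / (2 * (1 - t))) \<partial>\<mu>)))"

definition bridge_h :: "real measure \<Rightarrow> real \<Rightarrow> real \<Rightarrow> real" where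
  "bridge_h \<mu> t z = (\<integral>u. u \<partial>posterior \<mu> t z)"

definition bridge_f :: "real measure \<Rightarrow> real \<Rightarrow> real \<Rightarrow> real" where
  "bridge_f \<mu> s y = (\<integral>u. u * exp (u * y - u\<^sup>2 * s / 2) \<partial>\<mu>) / (\<integral>u. exp (u * y - u\<^sup>2 * s / 2) \<partial>\<mu>)"

section \<open>Brownian motion and the bridge with unknown pinning point\<close>

definition standard_brownian_motion :: "'w measure \<Rightarrow> (real \<Rightarrow> 'w \<Rightarrow> real) \<Rightarrow> bool" where
  "standard_brownian_motion M W \<longleftrightarrow>
     prob_space M \<and>
     (\<forall>s\<ge>0. W s \<in> borel_measurable M) \<and>
     (AE \<omega> in M. W 0 \<omega> = 0) \<and>
     (\<forall>s\<ge>0. \<forall>u>s. distributed M lborel (\<lambda>\<omega>. W u \<omega> - W s \<omega>) (normal_density 0 (sqrt (u - s)))) \<and>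
     (\<forall>(n::nat) p::nat \<Rightarrow> real. 0 \<le> p 0 \<and> (\<forall>i<n. p i \<le> p (Suc i)) \<longrightarrow>
        prob_space.indep_vars M (\<lambda>_. borel) (\<lambda>i \<omega>. W (p (Suc i)) \<omega> - W (p i) \<omega>) {..<n}) \<and>
     (\<forall>\<omega>\<in>space M. continuous_on {0..} (\<lambda>s. W s \<omega>))"

text \<open>
  \<open>X s\<close> is the value at time \<open>t + s\<close> of the process started at time \<open>t\<close> from \<open>z\<close>.
  Since the noise is additive, the stochastic differential equation is a pathwise integral
  equation; \<open>has_integral\<close> includes the existence of the drift integral. At \<open>s = 0\<close> the equation
  is the initial condition. The last clause is the extension to time 1.
\<close>

definition bridge_process ::
  "real measure \<Rightarrow> 'w measure \<Rightarrow> (real \<Rightarrow> 'w \<Rightarrow> real) \<Rightarrow> real \<Rightarrow> real \<Rightarrow> (real \<Rightarrow> 'w \<Rightarrow> real) \<Rightarrow> bool" where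
  "bridge_process \<mu> M W t z X \<longleftrightarrow>
     (\<forall>s\<in>{0..1 - t}. X s \<in> borel_measurable M) \<and>
     (\<forall>\<omega>\<in>space M. continuous_on {0..<1 - t} (\<lambda>s. X s \<omega>)) \<and>
     (AE \<omega> in M. \<forall>s\<in>{0..<1 - t}.
        ((\<lambda>r. (bridge_h \<mu> (t + r) (X r \<omega>) - X r \<omega>) / (1 - (t + r))) has_integral
           (X s \<omega> - z - (W (t + s) \<omega> - W t \<omega>))) {0..s}) \<and>
     (AE \<omega> in M. ((\<lambda>s. X s \<omega>) \<longlongrightarrow> X (1 - t) \<omega>) (at_left (1 - t)))"

section \<open>The stopping problem\<close>

definition natural_filtration ::
  "'w measure \<Rightarrow> real set \<Rightarrow> (real \<Rightarrow> 'w \<Rightarrow> real) \<Rightarrow> real \<Rightarrow> 'w measure" where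
  "natural_filtration M I X s =
     sigma (space M) (\<Union>r\<in>{r\<in>I. r \<le> s}. {X r -` B \<inter> space M |B. B \<in> sets borel})"

definition stopping_times :: "'w measure \<Rightarrow> (real \<Rightarrow> 'w \<Rightarrow> real) \<Rightarrow> real \<Rightarrow> ('w \<Rightarrow> real) set" where
  "stopping_times M X T =
     {\<tau>. stopping_time (natural_filtration M {0..T} X) \<tau> \<and> (\<forall>\<omega>\<in>space M. \<tau> \<omega> \<in> {0..T})}"

text \<open>
  In the next two definitions \<open>Z t z\<close> is the process started at time \<open>t\<close> from \<open>z\<close>. The supremum is
  taken in the extended reals, so that it needs no a priori upper bound.
\<close>

definition value_function ::
  "'w measure \<Rightarrow> (real \<Rightarrow> real \<Rightarrow> real \<Rightarrow> 'w \<Rightarrow> real) \<Rightarrow> real \<Rightarrow> real \<Rightarrow> ereal" where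
  "value_function M Z t z =
     (SUP \<tau>\<in>stopping_times M (Z t z) (1 - t). ereal (prob_space.expectation M (\<lambda>\<omega>. Z t z (\<tau> \<omega>) \<omega>)))"

definition continuation_region ::
  "'w measure \<Rightarrow> (real \<Rightarrow> real \<Rightarrow> real \<Rightarrow> 'w \<Rightarrow> real) \<Rightarrow> (real \<times> real) set" where
  "continuation_region M Z = {(t, z). t \<in> {0..<1} \<and> value_function M Z t z > ereal z}"

end

theory Submission
  imports Defs
begin

text \<open>
  All processes are driven by the same Brownian motion, so the difference of the solutions started
  at \<open>z1 < z2\<close> solves an ordinary differential equation. If the drift is decreasing in \<open>z\<close>, the gap
  stays in \<open>[0, z2 - z1]\<close>; if it is increasing, the gap never falls below \<open>z2 - z1\<close>. Hence
  \<open>v t z - z\<close> is monotone in \<open>z\<close>, and the section of the continuation region at time \<open>t\<close> is a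
  half-line, which is open because the processes depend continuously on \<open>z\<close> away from time 1.

  Two points need work. First, the value functions at different starting points refer to different
  filtrations, which agree only up to null sets. Second, the supremum of the absolute value of
  the process up to time 1 has to be integrable. If the drift is decreasing, this follows by
  comparing two paths. If it is increasing, \<open>\<mu>\<close> has a log-convex density with respect to the standard
  Gaussian, and the bounded posterior variance at time 1/2 then forces the drift to grow at most
  linearly, uniformly up to time 1.
\<close>

text \<open>Two instants are delicate. At time 0 the Gaussian damping in the posterior vanishes, so
  the Lipschitz and growth estimates are stated for positive times only; a single instant does not
  affect the integral equation. At time 1 the Lipschitz constants available for the drift may blow
  up. The comparison of paths therefore uses only the sign of the difference of drifts, and the
  Lipschitz property serves only up to a fixed time before 1.

  The transfer of stopping times is shaped by this. A grid-valued time that stops short of time 1 is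
  given by finitely many events, each decided strictly before time 1, where the processes from
  different starting points determine each other almost surely. Replacing each event by an almost
  surely equal one from the other filtration gives a genuine stopping time. Domination is what makes
  the expected payoff of an arbitrary stopping time the limit of grid-valued ones.

  For an increasing drift the uniform growth bound comes from the heat equation: averaging a convex
  function against a centred Gaussian increases it, so the density at a later time lies below the
  one at time 1/2.\<close>

section \<open>Exponentially tilted moments\<close>

definition tilted_moment :: "real measure \<Rightarrow> nat \<Rightarrow> real \<Rightarrow> real \<Rightarrow> real" where
  "tilted_moment \<mu> k s y = (\<integral>u. u ^ k * exp (u * y - u\<^sup>2 * s / 2) \<partial>\<mu>)"

lemma abs_power_le_exp: "\<bar>u::real\<bar> ^ k \<le> exp (real k * \<bar>u\<bar>)"
proof -
  have "\<bar>u\<bar> \<le> exp \<bar>u\<bar>" using exp_ge_add_one_self[of "\<bar>u\<bar>"] by linarith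
  then have "\<bar>u\<bar> ^ k \<le> exp \<bar>u\<bar> ^ k" by (intro power_mono) auto
  then show ?thesis by (simp add: exp_of_nat_mult)
qed

text \<open>The power is absorbed into \<open>exp (k * \<bar>u\<bar>)\<close>; completing the square
  in \<open>\<bar>u\<bar>\<close> then gives the maximum of the exponent.\<close>

lemma tilt_bound:
  fixes u s c :: real
  assumes "0 < s" "0 \<le> c"
  shows "\<bar>u\<bar> ^ k * exp (\<bar>u\<bar> * c - u\<^sup>2 * s / 2) \<le> exp ((c + k)\<^sup>2 / (2 * s))"
proof -
  have "0 \<le> (s * \<bar>u\<bar> - (c + k))\<^sup>2" by simp
  then have "2 * s * (\<bar>u\<bar> * (c + k)) - s\<^sup>2 * u\<^sup>2 \<le> (c + k)\<^sup>2"
    by (simp add: power2_diff power_mult_distrib algebra_simps)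
  then have "(2 * s * (\<bar>u\<bar> * (c + k)) - s\<^sup>2 * u\<^sup>2) / (2 * s) \<le> (c + k)\<^sup>2 / (2 * s)"
    using assms by (intro divide_right_mono) auto
  moreover have "(2 * s * (\<bar>u\<bar> * (c + k)) - s\<^sup>2 * u\<^sup>2) / (2 * s) = \<bar>u\<bar> * (c + k) - u\<^sup>2 * s / 2"
    using assms by (simp add: field_simps power2_eq_square)
  ultimately have *: "\<bar>u\<bar> * (c + k) - u\<^sup>2 * s / 2 \<le> (c + k)\<^sup>2 / (2 * s)" by simp
  have "\<bar>u\<bar> ^ k * exp (\<bar>u\<bar> * c - u\<^sup>2 * s / 2) \<le> exp (real k * \<bar>u\<bar>) * exp (\<bar>u\<bar> * c - u\<^sup>2 * s / 2)"
    by (intro mult_right_mono abs_power_le_exp) auto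
  also have "\<dots> = exp (\<bar>u\<bar> * (c + k) - u\<^sup>2 * s / 2)" by (simp add: exp_add[symmetric] algebra_simps)
  finally show ?thesis using * by (meson exp_le_cancel_iff order_trans)
qed

context
  fixes \<mu> :: "real measure"
  assumes \<mu>: "real_distribution \<mu>"
begin

interpretation real_distribution \<mu> by (rule \<mu>)

lemma integrable_tilted_abs:
  assumes "0 < s" "0 \<le> c"
  shows "integrable \<mu> (\<lambda>u. \<bar>u\<bar> ^ k * exp (\<bar>u\<bar> * c - u\<^sup>2 * s / 2))"
  by (rule integrable_const_bound[where B="exp ((c + k)\<^sup>2 / (2 * s))"])
     (use tilt_bound[OF assms] in \<open>auto simp: abs_mult\<close>)

lemma integrable_tilted:
  assumes "0 < s"
  shows "integrable \<mu> (\<lambda>u. u ^ k * exp (u * y - u\<^sup>2 * s / 2))"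
proof (rule Bochner_Integration.integrable_bound[OF integrable_tilted_abs[OF assms, of "\<bar>y\<bar>" k]])
  have "u * y \<le> \<bar>u\<bar> * \<bar>y\<bar>" for u :: real by (metis abs_ge_self abs_mult)
  then show "AE u in \<mu>. norm (u ^ k * exp (u * y - u\<^sup>2 * s / 2)) \<le> norm (\<bar>u\<bar> ^ k * exp (\<bar>u\<bar> * \<bar>y\<bar> - u\<^sup>2 * s / 2))"
    by (auto simp: abs_mult power_abs intro!: mult_left_mono)
qed auto

text \<open>Differentiation under the integral: the first-order Taylor remainder of
  \<open>exp (\<eta> * u)\<close> is bounded by \<open>\<eta>\<^sup>2\<close> times an integrable
  function, uniformly for \<open>\<bar>\<eta>\<bar> \<le> 1\<close>.\<close>

lemma tilted_moment_has_derivative: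
  assumes s: "0 < s"
  shows "(tilted_moment \<mu> k s has_real_derivative tilted_moment \<mu> (Suc k) s y) (at y)"
proof -
  \<comment> \<open>The remainder is at most
    \<open>\<eta>\<^sup>2 * u\<^sup>2 * exp \<bar>u\<bar>\<close>: the square raises the power by 2
    and the exponential raises \<open>\<bar>y\<bar>\<close> by 1.\<close>
  define K where "K = (\<integral>u. \<bar>u\<bar> ^ (k + 2) * exp (\<bar>u\<bar> * (\<bar>y\<bar> + 1) - u\<^sup>2 * s / 2) \<partial>\<mu>)"
  let ?F = "\<lambda>k. tilted_moment \<mu> k s"
  have bound: "\<bar>?F k (y + \<eta>) - ?F k y - \<eta> * ?F (Suc k) y\<bar> \<le> \<eta>\<^sup>2 * K" if "\<bar>\<eta>\<bar> \<le> 1" for \<eta>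
  proof -
    have fac: "u ^ k * exp (u * (y + \<eta>) - u\<^sup>2 * s / 2) - u ^ k * exp (u * y - u\<^sup>2 * s / 2)
          - \<eta> * (u ^ Suc k * exp (u * y - u\<^sup>2 * s / 2)) =
        u ^ k * exp (u * y - u\<^sup>2 * s / 2) * (exp (\<eta> * u) - 1 - \<eta> * u)" for u
    proof -
      have "u * (y + \<eta>) - u\<^sup>2 * s / 2 = (u * y - u\<^sup>2 * s / 2) + \<eta> * u" by (simp add: algebra_simps)
      then show ?thesis by (simp only: exp_add power_Suc) (simp add: algebra_simps)
    qed
    have "?F k (y + \<eta>) - ?F k y - \<eta> * ?F (Suc k) y =
      (\<integral>u. u ^ k * exp (u * (y + \<eta>) - u\<^sup>2 * s / 2) - u ^ k * exp (u * y - u\<^sup>2 * s / 2)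
          - \<eta> * (u ^ Suc k * exp (u * y - u\<^sup>2 * s / 2)) \<partial>\<mu>)"
      unfolding tilted_moment_def using integrable_tilted[OF s, of k] integrable_tilted[OF s, of "Suc k"]
      by (simp del: power_Suc)
    also have "\<dots> = (\<integral>u. u ^ k * exp (u * y - u\<^sup>2 * s / 2) * (exp (\<eta> * u) - 1 - \<eta> * u) \<partial>\<mu>)"
      by (simp only: fac)
    finally have eq: "?F k (y + \<eta>) - ?F k y - \<eta> * ?F (Suc k) y = \<dots>" .
    have "\<bar>\<dots>\<bar> \<le> (\<integral>u. \<eta>\<^sup>2 * (\<bar>u\<bar> ^ (k + 2) * exp (\<bar>u\<bar> * (\<bar>y\<bar> + 1) - u\<^sup>2 * s / 2)) \<partial>\<mu>)"
    proof (rule integral_abs_bound_integral)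
      show "integrable \<mu> (\<lambda>u. \<eta>\<^sup>2 * (\<bar>u\<bar> ^ (k + 2) * exp (\<bar>u\<bar> * (\<bar>y\<bar> + 1) - u\<^sup>2 * s / 2)))"
        using integrable_tilted_abs[OF s, of "\<bar>y\<bar> + 1" "k + 2"] by (simp del: power_Suc power_Suc2)
      have "integrable \<mu> (\<lambda>u. u ^ k * exp (u * (y + \<eta>) - u\<^sup>2 * s / 2) - u ^ k * exp (u * y - u\<^sup>2 * s / 2)
          - \<eta> * (u ^ Suc k * exp (u * y - u\<^sup>2 * s / 2)))"
        using integrable_tilted[OF s, of k] integrable_tilted[OF s, of "Suc k"]
        by (simp del: power_Suc)
      then show "integrable \<mu> (\<lambda>u. u ^ k * exp (u * y - u\<^sup>2 * s / 2) * (exp (\<eta> * u) - 1 - \<eta> * u))"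
        by (simp only: fac)
      fix u :: real
      have "\<bar>exp (\<eta> * u) - 1 - \<eta> * u\<bar> \<le> exp \<bar>\<eta> * u\<bar> * \<bar>\<eta> * u\<bar>\<^sup>2"
        using Taylor_exp_field[of "\<eta> * u" 1] by (simp add: power2_eq_square algebra_simps)
      also have "\<dots> \<le> exp \<bar>u\<bar> * (\<eta>\<^sup>2 * u\<^sup>2)"
        using that by (intro mult_mono) (auto simp: abs_mult power_mult_distrib intro: mult_left_le_one_le)
      finally have 1: "\<bar>exp (\<eta> * u) - 1 - \<eta> * u\<bar> \<le> exp \<bar>u\<bar> * (\<eta>\<^sup>2 * u\<^sup>2)" .
      have 2: "u * y \<le> \<bar>u\<bar> * \<bar>y\<bar>" by (metis abs_ge_self abs_mult)
      have "\<bar>u ^ k * exp (u * y - u\<^sup>2 * s / 2) * (exp (\<eta> * u) - 1 - \<eta> * u)\<bar>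
        \<le> \<bar>u\<bar> ^ k * exp (\<bar>u\<bar> * \<bar>y\<bar> - u\<^sup>2 * s / 2) * (exp \<bar>u\<bar> * (\<eta>\<^sup>2 * u\<^sup>2))"
        unfolding abs_mult power_abs using 1 2 by (intro mult_mono) auto
      also have "\<dots> = \<eta>\<^sup>2 * (\<bar>u\<bar> ^ (k + 2) * exp (\<bar>u\<bar> * (\<bar>y\<bar> + 1) - u\<^sup>2 * s / 2))"
        by (simp add: algebra_simps exp_add exp_diff power2_eq_square power_add)
      finally show "\<bar>u ^ k * exp (u * y - u\<^sup>2 * s / 2) * (exp (\<eta> * u) - 1 - \<eta> * u)\<bar>
        \<le> \<eta>\<^sup>2 * (\<bar>u\<bar> ^ (k + 2) * exp (\<bar>u\<bar> * (\<bar>y\<bar> + 1) - u\<^sup>2 * s / 2))" .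
    qed
    also have "\<dots> = \<eta>\<^sup>2 * K" unfolding K_def by simp
    finally show ?thesis unfolding eq .
  qed
  have "((\<lambda>\<eta>. (?F k (y + \<eta>) - ?F k y) / \<eta> - ?F (Suc k) y) \<longlongrightarrow> 0) (at 0)"
  proof (rule Lim_null_comparison)
    show "((\<lambda>\<eta>. \<bar>\<eta>\<bar> * K) \<longlongrightarrow> 0) (at 0)" by (auto intro!: tendsto_eq_intros)
    have "eventually (\<lambda>\<eta>::real. \<bar>\<eta>\<bar> < 1) (at 0)"
      by (rule order_tendstoD[OF tendsto_eq_rhs[OF tendsto_rabs[OF tendsto_ident_at]]]) auto
    moreover have "eventually (\<lambda>\<eta>::real. \<eta> \<noteq> 0) (at 0)" by (simp add: eventually_at_filter)
    ultimately show "\<forall>\<^sub>F \<eta> in at 0. norm ((?F k (y + \<eta>) - ?F k y) / \<eta> - ?F (Suc k) y) \<le> \<bar>\<eta>\<bar> * K"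
    proof eventually_elim
      case (elim \<eta>)
      have "norm ((?F k (y + \<eta>) - ?F k y) / \<eta> - ?F (Suc k) y) = \<bar>?F k (y + \<eta>) - ?F k y - \<eta> * ?F (Suc k) y\<bar> / \<bar>\<eta>\<bar>"
      proof -
        have "(?F k (y + \<eta>) - ?F k y) / \<eta> - ?F (Suc k) y = (?F k (y + \<eta>) - ?F k y - \<eta> * ?F (Suc k) y) / \<eta>"
          using elim by (simp add: diff_divide_distrib)
        then show ?thesis by (simp only: real_norm_def abs_divide)
      qed
      also have "\<dots> \<le> \<eta>\<^sup>2 * K / \<bar>\<eta>\<bar>" using bound[of \<eta>] elim by (intro divide_right_mono) auto
      also have "\<dots> = \<bar>\<eta>\<bar> * K" using elim by (simp add: power2_eq_square abs_if)
      finally show ?case .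
    qed
  qed
  then show ?thesis unfolding DERIV_def by (rule LIM_zero_cancel)
qed

lemma tilted_moment_0_pos:
  assumes s: "0 < s"
  shows "0 < tilted_moment \<mu> 0 s y"
proof -
  have "0 < (\<integral>u. exp (u * y - u\<^sup>2 * s / 2) \<partial>\<mu>)"
    using integrable_tilted[OF s, of 0 y] emeasure_space_1
    by (subst integral_less_AE_space[of "\<lambda>_. 0", simplified]) (auto simp: emeasure_space_1)
  then show ?thesis by (simp add: tilted_moment_def)
qed

lemma bridge_f_eq: "bridge_f \<mu> s y = tilted_moment \<mu> 1 s y / tilted_moment \<mu> 0 s y"
  by (simp add: bridge_f_def tilted_moment_def)

text \<open>This holds for every \<open>t < 1\<close>, including \<open>t = 0\<close>: if the
  normalising integral diverges it takes the default value 0, and both sides are 0 because division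
  by 0 gives 0. Hence \<open>h\<close> and \<open>f\<close> correspond at time 0 as well.\<close>

lemma integral_posterior:
  assumes "t < 1" and [measurable]: "g \<in> borel_measurable borel"
  shows "(\<integral>u. g u \<partial>posterior \<mu> t z) =
    (\<integral>u. g u * exp (u * (z / (1 - t)) - u\<^sup>2 * (t / (1 - t)) / 2) \<partial>\<mu>) / tilted_moment \<mu> 0 (t / (1 - t)) (z / (1 - t))"
proof -
  let ?N = "(\<integral>u. exp (u * z / (1 - t) - t * u\<^sup>2 / (2 * (1 - t))) \<partial>\<mu>)"
  have e: "u * z / (1 - t) - t * u\<^sup>2 / (2 * (1 - t)) = u * (z / (1 - t)) - u\<^sup>2 * (t / (1 - t)) / 2" for u
    by (simp add: mult.commute)
  have N: "?N = tilted_moment \<mu> 0 (t / (1 - t)) (z / (1 - t))" unfolding tilted_moment_def e by simp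
  have "0 \<le> ?N" by simp
  then have "(\<integral>u. g u \<partial>posterior \<mu> t z) = (\<integral>u. (exp (u * z / (1 - t) - t * u\<^sup>2 / (2 * (1 - t))) / ?N) *\<^sub>R g u \<partial>\<mu>)"
    unfolding posterior_def by (intro integral_density) auto
  also have "\<dots> = (\<integral>u. (g u * exp (u * (z / (1 - t)) - u\<^sup>2 * (t / (1 - t)) / 2)) / ?N \<partial>\<mu>)"
    unfolding e by (intro Bochner_Integration.integral_cong) auto
  finally show ?thesis unfolding N by simp
qed

lemma bridge_h_eq_f: "t < 1 \<Longrightarrow> bridge_h \<mu> t z = bridge_f \<mu> (t / (1 - t)) (z / (1 - t))"
  unfolding bridge_h_def bridge_f_eq by (subst integral_posterior) (auto simp: tilted_moment_def)

text \<open>With \<open>s = t / (1 - t)\<close> and \<open>y = (1 + s) * z\<close>, the two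
  functions coincide up to the positive scaling \<open>1 + s = 1 / (1 - t)\<close> of the argument,
  which preserves either kind of monotonicity.\<close>

lemma f_monotone_iff_h_monotone:
  fixes P :: "(real \<Rightarrow> real) \<Rightarrow> bool"
  assumes "P = antimono \<or> P = mono"
  shows "(\<forall>t\<in>{0..<1}. P (\<lambda>z. bridge_h \<mu> t z - z)) \<longleftrightarrow> (\<forall>s\<ge>0. P (\<lambda>y. bridge_f \<mu> s y - y / (1 + s)))"
proof -
  have scale: "P (\<lambda>x. g (c * x))" if "P g" "0 < c" for g and c :: real
    using that assms by (auto simp: mono_def antimono_def)
  show ?thesis
  proof (intro iffI allI ballI impI)
    fix s :: real assume *: "\<forall>t\<in>{0..<1}. P (\<lambda>z. bridge_h \<mu> t z - z)" and s: "0 \<le> s"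
    have t: "s / (1 + s) \<in> {0..<1}" using s by auto
    have 1: "1 - s / (1 + s) = 1 / (1 + s)" using s by (simp add: field_simps)
    then have "bridge_h \<mu> (s / (1 + s)) z = bridge_f \<mu> s ((1 + s) * z)" for z
      using t s by (subst bridge_h_eq_f) (auto simp: mult.commute)
    with *[rule_format, OF t] have "P (\<lambda>z. bridge_f \<mu> s ((1 + s) * z) - z)" by simp
    from scale[OF this, of "1 / (1 + s)"] show "P (\<lambda>y. bridge_f \<mu> s y - y / (1 + s))" using s by simp
  next
    fix t :: real assume *: "\<forall>s\<ge>0. P (\<lambda>y. bridge_f \<mu> s y - y / (1 + s))" and t: "t \<in> {0..<1}"
    have 1: "1 + t / (1 - t) = 1 / (1 - t)" using t by (simp add: field_simps)
    from * t have "P (\<lambda>y. bridge_f \<mu> (t / (1 - t)) y - y / (1 + t / (1 - t)))" by auto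
    from scale[OF this, of "1 / (1 - t)"] show "P (\<lambda>z. bridge_h \<mu> t z - z)"
      using t 1 by (simp add: bridge_h_eq_f)
  qed
qed

lemma posterior_variance_eq:
  fixes t z :: real
  assumes t: "0 < t" "t < 1"
  defines "s \<equiv> t / (1 - t)" and "y \<equiv> z / (1 - t)"
  shows "prob_space.variance (posterior \<mu> t z) (\<lambda>u. u) =
    (tilted_moment \<mu> 2 s y * tilted_moment \<mu> 0 s y - tilted_moment \<mu> 1 s y * tilted_moment \<mu> 1 s y)
      / (tilted_moment \<mu> 0 s y * tilted_moment \<mu> 0 s y)"
proof -
  have s: "0 < s" using t by (simp add: s_def)
  define m where "m = (\<integral>u. u \<partial>posterior \<mu> t z)"
  let ?F = "\<lambda>k. tilted_moment \<mu> k s y"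
  have m: "m = ?F 1 / ?F 0" unfolding m_def using t
    by (subst integral_posterior) (auto simp: tilted_moment_def s_def y_def)
  have "(\<integral>u. (u - m)\<^sup>2 \<partial>posterior \<mu> t z) = (\<integral>u. (u - m)\<^sup>2 * exp (u * y - u\<^sup>2 * s / 2) \<partial>\<mu>) / ?F 0"
    using t by (subst integral_posterior) (auto simp: s_def y_def)
  also have "(\<integral>u. (u - m)\<^sup>2 * exp (u * y - u\<^sup>2 * s / 2) \<partial>\<mu>) = (\<integral>u. u ^ 2 * exp (u * y - u\<^sup>2 * s / 2)
     - 2 * m * (u ^ 1 * exp (u * y - u\<^sup>2 * s / 2)) + m\<^sup>2 * (u ^ 0 * exp (u * y - u\<^sup>2 * s / 2)) \<partial>\<mu>)"
    by (intro Bochner_Integration.integral_cong) (auto simp: algebra_simps power2_eq_square)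
  also have "\<dots> = ?F 2 - 2 * m * ?F 1 + m\<^sup>2 * ?F 0"
    unfolding tilted_moment_def
    using integrable_tilted[OF s, of 0 y] integrable_tilted[OF s, of 1 y] integrable_tilted[OF s, of 2 y]
    by simp
  finally show ?thesis unfolding m_def[symmetric] m using tilted_moment_0_pos[OF s, of y]
    by (simp add: field_simps power2_eq_square)
qed

text \<open>The exponential family identity: \<open>bridge_f\<close> is the derivative of the
  logarithm of \<open>tilted_moment \<mu> 0 s\<close>, so its own derivative is a variance. Through
  it the bound on the posterior variance becomes a Lipschitz bound on the drift.\<close>

lemma bridge_f_has_derivative:
  assumes s: "0 < s"
  shows "(bridge_f \<mu> s has_real_derivative prob_space.variance (posterior \<mu> (s / (1 + s)) (y / (1 + s))) (\<lambda>u. u)) (at y)"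
proof -
  have t: "0 < s / (1 + s)" "s / (1 + s) < 1" and 1: "1 - s / (1 + s) = 1 / (1 + s)" using s by (auto simp: field_simps)
  have 2: "s / (1 + s) / (1 - s / (1 + s)) = s" "y / (1 + s) / (1 - s / (1 + s)) = y" using s unfolding 1 by auto
  have "((\<lambda>y. tilted_moment \<mu> 1 s y / tilted_moment \<mu> 0 s y) has_real_derivative
      (tilted_moment \<mu> (Suc 1) s y * tilted_moment \<mu> 0 s y - tilted_moment \<mu> 1 s y * tilted_moment \<mu> (Suc 0) s y)
      / (tilted_moment \<mu> 0 s y * tilted_moment \<mu> 0 s y)) (at y)"
    using tilted_moment_0_pos[OF s, of y] by (intro DERIV_divide tilted_moment_has_derivative s) auto
  then show ?thesis unfolding posterior_variance_eq[OF t] 2 bridge_f_eq[abs_def] by (simp add: numeral_2_eq_2)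
qed

lemma bridge_f_lipschitz:
  assumes s: "0 < s" and C: "\<And>z. prob_space.variance (posterior \<mu> (s / (1 + s)) z) (\<lambda>u. u) \<le> C"
  shows "\<bar>bridge_f \<mu> s y - bridge_f \<mu> s y'\<bar> \<le> C * \<bar>y - y'\<bar>"
proof -
  have "norm (bridge_f \<mu> s y - bridge_f \<mu> s y') \<le> C * norm (y - y')"
  proof (rule field_differentiable_bound[OF convex_UNIV])
    fix x show "(bridge_f \<mu> s has_real_derivative
        prob_space.variance (posterior \<mu> (s / (1 + s)) (x / (1 + s))) (\<lambda>u. u)) (at x)"
      by (rule bridge_f_has_derivative[OF s])
    have "0 \<le> prob_space.variance (posterior \<mu> (s / (1 + s)) (x / (1 + s))) (\<lambda>u. u)"
      by simp
    with C[of "x / (1 + s)"]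
    show "norm (prob_space.variance (posterior \<mu> (s / (1 + s)) (x / (1 + s))) (\<lambda>u. u)) \<le> C" by simp
  qed auto
  then show ?thesis by simp
qed

lemma bridge_h_lipschitz:
  assumes t: "0 < t" "t < 1" and C: "\<And>z. prob_space.variance (posterior \<mu> t z) (\<lambda>u. u) \<le> C"
  shows "\<bar>bridge_h \<mu> t z - bridge_h \<mu> t z'\<bar> \<le> C / (1 - t) * \<bar>z - z'\<bar>"
proof -
  have s: "0 < t / (1 - t)" using t by simp
  have "t / (1 - t) / (1 + t / (1 - t)) = t" using t by (simp add: field_simps)
  then have "\<bar>bridge_h \<mu> t z - bridge_h \<mu> t z'\<bar> \<le> C * \<bar>z / (1 - t) - z' / (1 - t)\<bar>"
    using bridge_f_lipschitz[OF s, of C] C t by (simp only: bridge_h_eq_f)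
  moreover have "\<bar>z / (1 - t) - z' / (1 - t)\<bar> = \<bar>z - z'\<bar> / (1 - t)"
    using t by (simp only: diff_divide_distrib[symmetric] abs_divide)
  ultimately show ?thesis by simp
qed

end

section \<open>The supremum of Brownian motion\<close>

text \<open>Fourth moments are used because the \<open>2 ^ n\<close> dyadic increments of level
  \<open>n\<close> have squares of total mean 1 on every level, but fourth powers of total mean
  \<open>3 / 2 ^ n\<close>, which is summable with room to spare.\<close>

lemma brownian_increment_moment:
  assumes bm: "standard_brownian_motion M W" and st: "0 \<le> s" "s < t"
  shows "integrable M (\<lambda>\<omega>. (W t \<omega> - W s \<omega>) ^ 4)"
    and "(\<integral>\<omega>. (W t \<omega> - W s \<omega>) ^ 4 \<partial>M) = 3 * (t - s)\<^sup>2"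
proof -
  have d: "distributed M lborel (\<lambda>\<omega>. W t \<omega> - W s \<omega>) (normal_density 0 (sqrt (t - s)))"
    using bm st by (auto simp: standard_brownian_motion_def)
  have pos: "0 < sqrt (t - s)" using st by simp
  have b: "has_bochner_integral lborel (\<lambda>x. normal_density 0 (sqrt (t - s)) x * x ^ 4) (3 * (t - s)\<^sup>2)"
    using normal_moment_even[OF pos, of 0 2] st by (simp add: fact_numeral power_divide field_simps)
  have "integrable lborel (\<lambda>x. normal_density 0 (sqrt (t - s)) x * x ^ 4)" using b by (rule integrable.intros)
  then show "integrable M (\<lambda>\<omega>. (W t \<omega> - W s \<omega>) ^ 4)"
    by (subst distributed_integrable[OF d, symmetric]) auto
  show "(\<integral>\<omega>. (W t \<omega> - W s \<omega>) ^ 4 \<partial>M) = 3 * (t - s)\<^sup>2"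
    using distributed_integral[OF d, of "\<lambda>x. x ^ 4"] has_bochner_integral_integral_eq[OF b] by simp
qed

text \<open>Above the threshold \<open>e\<close> the factor \<open>(\<bar>x\<bar> / e) ^ 3\<close>
  is at least 1. This bounds the largest of many increments by a threshold plus a sum of fourth
  powers.\<close>

lemma abs_le_fourth_power:
  fixes e x :: real
  assumes "0 < e"
  shows "\<bar>x\<bar> \<le> e + x ^ 4 / e ^ 3"
proof (cases "\<bar>x\<bar> \<le> e")
  case True
  have "0 \<le> x ^ 4 / e ^ 3" using assms by simp
  with True show ?thesis by linarith
next
  case False
  then have "e ^ 3 \<le> \<bar>x\<bar> ^ 3" using assms by (intro power_mono) auto
  then have "\<bar>x\<bar> * e ^ 3 \<le> \<bar>x\<bar> * \<bar>x\<bar> ^ 3" by (intro mult_left_mono) auto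
  also have "\<dots> = x ^ 4" using power_even_abs[of 4 x] by (simp add: eval_nat_numeral)
  finally have "\<bar>x\<bar> \<le> x ^ 4 / e ^ 3" using assms by (simp add: field_simps)
  then show ?thesis using assms by linarith
qed

text \<open>A dyadic point of level \<open>n + 1\<close> is a point of level \<open>n\<close> or the
  right neighbour of one, so it is reached from 0 with at most one increment per level.\<close>

lemma dyadic_chaining:
  fixes w :: "real \<Rightarrow> real"
  assumes m: "\<And>n k. k < 2 ^ n \<Longrightarrow> \<bar>w (real (Suc k) / 2 ^ n) - w (real k / 2 ^ n)\<bar> \<le> m n"
    and "w 0 = 0" and "k \<le> 2 ^ n"
  shows "\<bar>w (real k / 2 ^ n)\<bar> \<le> (\<Sum>i\<le>n. m i)"
  using \<open>k \<le> 2 ^ n\<close>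
proof (induction n arbitrary: k)
  case 0
  then consider "k = 0" | "k = 1" by fastforce
  then show ?case
  proof cases
    case 1
    have "0 \<le> m 0" using m[of 0 0] by (simp add: order_trans[OF abs_ge_zero])
    then show ?thesis using 1 \<open>w 0 = 0\<close> by simp
  next
    case 2
    then show ?thesis using m[of 0 0] \<open>w 0 = 0\<close> by simp
  qed
next
  case (Suc n)
  have m0: "0 \<le> m (Suc n)" using m[of 0 "Suc n"] by (simp add: order_trans[OF abs_ge_zero])
  define j where "j = k div 2"
  have j: "j \<le> 2 ^ n" using Suc.prems unfolding j_def by simp
  have half: "real (2 * j) / 2 ^ Suc n = real j / 2 ^ n" by simp
  show ?case
  proof (cases "even k")
    case True
    then have "k = 2 * j" by (simp add: j_def)
    then have "\<bar>w (real k / 2 ^ Suc n)\<bar> \<le> (\<Sum>i\<le>n. m i)" unfolding \<open>k = 2 * j\<close> half by (intro Suc.IH j)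
    then show ?thesis using m0 by simp
  next
    case False
    then have k: "k = Suc (2 * j)" by (simp add: j_def)
    have "2 * j < 2 ^ Suc n" using Suc.prems k by linarith
    then have "\<bar>w (real k / 2 ^ Suc n) - w (real j / 2 ^ n)\<bar> \<le> m (Suc n)"
      using m[of "2 * j" "Suc n"] unfolding half k by blast
    moreover have "\<bar>w (real j / 2 ^ n)\<bar> \<le> (\<Sum>i\<le>n. m i)" by (intro Suc.IH j)
    ultimately show ?thesis by simp
  qed
qed

lemma dyadic_floor_tendsto: "(\<lambda>n. real_of_int \<lfloor>r * 2 ^ n\<rfloor> / 2 ^ n) \<longlonglongrightarrow> r"
proof (rule tendsto_sandwich)
  show "(\<lambda>n. r - (1 / 2) ^ n) \<longlonglongrightarrow> r"
    by (rule tendsto_eq_intros LIMSEQ_power_zero | simp)+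
  have "r - (1 / 2) ^ n \<le> real_of_int \<lfloor>r * 2 ^ n\<rfloor> / 2 ^ n" for n
  proof -
    have "r * 2 ^ n - 1 \<le> real_of_int \<lfloor>r * 2 ^ n\<rfloor>" by linarith
    then have "(r * 2 ^ n - 1) / 2 ^ n \<le> real_of_int \<lfloor>r * 2 ^ n\<rfloor> / 2 ^ n" by (intro divide_right_mono) auto
    then show ?thesis by (simp add: diff_divide_distrib power_divide)
  qed
  then show "\<forall>\<^sub>F n in sequentially. r - (1 / 2) ^ n \<le> real_of_int \<lfloor>r * 2 ^ n\<rfloor> / 2 ^ n" by simp
  have "real_of_int \<lfloor>r * 2 ^ n\<rfloor> / 2 ^ n \<le> r" for n by (simp add: divide_le_eq)
  then show "\<forall>\<^sub>F n in sequentially. real_of_int \<lfloor>r * 2 ^ n\<rfloor> / 2 ^ n \<le> r" by simp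
qed simp

lemma dyadic_chaining_continuous:
  fixes w :: "real \<Rightarrow> real"
  assumes m: "\<And>n k. k < 2 ^ n \<Longrightarrow> \<bar>w (real (Suc k) / 2 ^ n) - w (real k / 2 ^ n)\<bar> \<le> m n"
    and "w 0 = 0" and sm: "summable m" and cont: "continuous_on {0..} w" and r: "r \<in> {0..1}"
  shows "\<bar>w r\<bar> \<le> suminf m"
proof -
  define q where "q n = real (nat \<lfloor>r * 2 ^ n\<rfloor>) / 2 ^ n" for n
  have fl: "real (nat \<lfloor>r * 2 ^ n\<rfloor>) = real_of_int \<lfloor>r * 2 ^ n\<rfloor>" for n :: nat
    using r by (simp add: of_nat_nat)
  have q: "q \<longlonglongrightarrow> r"
    unfolding q_def[abs_def] fl by (rule dyadic_floor_tendsto)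
  have q0: "0 \<le> q n" for n by (simp add: q_def)
  have "(\<lambda>n. w (q n)) \<longlonglongrightarrow> w r"
    by (rule continuous_on_tendsto_compose[OF cont q]) (use r q0 in auto)
  then have "(\<lambda>n. \<bar>w (q n)\<bar>) \<longlonglongrightarrow> \<bar>w r\<bar>" by (rule tendsto_rabs)
  moreover have "\<bar>w (q n)\<bar> \<le> suminf m" for n
  proof -
    have "real (nat \<lfloor>r * 2 ^ n\<rfloor>) \<le> 2 ^ n"
    proof -
      have "r * 2 ^ n \<le> 2 ^ n" using r by (simp add: mult_left_le_one_le)
      then show ?thesis unfolding fl by linarith
    qed
    then have "nat \<lfloor>r * 2 ^ n\<rfloor> \<le> 2 ^ n" by (metis of_nat_le_iff of_nat_numeral of_nat_power)
    then have "\<bar>w (q n)\<bar> \<le> (\<Sum>i\<le>n. m i)"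
      unfolding q_def by (intro dyadic_chaining[OF m \<open>w 0 = 0\<close>])
    also have "\<dots> \<le> suminf m"
    proof (rule sum_le_suminf[OF sm])
      fix n show "0 \<le> m n" using m[of 0 n] by (simp add: order_trans[OF abs_ge_zero])
    qed auto
    finally show ?thesis .
  qed
  ultimately show ?thesis by (intro LIMSEQ_le_const2) auto
qed

text \<open>Chaining with random increments bounds: \<open>m n\<close> dominates all increments of
  level \<open>n\<close>, its mean decays geometrically, and \<open>V\<close> is the sum of the
  \<open>m n\<close>.\<close>

lemma brownian_sup_integrable:
  assumes bm: "standard_brownian_motion M W"
  obtains V where "integrable M V" "AE \<omega> in M. \<forall>r\<in>{0..1}. \<bar>W r \<omega>\<bar> \<le> V \<omega>"
proof -
  interpret prob_space M using bm by (simp add: standard_brownian_motion_def)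
  \<comment> \<open>The fourth powers of level \<open>n\<close> have total mean
    \<open>3 * (1 / 2) ^ n = 3 * \<rho> ^ (8 * n)\<close>. Division by the cube of the threshold
    \<open>\<rho> ^ n\<close> leaves \<open>3 * \<rho> ^ (5 * n)\<close>, so both terms of
    \<open>m n\<close> have geometric means.\<close>
  define \<rho> where "\<rho> = root 8 (1 / 2 :: real)"
  have \<rho>8: "\<rho> ^ 8 = 1 / 2" and \<rho>0: "0 < \<rho>" and \<rho>1: "\<rho> < 1" by (auto simp: \<rho>_def)
  define \<Delta> where "\<Delta> n k \<omega> = W (real (Suc k) / 2 ^ n) \<omega> - W (real k / 2 ^ n) \<omega>" for n k \<omega>
  define m where "m n \<omega> = \<rho> ^ n + (\<Sum>k<2 ^ n. \<Delta> n k \<omega> ^ 4) / (\<rho> ^ n) ^ 3" for n \<omega>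
  have inc: "real (Suc k) / 2 ^ n - real k / 2 ^ n = 1 / 2 ^ n" for k n
    by (simp add: diff_divide_distrib[symmetric])
  have less: "real k / 2 ^ n < real (Suc k) / 2 ^ n" for k n :: nat
    by (intro divide_strict_right_mono) auto
  note mom = brownian_increment_moment[OF bm _ less]
  have \<Delta>int: "integrable M (\<lambda>\<omega>. \<Delta> n k \<omega> ^ 4)" for n k
    unfolding \<Delta>_def by (intro mom) auto
  have \<Delta>exp: "expectation (\<lambda>\<omega>. \<Delta> n k \<omega> ^ 4) = 3 / 4 ^ n" for n k
  proof -
    have "expectation (\<lambda>\<omega>. \<Delta> n k \<omega> ^ 4) = 3 * (1 / 2 ^ n)\<^sup>2"
      unfolding \<Delta>_def inc[of k n, symmetric] by (rule mom(2)) simp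
    also have "\<dots> = 3 / 4 ^ n" by (simp add: power2_eq_square power_mult_distrib[symmetric])
    finally show ?thesis .
  qed
  have mint: "integrable M (m n)" for n
    unfolding m_def using \<Delta>int by (intro Bochner_Integration.integrable_add integrable_divide Bochner_Integration.integrable_sum) auto
  have mnn: "0 \<le> m n \<omega>" for n \<omega>
    unfolding m_def using \<rho>0 by (intro add_nonneg_nonneg divide_nonneg_nonneg sum_nonneg) auto
  have mexp: "expectation (m n) \<le> 4 * \<rho> ^ n" for n
  proof -
    have "expectation (m n) = \<rho> ^ n + (2 ^ n * (3 / 4 ^ n)) / (\<rho> ^ n) ^ 3"
      unfolding m_def using \<Delta>int by (simp add: \<Delta>exp prob_space)
    also have "2 ^ n * (3 / 4 ^ n) = 3 * (1 / 2 :: real) ^ n"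
    proof -
      have "(4 :: real) ^ n = 2 ^ n * 2 ^ n" by (simp add: power_mult_distrib[symmetric])
      then show ?thesis by (simp add: power_divide)
    qed
    also have "(1 / 2) ^ n = (\<rho> ^ n) ^ 8" unfolding \<rho>8[symmetric] by (simp add: power_mult[symmetric] mult.commute)
    also have "3 * (\<rho> ^ n) ^ 8 / (\<rho> ^ n) ^ 3 = 3 * (\<rho> ^ n) ^ 5"
      using \<rho>0 by (simp add: field_simps power_add[symmetric])
    also have "(\<rho> ^ n) ^ 5 \<le> \<rho> ^ n"
      using \<rho>0 \<rho>1 power_decreasing[of 1 5 "\<rho> ^ n"] by (simp add: power_le_one)
    finally show ?thesis by simp
  qed
  have "(\<integral>\<^sup>+\<omega>. (\<Sum>n. ennreal (m n \<omega>)) \<partial>M) = (\<Sum>n. \<integral>\<^sup>+\<omega>. ennreal (m n \<omega>) \<partial>M)"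
    using mint by (intro nn_integral_suminf) auto
  also have "\<dots> = (\<Sum>n. ennreal (expectation (m n)))"
    using mint mnn by (intro suminf_cong nn_integral_eq_integral) auto
  also have "\<dots> \<le> (\<Sum>n. ennreal (4 * \<rho> ^ n))"
    using mexp by (intro suminf_le ennreal_leI) auto
  also have "\<dots> < \<infinity>"
  proof -
    have "summable (\<lambda>n. 4 * \<rho> ^ n)" using \<rho>0 \<rho>1 by (intro summable_mult summable_geometric) auto
    then show ?thesis using \<rho>0 by (subst suminf_ennreal2) auto
  qed
  finally have fin: "(\<integral>\<^sup>+\<omega>. (\<Sum>n. ennreal (m n \<omega>)) \<partial>M) < \<infinity>" .
  have meas[measurable]: "m n \<in> borel_measurable M" for n using mint[of n] by auto
  have aefin: "AE \<omega> in M. (\<Sum>n. ennreal (m n \<omega>)) \<noteq> \<infinity>"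
    by (rule nn_integral_PInf_AE) (use fin in auto)
  define V where "V \<omega> = enn2real (\<Sum>n. ennreal (m n \<omega>))" for \<omega>
  have "integrable M V"
  proof (rule integrableI_bounded)
    show "V \<in> borel_measurable M" unfolding V_def by measurable
    have "(\<integral>\<^sup>+\<omega>. ennreal (norm (V \<omega>)) \<partial>M) = (\<integral>\<^sup>+\<omega>. (\<Sum>n. ennreal (m n \<omega>)) \<partial>M)"
      using aefin by (intro nn_integral_cong_AE) (auto simp: V_def elim!: eventually_mono simp: ennreal_enn2real less_top)
    then show "(\<integral>\<^sup>+\<omega>. ennreal (norm (V \<omega>)) \<partial>M) < \<infinity>" using fin by simp
  qed
  moreover have "AE \<omega> in M. \<forall>r\<in>{0..1}. \<bar>W r \<omega>\<bar> \<le> V \<omega>"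
  proof -
    have "AE \<omega> in M. W 0 \<omega> = 0" using bm by (simp add: standard_brownian_motion_def)
    with aefin AE_space show ?thesis
    proof eventually_elim
      case (elim \<omega>)
      have sm: "summable (\<lambda>n. m n \<omega>)"
        using elim mnn by (intro summable_suminf_not_top) auto
      have V: "V \<omega> = (\<Sum>n. m n \<omega>)"
        unfolding V_def using mnn by (simp add: suminf_ennreal2[OF _ sm] suminf_nonneg[OF sm])
      show ?case
      proof
        fix r :: real assume r: "r \<in> {0..1}"
        show "\<bar>W r \<omega>\<bar> \<le> V \<omega>" unfolding V
        proof (rule dyadic_chaining_continuous[OF _ _ sm _ r])
          show "continuous_on {0..} (\<lambda>r. W r \<omega>)" using bm elim by (simp add: standard_brownian_motion_def)
          fix n k :: nat assume k: "k < 2 ^ n"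
          have "\<bar>\<Delta> n k \<omega>\<bar> \<le> \<rho> ^ n + \<Delta> n k \<omega> ^ 4 / (\<rho> ^ n) ^ 3"
            using \<rho>0 by (intro abs_le_fourth_power) auto
          also have "\<dots> \<le> m n \<omega>" unfolding m_def
            using \<rho>0 k by (intro add_mono divide_right_mono member_le_sum) auto
          finally show "\<bar>W (real (Suc k) / 2 ^ n) \<omega> - W (real k / 2 ^ n) \<omega>\<bar> \<le> m n \<omega>" unfolding \<Delta>_def .
        qed (use elim in auto)
      qed
    qed
  qed
  ultimately show thesis by (rule that)
qed

section \<open>Comparison and growth for integral equations\<close>

text \<open>The sign of \<open>k\<close> is required only inside the interval: at the endpoint where
  a gap between two paths has just closed nothing is known, and two points do not change the
  integral.\<close>

lemma has_integral_increment_le: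
  fixes k G :: "real \<Rightarrow> real"
  assumes k: "\<And>s. s \<in> {0..r} \<Longrightarrow> (k has_integral G s) {0..s}"
    and ab: "0 \<le> a" "a \<le> b" "b \<le> r"
    and neg: "\<And>u. a < u \<Longrightarrow> u < b \<Longrightarrow> k u \<le> 0"
  shows "G b \<le> G a"
proof -
  have kb: "k integrable_on {0..b}" using k[of b] ab by (auto simp: has_integral_integrable)
  have "integral {0..a} k + integral {a..b} k = integral {0..b} k"
    by (rule Henstock_Kurzweil_Integration.integral_combine[OF ab(1,2) kb])
  moreover have "integral {0..a} k = G a" "integral {0..b} k = G b" using k[of a] k[of b] ab by (auto intro: integral_unique)
  moreover have "integral {a..b} k \<le> 0"
  proof -
    have "k integrable_on {a..b}" using kb ab by (intro integrable_subinterval_real[OF kb]) auto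
    then have "(k has_integral integral {a..b} k) {a..b}" by (rule integrable_integral)
    then have "((\<lambda>u. if u \<in> {a, b} then 0 else k u) has_integral integral {a..b} k) {a..b}"
      by (rule has_integral_spike_finite[of "{a, b}", rotated -1]) auto
    then show ?thesis
      by (rule has_integral_le[OF _ has_integral_0]) (use neg in auto)
  qed
  ultimately show ?thesis by linarith
qed

text \<open>After the last time \<open>s0\<close> with \<open>D s0 \<le> 0\<close>, or from the
  start if there is none, the drift only lowers \<open>D\<close>, so \<open>D\<close> exceeds its
  value there by at most an increment of \<open>w\<close>. The two values of \<open>w\<close> give
  \<open>2 * m\<close>.\<close>

lemma contractive_drift_bound:
  fixes D k w :: "real \<Rightarrow> real"
  assumes r: "0 \<le> r" and cont: "continuous_on {0..r} D"
    and k: "\<And>s. s \<in> {0..r} \<Longrightarrow> (k has_integral D s - D 0 - w s) {0..s}"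
    and w: "\<And>s. s \<in> {0..r} \<Longrightarrow> \<bar>w s\<bar> \<le> m"
    and neg: "\<And>u. u \<in> {0..r} \<Longrightarrow> 0 < D u \<Longrightarrow> k u \<le> 0"
  shows "D r \<le> max (D 0) 0 + 2 * m"
proof -
  have m: "0 \<le> m" using w[of 0] r by auto
  have wr: "\<bar>w r\<bar> \<le> m" using w[of r] r by auto
  define S where "S = {u \<in> {0..r}. D u \<le> 0}"
  show ?thesis
  proof (cases "S = {}")
    case True
    have "0 < D u" if "u \<in> {0..r}" for u
    proof -
      have "u \<notin> S" using True by simp
      then show ?thesis using that by (auto simp: S_def)
    qed
    then have "D r - D 0 - w r \<le> D 0 - D 0 - w 0"
      using r by (intro has_integral_increment_le[OF k]) (auto intro!: neg)
    moreover have "w 0 = 0" using integral_unique[OF k[of 0]] r by simp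
    ultimately show ?thesis using wr m by linarith
  next
    case False
    have "closed S" unfolding S_def
      using continuous_closed_preimage[OF cont closed_atLeastAtMost, of "{..0}"] by (simp add: vimage_def Int_def)
    moreover have bdd: "bdd_above S" unfolding S_def by (auto intro: bdd_aboveI[of _ r])
    ultimately have Sup: "Sup S \<in> S" using False by (intro closed_contains_Sup) auto
    define s0 where "s0 = Sup S"
    have s0: "s0 \<in> {0..r}" "D s0 \<le> 0" using Sup by (auto simp: S_def s0_def)
    have "D r - D 0 - w r \<le> D s0 - D 0 - w s0"
    proof (rule has_integral_increment_le[OF k])
      fix u assume u: "s0 < u" "u < r"
      then have "u \<notin> S" using cSup_upper[OF _ bdd, of u] by (auto simp: s0_def)
      then show "k u \<le> 0" using u s0 by (intro neg) (auto simp: S_def)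
    qed (use s0 r in auto)
    moreover have "\<bar>w s0\<bar> \<le> m" using w[of s0] s0 by auto
    ultimately show ?thesis using wr s0 by linarith
  qed
qed

text \<open>Before the first time at which \<open>D\<close> could be nonpositive the drift is
  nonnegative, so \<open>D\<close> would still be at least \<open>D 0 > 0\<close> at that time;
  hence \<open>D\<close> stays positive and the drift nonnegative throughout.\<close>

lemma expansive_drift_bound:
  fixes D k :: "real \<Rightarrow> real"
  assumes r: "0 \<le> r" and cont: "continuous_on {0..r} D" and D0: "0 < D 0"
    and k: "\<And>s. s \<in> {0..r} \<Longrightarrow> (k has_integral D s - D 0) {0..s}"
    and pos: "\<And>u. u \<in> {0..r} \<Longrightarrow> 0 < D u \<Longrightarrow> 0 \<le> k u"
  shows "D 0 \<le> D r"
proof -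
  have k': "((\<lambda>u. - k u) has_integral - (D s - D 0)) {0..s}" if "s \<in> {0..r}" for s
    using has_integral_neg[OF k[OF that]] .
  define S where "S = {u \<in> {0..r}. D u \<le> 0}"
  have S: "S = {}"
  proof (rule ccontr)
    assume ne: "S \<noteq> {}"
    have "closed S" unfolding S_def
      using continuous_closed_preimage[OF cont closed_atLeastAtMost, of "{..0}"] by (simp add: vimage_def Int_def)
    moreover have bdd: "bdd_below S" unfolding S_def by (auto intro: bdd_belowI[of _ 0])
    ultimately have Inf: "Inf S \<in> S" using ne by (intro closed_contains_Inf) auto
    define s0 where "s0 = Inf S"
    have s0: "s0 \<in> {0..r}" "D s0 \<le> 0" using Inf by (auto simp: S_def s0_def)
    have "- (D s0 - D 0) \<le> - (D 0 - D 0)"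
    proof (rule has_integral_increment_le[OF k'])
      fix u assume u: "0 < u" "u < s0"
      then have "u \<notin> S" using cInf_lower[OF _ bdd, of u] by (auto simp: s0_def)
      then show "- k u \<le> 0" using u s0 pos[of u] by (auto simp: S_def)
    qed (use s0 r in auto)
    then show False using D0 s0 by linarith
  qed
  have "0 < D u" if "u \<in> {0..r}" for u
  proof -
    have "u \<notin> S" using S by simp
    then show ?thesis using that by (auto simp: S_def)
  qed
  then have "- (D r - D 0) \<le> - (D 0 - D 0)"
    using r by (intro has_integral_increment_le[OF k']) (auto intro!: pos)
  then show ?thesis by simp
qed

text \<open>The function \<open>exp (- (K * s)) * (A + K * integral {0..s} \<phi>)\<close> is
  decreasing in \<open>s\<close> and starts at \<open>A\<close>.\<close>

lemma gronwall:
  fixes \<phi> :: "real \<Rightarrow> real"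
  assumes r: "0 \<le> r" and K: "0 \<le> K" and cont: "continuous_on {0..r} \<phi>"
    and le: "\<And>s. s \<in> {0..r} \<Longrightarrow> \<phi> s \<le> A + K * integral {0..s} \<phi>"
  shows "\<phi> r \<le> A * exp (K * r)"
proof -
  define I where "I s = integral {0..s} \<phi>" for s
  define \<psi> where "\<psi> s = exp (- (K * s)) * (A + K * I s)" for s
  have Icont: "continuous_on {0..r} I" unfolding I_def
    by (intro indefinite_integral_continuous_1 integrable_continuous_real cont)
  have "\<psi> r \<le> \<psi> 0"
  proof (rule DERIV_nonpos_imp_decreasing_open[OF r])
    show "continuous_on {0..r} \<psi>" unfolding \<psi>_def by (intro continuous_intros Icont)
    fix x assume x: "0 < x" "x < r"
    have "(I has_real_derivative \<phi> x) (at x within {0..r})" unfolding I_def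
      by (rule integral_has_real_derivative[OF cont]) (use x in auto)
    then have dI: "(I has_real_derivative \<phi> x) (at x)" using x by (simp add: at_within_Icc_at)
    have "(\<psi> has_real_derivative exp (- (K * x)) * (- K) * (A + K * I x) + exp (- (K * x)) * (K * \<phi> x)) (at x)"
      unfolding \<psi>_def by (auto intro!: derivative_eq_intros dI)
    moreover have "exp (- (K * x)) * (- K) * (A + K * I x) + exp (- (K * x)) * (K * \<phi> x)
      = - (exp (- (K * x)) * K * ((A + K * I x) - \<phi> x))" by (simp add: algebra_simps)
    moreover have "0 \<le> exp (- (K * x)) * K * ((A + K * I x) - \<phi> x)"
      using le[of x] x K by (intro mult_nonneg_nonneg) (auto simp: I_def)
    ultimately show "\<exists>y. (\<psi> has_real_derivative y) (at x) \<and> y \<le> 0" by (metis neg_le_0_iff_le)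
  qed
  then have "exp (- (K * r)) * (A + K * I r) \<le> A" by (simp add: \<psi>_def I_def)
  then have "exp (K * r) * (exp (- (K * r)) * (A + K * I r)) \<le> exp (K * r) * A" by (rule mult_left_mono) simp
  then have "A + K * I r \<le> A * exp (K * r)" by (simp add: mult.assoc[symmetric] exp_add[symmetric] mult.commute)
  then show ?thesis using le[of r] r by (auto simp: I_def)
qed

text \<open>It serves twice: with \<open>c = 1\<close> for the growth of a single path, and with
  \<open>c = 0\<close>, \<open>m = 0\<close> for Lipschitz dependence on the starting point. The
  growth condition leaves out \<open>u = 0\<close>, which may correspond to time 0.\<close>

lemma linear_growth_bound:
  fixes D k w :: "real \<Rightarrow> real"
  assumes r: "0 \<le> r" and K: "0 \<le> K" and c: "0 \<le> c" and cont: "continuous_on {0..r} D"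
    and k: "\<And>s. s \<in> {0..r} \<Longrightarrow> (k has_integral D s - D 0 - w s) {0..s}"
    and w: "\<And>s. s \<in> {0..r} \<Longrightarrow> \<bar>w s\<bar> \<le> m"
    and growth: "\<And>u. 0 < u \<Longrightarrow> u \<le> r \<Longrightarrow> \<bar>k u\<bar> \<le> K * (c + \<bar>D u\<bar>)"
  shows "\<bar>D r\<bar> \<le> (c + \<bar>D 0\<bar> + m) * exp (K * r)"
proof -
  have "c + \<bar>D r\<bar> \<le> (c + \<bar>D 0\<bar> + m) * exp (K * r)"
  proof (rule gronwall[OF r K])
    show "continuous_on {0..r} (\<lambda>s. c + \<bar>D s\<bar>)" by (intro continuous_intros cont)
    fix s assume s: "s \<in> {0..r}"
    have ks: "((\<lambda>u. if u \<in> {0} then 0 else k u) has_integral D s - D 0 - w s) {0..s}"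
      by (rule has_integral_spike_finite[of "{0}", OF _ _ k[OF s]]) auto
    have "continuous_on {0..s} (\<lambda>s. K * (c + \<bar>D s\<bar>))"
      by (intro continuous_intros continuous_on_subset[OF cont]) (use s in auto)
    then have int: "(\<lambda>s. K * (c + \<bar>D s\<bar>)) integrable_on {0..s}" by (rule integrable_continuous_real)
    have "norm (integral {0..s} (\<lambda>u. if u \<in> {0} then 0 else k u)) \<le> integral {0..s} (\<lambda>u. K * (c + \<bar>D u\<bar>))"
      by (rule integral_norm_bound_integral[OF has_integral_integrable[OF ks] int])
         (use growth s K c in auto)
    then have "\<bar>D s - D 0 - w s\<bar> \<le> integral {0..s} (\<lambda>u. K * (c + \<bar>D u\<bar>))"
      unfolding integral_unique[OF ks] real_norm_def .
    then have "\<bar>D s - D 0 - w s\<bar> \<le> K * integral {0..s} (\<lambda>u. c + \<bar>D u\<bar>)" by simp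
    then show "c + \<bar>D s\<bar> \<le> (c + \<bar>D 0\<bar> + m) + K * integral {0..s} (\<lambda>u. c + \<bar>D u\<bar>)"
      using w[OF s] by linarith
  qed
  then show ?thesis using c by linarith
qed

section \<open>Linear growth of increasing drifts\<close>

text \<open>A convex function below a quadratic and not too low at one point \<open>x0\<close> has
  slopes of linear growth. The tangent at \<open>x0\<close> bounds \<open>L z\<close> from below;
  steps of length \<open>1 + \<bar>z\<bar>\<close> to either side of \<open>z\<close> then bound
  \<open>d z * (1 + \<bar>z\<bar>)\<close> by a quadratic.\<close>

lemma quadratic_convex_imp_linear_growth:
  fixes L d :: "real \<Rightarrow> real"
  assumes tangent: "\<And>x z. L z + d z * (x - z) \<le> L x"
    and upper: "\<And>x. L x \<le> A * (1 + \<bar>x\<bar>)\<^sup>2"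
    and x0: "\<bar>x0\<bar> \<le> R" "- b \<le> L x0" and nonneg: "0 \<le> A" "0 \<le> b" "0 \<le> R"
  shows "\<bar>d z\<bar> \<le> (4 * A + b + (A * (2 + R)\<^sup>2 + b) * (1 + R)) * (1 + \<bar>z\<bar>)"
proof -
  \<comment> \<open>This bounds the slope at \<open>x0\<close>: the points \<open>x0 + 1\<close> and
    \<open>x0 - 1\<close> have absolute value at most \<open>1 + R\<close>, where \<open>L\<close>
    is at most \<open>A * (2 + R)\<^sup>2\<close>.\<close>
  define C where "C = A * (2 + R)\<^sup>2 + b"
  have C0: "0 \<le> C" using nonneg by (simp add: C_def)
  have up: "L x \<le> A * (2 + R)\<^sup>2" if "\<bar>x\<bar> \<le> 1 + R" for x
    using upper[of x] mult_left_mono[OF power_mono[of "1 + \<bar>x\<bar>" "2 + R" 2] nonneg(1)] that by auto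
  have "\<bar>d x0\<bar> \<le> C"
    using tangent[of x0 "x0 + 1"] tangent[of x0 "x0 - 1"] up[of "x0 + 1"] up[of "x0 - 1"] x0
    unfolding C_def by (simp add: abs_le_iff)
  moreover have "\<bar>z - x0\<bar> \<le> \<bar>z\<bar> + R" using x0 by linarith
  ultimately have "\<bar>d x0 * (z - x0)\<bar> \<le> C * (\<bar>z\<bar> + R)"
    unfolding abs_mult using C0 by (intro mult_mono) auto
  then have low: "- b - C * (\<bar>z\<bar> + R) \<le> L z" using tangent[of x0 z] x0 by linarith
  have up2: "L x \<le> 4 * A * (1 + \<bar>z\<bar>)\<^sup>2" if "\<bar>x\<bar> \<le> 1 + 2 * \<bar>z\<bar>" for x
  proof -
    have "(1 + \<bar>x\<bar>)\<^sup>2 \<le> (2 * (1 + \<bar>z\<bar>))\<^sup>2" using that by (intro power_mono) auto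
    then have "(1 + \<bar>x\<bar>)\<^sup>2 \<le> 4 * (1 + \<bar>z\<bar>)\<^sup>2" by (simp only: power_mult_distrib) simp
    from mult_left_mono[OF this nonneg(1)] upper[of x] show ?thesis by simp
  qed
  have "L z + d z * (1 + \<bar>z\<bar>) \<le> L (z + (1 + \<bar>z\<bar>))" "L z - d z * (1 + \<bar>z\<bar>) \<le> L (z - (1 + \<bar>z\<bar>))"
    using tangent[of z "z + (1 + \<bar>z\<bar>)"] tangent[of z "z - (1 + \<bar>z\<bar>)"] by (auto simp: algebra_simps)
  moreover have "L (z + (1 + \<bar>z\<bar>)) \<le> 4 * A * (1 + \<bar>z\<bar>)\<^sup>2" "L (z - (1 + \<bar>z\<bar>)) \<le> 4 * A * (1 + \<bar>z\<bar>)\<^sup>2"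
    by (intro up2; linarith)+
  ultimately have "\<bar>d z * (1 + \<bar>z\<bar>)\<bar> \<le> 4 * A * (1 + \<bar>z\<bar>)\<^sup>2 + b + C * (\<bar>z\<bar> + R)"
    using low by (intro abs_leI) linarith+
  also have "\<dots> \<le> (4 * A + b + C * (1 + R)) * (1 + \<bar>z\<bar>)\<^sup>2"
  proof -
    have sq: "1 + \<bar>z\<bar> \<le> (1 + \<bar>z\<bar>)\<^sup>2" using mult_left_mono[of 1 "1 + \<bar>z\<bar>" "1 + \<bar>z\<bar>"] by (simp add: power2_eq_square)
    have "b * 1 \<le> b * (1 + \<bar>z\<bar>)\<^sup>2" using sq nonneg by (intro mult_left_mono) auto
    moreover have "\<bar>z\<bar> + R \<le> (1 + R) * (1 + \<bar>z\<bar>)" using nonneg by (simp add: algebra_simps)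
    then have "\<bar>z\<bar> + R \<le> (1 + R) * (1 + \<bar>z\<bar>)\<^sup>2" using sq nonneg mult_left_mono[OF sq, of "1 + R"] by linarith
    then have "C * (\<bar>z\<bar> + R) \<le> C * ((1 + R) * (1 + \<bar>z\<bar>)\<^sup>2)" using C0 by (intro mult_left_mono) auto
    ultimately show ?thesis by (simp add: algebra_simps)
  qed
  finally have "\<bar>d z\<bar> * (1 + \<bar>z\<bar>) \<le> ((4 * A + b + C * (1 + R)) * (1 + \<bar>z\<bar>)) * (1 + \<bar>z\<bar>)"
    by (simp add: abs_mult power2_eq_square mult.assoc)
  then show ?thesis unfolding C_def by (rule mult_right_le_imp_le) auto
qed

text \<open>
  \<open>bridge_density \<mu> t x\<close> is the integral of the Gaussian density with mean \<open>x\<close> and variance \<open>1 - t\<close>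
  against \<open>\<mu>\<close> weighted by the reciprocal of the standard Gaussian density. It solves the backward
  heat equation, and its logarithmic derivative in \<open>x\<close> is the drift of the bridge.
\<close>

definition bridge_density :: "real measure \<Rightarrow> real \<Rightarrow> real \<Rightarrow> real" where
  "bridge_density \<mu> t x = exp (- x\<^sup>2 / (2 * (1 - t))) / sqrt (1 - t) * tilted_moment \<mu> 0 (t / (1 - t)) (x / (1 - t))"

definition bridge_drift :: "real measure \<Rightarrow> real \<Rightarrow> real \<Rightarrow> real" where
  "bridge_drift \<mu> t z = (bridge_h \<mu> t z - z) / (1 - t)"

lemma nn_integral_normal_density: "0 < \<sigma> \<Longrightarrow> (\<integral>\<^sup>+x. ennreal (normal_density m \<sigma> x) \<partial>lborel) = 1"
  by (subst nn_integral_eq_integral) (auto simp: integrable_normal_density integral_normal_density)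

text \<open>Chebyshev's inequality: a point outside the window is at distance at least 1 from
  \<open>u\<close>, so the mass outside is at most the variance.\<close>

lemma normal_window_mass:
  assumes \<sigma>: "0 < \<sigma>" "\<sigma>\<^sup>2 \<le> 1 / 2" and u: "\<bar>u\<bar> \<le> R - 1"
  shows "ennreal (1 / 2) \<le> (\<integral>\<^sup>+x. indicator {-R..R} x * ennreal (normal_density u \<sigma> x) \<partial>lborel)" (is "_ \<le> ?I")
proof -
  have mom: "has_bochner_integral lborel (\<lambda>x. normal_density u \<sigma> x * (x - u)\<^sup>2) (\<sigma>\<^sup>2)"
    proof -
    have "fact (2 * 1) / ((2 / \<sigma>\<^sup>2) ^ 1 * fact 1) = \<sigma>\<^sup>2" by (simp add: fact_numeral)
    then show ?thesis using normal_moment_even[OF \<sigma>(1), of u 1] by (simp only: mult_1_right)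
  qed
  have "1 = (\<integral>\<^sup>+x. ennreal (normal_density u \<sigma> x) \<partial>lborel)" using nn_integral_normal_density[OF \<sigma>(1)] by simp
  also have "\<dots> \<le> (\<integral>\<^sup>+x. indicator {-R..R} x * ennreal (normal_density u \<sigma> x) + ennreal (normal_density u \<sigma> x * (x - u)\<^sup>2) \<partial>lborel)"
  proof (rule nn_integral_mono)
    fix x :: real
    show "ennreal (normal_density u \<sigma> x)
      \<le> indicator {-R..R} x * ennreal (normal_density u \<sigma> x) + ennreal (normal_density u \<sigma> x * (x - u)\<^sup>2)"
    proof (cases "x \<in> {-R..R}")
      case True
      then show ?thesis by simp
    next
      case False
      then have "1 \<le> \<bar>x - u\<bar>" using u by auto
      then have "1 \<le> \<bar>x - u\<bar>\<^sup>2" by (rule one_le_power)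
      then have "normal_density u \<sigma> x * 1 \<le> normal_density u \<sigma> x * (x - u)\<^sup>2" by (intro mult_left_mono) auto
      then show ?thesis using False by (simp add: ennreal_leI)
    qed
  qed
  also have "\<dots> = ?I + (\<integral>\<^sup>+x. ennreal (normal_density u \<sigma> x * (x - u)\<^sup>2) \<partial>lborel)"
    by (rule nn_integral_add) auto
  also have "(\<integral>\<^sup>+x. ennreal (normal_density u \<sigma> x * (x - u)\<^sup>2) \<partial>lborel) = ennreal (\<sigma>\<^sup>2)"
    using mom by (subst nn_integral_eq_integral) (auto simp: has_bochner_integral_iff)
  also have "?I + ennreal (\<sigma>\<^sup>2) \<le> ?I + ennreal (1 / 2)" using \<sigma> by (intro add_left_mono ennreal_leI)
  finally have "1 \<le> ?I + ennreal (1 / 2)" .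
  then show ?thesis
  proof (cases ?I)
    case (real r)
    then have "ennreal 1 \<le> ennreal (r + 1 / 2)" using \<open>1 \<le> ?I + _\<close> by (simp only: ennreal_plus) simp
    then have "1 / 2 \<le> r" using real by (subst (asm) ennreal_le_iff) auto
    then show ?thesis unfolding real(2) by (rule ennreal_leI)
  qed auto
qed

section \<open>Bridge density: heat equation, log-convexity and bounds\<close>

context
  fixes \<mu> :: "real measure"
  assumes \<mu>: "real_distribution \<mu>"
begin

interpretation real_distribution \<mu> by (rule \<mu>)

lemma tilted_moment_measurable:
  "(\<lambda>x. tilted_moment \<mu> k (fst x) (snd x)) \<in> borel_measurable (borel \<Otimes>\<^sub>M borel)"
  unfolding tilted_moment_def by measurable

lemma bridge_density_pos: "0 < t \<Longrightarrow> t < 1 \<Longrightarrow> 0 < bridge_density \<mu> t x"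
  unfolding bridge_density_def by (intro mult_pos_pos divide_pos_pos tilted_moment_0_pos[OF \<mu>]) auto

lemma ln_bridge_density_derivative:
  assumes t: "0 < t" "t < 1"
  shows "((\<lambda>x. ln (bridge_density \<mu> t x)) has_real_derivative bridge_drift \<mu> t x) (at x)"
proof -
  let ?s = "t / (1 - t)"
  have s: "0 < ?s" using t by simp
  note pos = tilted_moment_0_pos[OF \<mu> s]
  have eq: "ln (bridge_density \<mu> t x) = - x\<^sup>2 / (2 * (1 - t)) - ln (sqrt (1 - t)) + ln (tilted_moment \<mu> 0 ?s (x / (1 - t)))" for x
    unfolding bridge_density_def using pos[of "x / (1 - t)"] t by (subst ln_mult) (auto simp: ln_div)
  have lin: "((\<lambda>x. x * (1 / (1 - t))) has_real_derivative 1 / (1 - t)) (at x)"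
    using DERIV_cmult_right[OF DERIV_ident, of "1 / (1 - t)" x] by simp
  have moment: "(tilted_moment \<mu> 0 ?s has_real_derivative tilted_moment \<mu> 1 ?s y) (at y)" for y
    using tilted_moment_has_derivative[OF \<mu> s, of 0 y] by simp
  have "((\<lambda>x. ln (tilted_moment \<mu> 0 ?s (x * (1 / (1 - t))))) has_real_derivative
      1 / tilted_moment \<mu> 0 ?s (x * (1 / (1 - t))) * (tilted_moment \<mu> 1 ?s (x * (1 / (1 - t))) * (1 / (1 - t)))) (at x)"
    by (rule DERIV_chain2[OF DERIV_ln_divide[OF pos] DERIV_chain2[OF moment lin]])
  then have 1: "((\<lambda>x. ln (tilted_moment \<mu> 0 ?s (x / (1 - t)))) has_real_derivative bridge_h \<mu> t x / (1 - t)) (at x)"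
    using t by (simp add: bridge_h_eq_f[OF \<mu>] bridge_f_eq[OF \<mu>])
  have "((\<lambda>x. - x\<^sup>2 / (2 * (1 - t))) has_real_derivative - x / (1 - t)) (at x)"
  proof -
    have "((\<lambda>x. x\<^sup>2) has_real_derivative 2 * x) (at x)" by (auto intro!: derivative_eq_intros)
    note DERIV_cmult_right[OF this, of "- 1 / (2 * (1 - t))"]
    moreover have "y\<^sup>2 * (- 1 / (2 * (1 - t))) = - y\<^sup>2 / (2 * (1 - t))" for y by simp
    moreover have "2 * x * (- 1 / (2 * (1 - t))) = - x / (1 - t)" using t by (simp add: field_simps)
    ultimately show ?thesis by (simp only:)
  qed
  then have "((\<lambda>x. - x\<^sup>2 / (2 * (1 - t)) - ln (sqrt (1 - t)) + ln (tilted_moment \<mu> 0 ?s (x / (1 - t))))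
      has_real_derivative - x / (1 - t) - 0 + bridge_h \<mu> t x / (1 - t)) (at x)"
    by (intro DERIV_add DERIV_diff 1 DERIV_const)
  moreover have "- x / (1 - t) - 0 + bridge_h \<mu> t x / (1 - t) = bridge_drift \<mu> t x"
    by (simp add: bridge_drift_def diff_divide_distrib)
  ultimately show ?thesis unfolding eq by simp
qed

text \<open>An increasing drift is an increasing derivative of
  \<open>ln (bridge_density \<mu> t)\<close>, so this function is convex.\<close>

lemma bridge_density_tangent:
  assumes t: "0 < t" "t < 1" and mono: "mono (\<lambda>z. bridge_h \<mu> t z - z)"
  shows "ln (bridge_density \<mu> t z) + bridge_drift \<mu> t z * (x - z) \<le> ln (bridge_density \<mu> t x)"
proof -
  have "convex_on UNIV (\<lambda>x. ln (bridge_density \<mu> t x))"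
    by (rule convex_on_realI[OF _ ln_bridge_density_derivative[OF t]])
       (use t monoD[OF mono] in \<open>auto simp: bridge_drift_def intro!: divide_right_mono\<close>)
  from convex_on_imp_above_tangent[OF this _ _ _ ln_bridge_density_derivative[OF t], of z x]
  show ?thesis by simp
qed

text \<open>Completing the square gives the Gaussian kernel form. It is stated as a nonnegative
  integral so that integrals can be interchanged without integrability conditions.\<close>

lemma bridge_density_nn_integral:
  assumes t: "0 < t" "t < 1"
  shows "ennreal (bridge_density \<mu> t x) =
    (\<integral>\<^sup>+u. ennreal (normal_density 0 (sqrt (1 - t)) (u - x) * (sqrt (2 * pi) * exp (u\<^sup>2 / 2))) \<partial>\<mu>)"
proof -
  have eq: "normal_density 0 (sqrt (1 - t)) (u - x) * (sqrt (2 * pi) * exp (u\<^sup>2 / 2)) =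
    exp (- x\<^sup>2 / (2 * (1 - t))) / sqrt (1 - t) * (u ^ 0 * exp (u * (x / (1 - t)) - u\<^sup>2 * (t / (1 - t)) / 2))" for u
  proof -
    have "- (u - x)\<^sup>2 / (2 * (1 - t)) + u\<^sup>2 / 2 = - x\<^sup>2 / (2 * (1 - t)) + (u * (x / (1 - t)) - u\<^sup>2 * (t / (1 - t)) / 2)"
    proof -
      define a where "a = 1 - t"
      have a: "a \<noteq> 0" "t = 1 - a" using t by (auto simp: a_def)
      have "- (u - x)\<^sup>2 / (2 * a) + u\<^sup>2 / 2 = - x\<^sup>2 / (2 * a) + (u * (x / a) - u\<^sup>2 * ((1 - a) / a) / 2)"
        using a(1) by (simp add: field_simps power2_eq_square)
      then show ?thesis by (simp add: a_def)
    qed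
    then have "exp (- (u - x)\<^sup>2 / (2 * (1 - t))) * exp (u\<^sup>2 / 2) =
      exp (- x\<^sup>2 / (2 * (1 - t))) * exp (u * (x / (1 - t)) - u\<^sup>2 * (t / (1 - t)) / 2)"
      by (simp only: exp_add[symmetric])
    moreover have "normal_density 0 (sqrt (1 - t)) (u - x) = exp (- (u - x)\<^sup>2 / (2 * (1 - t))) / (sqrt (2 * pi) * sqrt (1 - t))"
      using t by (simp add: normal_density_def real_sqrt_mult)
    ultimately show ?thesis by (simp add: field_simps)
  qed
  have "0 < t / (1 - t)" using t by simp
  note int = integrable_tilted[OF \<mu> this, of 0 "x / (1 - t)"]
  have "0 \<le> exp (- x\<^sup>2 / (2 * (1 - t))) / sqrt (1 - t)" using t by simp
  then show ?thesis unfolding bridge_density_def tilted_moment_def eq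
    by (subst nn_integral_eq_integral) (use int t in \<open>auto intro!: AE_I2 mult_nonneg_nonneg divide_nonneg_nonneg\<close>)
qed

lemma bridge_density_measurable: "bridge_density \<mu> t \<in> borel_measurable borel"
proof -
  have "(\<lambda>x. tilted_moment \<mu> 0 (fst (t / (1 - t), x / (1 - t))) (snd (t / (1 - t), x / (1 - t)))) \<in> borel_measurable borel"
    by (rule measurable_compose[OF _ tilted_moment_measurable]) measurable
  then have [measurable]: "(\<lambda>x. tilted_moment \<mu> 0 (t / (1 - t)) (x / (1 - t))) \<in> borel_measurable borel" by simp
  show ?thesis unfolding bridge_density_def[abs_def] by measurable
qed

text \<open>The semigroup property of Gaussian kernels: after interchanging the integrals the
  variances \<open>1 - t\<close> and \<open>t - t0\<close> add up to \<open>1 - t0\<close>.\<close>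

lemma bridge_density_convolution:
  assumes t: "0 < t0" "t0 < t" "t < 1"
  shows "(\<integral>\<^sup>+x. ennreal (bridge_density \<mu> t (z + x) * normal_density 0 (sqrt (t - t0)) x) \<partial>lborel) = ennreal (bridge_density \<mu> t0 z)"
proof -
  let ?n = "normal_density 0"
  let ?w = "\<lambda>u. sqrt (2 * pi) * exp (u\<^sup>2 / 2) :: real"
  interpret lb: sigma_finite_measure "lborel :: real measure" by (rule sigma_finite_lborel)
  interpret pair_sigma_finite "lborel :: real measure" \<mu> ..
  have "(\<integral>\<^sup>+x. ennreal (bridge_density \<mu> t (z + x) * ?n (sqrt (t - t0)) x) \<partial>lborel)
    = (\<integral>\<^sup>+x. \<integral>\<^sup>+u. ennreal (?n (sqrt (1 - t)) (u - (z + x)) * ?w u) * ennreal (?n (sqrt (t - t0)) x) \<partial>\<mu> \<partial>lborel)"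
    using t bridge_density_pos[of t]
    by (intro nn_integral_cong)
       (simp add: ennreal_mult'' bridge_density_nn_integral nn_integral_multc)
  also have "\<dots> = (\<integral>\<^sup>+u. \<integral>\<^sup>+x. ennreal (?n (sqrt (1 - t)) (u - (z + x)) * ?w u) * ennreal (?n (sqrt (t - t0)) x) \<partial>lborel \<partial>\<mu>)"
    by (rule Fubini'[symmetric]) measurable
  also have "\<dots> = (\<integral>\<^sup>+u. ennreal (?n (sqrt (1 - t0)) (u - z) * ?w u) \<partial>\<mu>)"
  proof (rule nn_integral_cong)
    fix u
    have pos: "0 < sqrt (1 - t)" "0 < sqrt (t - t0)" using t by auto
    have "(\<integral>\<^sup>+x. ennreal (?n (sqrt (1 - t)) (u - (z + x)) * ?w u) * ennreal (?n (sqrt (t - t0)) x) \<partial>lborel)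
      = (\<integral>\<^sup>+x. ennreal (?w u) * ennreal (?n (sqrt (1 - t)) (u - z - x) * ?n (sqrt (t - t0)) x) \<partial>lborel)"
      by (intro nn_integral_cong) (simp add: ennreal_mult[symmetric] diff_diff_eq mult_ac)
    also have "\<dots> = ennreal (?w u) * (\<integral>\<^sup>+x. ennreal (?n (sqrt (1 - t)) (u - z - x) * ?n (sqrt (t - t0)) x) \<partial>lborel)"
      by (rule nn_integral_cmult) measurable
    also have "(\<integral>\<^sup>+x. ennreal (?n (sqrt (1 - t)) (u - z - x) * ?n (sqrt (t - t0)) x) \<partial>lborel)
      = ?n (sqrt ((sqrt (1 - t))\<^sup>2 + (sqrt (t - t0))\<^sup>2)) (u - z)"
      using fun_cong[OF conv_normal_density_zero_mean[OF pos], of "u - z"] .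
    also have "(sqrt (1 - t))\<^sup>2 + (sqrt (t - t0))\<^sup>2 = 1 - t0" using t by simp
    finally show "(\<integral>\<^sup>+x. ennreal (?n (sqrt (1 - t)) (u - (z + x)) * ?w u) * ennreal (?n (sqrt (t - t0)) x) \<partial>lborel)
      = ennreal (?n (sqrt (1 - t0)) (u - z) * ?w u)"
      by (simp add: ennreal_mult[symmetric] mult.commute)
  qed
  also have "\<dots> = ennreal (bridge_density \<mu> t0 z)" using t by (simp add: bridge_density_nn_integral)
  finally show ?thesis .
qed

text \<open>Jensen's inequality by symmetry: the density at time \<open>t0\<close> averages the one
  at time \<open>t\<close> against a centred Gaussian, and by convexity the mean of the values at
  \<open>z + x\<close> and \<open>z - x\<close> is at least the value at \<open>z\<close>.\<close>

lemma bridge_density_decreasing: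
  assumes t: "0 < t0" "t0 < t" "t < 1" and mono: "mono (\<lambda>z. bridge_h \<mu> t z - z)"
  shows "bridge_density \<mu> t z \<le> bridge_density \<mu> t0 z"
proof -
  define q where "q = bridge_density \<mu> t"
  define n where "n = normal_density 0 (sqrt (t - t0))"
  have [measurable]: "q \<in> borel_measurable borel" unfolding q_def by (rule bridge_density_measurable)
  have [measurable]: "n \<in> borel_measurable borel" unfolding n_def by simp
  have q0: "0 < q x" for x unfolding q_def using t by (intro bridge_density_pos) auto
  have n0: "0 \<le> n x" "n (- x) = n x" for x unfolding n_def by (auto simp: normal_density_def)
  have conv: "(\<integral>\<^sup>+x. ennreal (q (z + x) * n x) \<partial>lborel) = ennreal (bridge_density \<mu> t0 z)"
    unfolding q_def n_def by (rule bridge_density_convolution[OF t])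
  also have "(\<integral>\<^sup>+x. ennreal (q (z + x) * n x) \<partial>lborel) = (\<integral>\<^sup>+x. ennreal (q (z - x) * n x) \<partial>lborel)"
    by (subst nn_integral_real_affine[where c="-1" and t=0]) (auto simp: n0)
  finally have conv': "(\<integral>\<^sup>+x. ennreal (q (z - x) * n x) \<partial>lborel) = ennreal (bridge_density \<mu> t0 z)" .
  have two: "2 * q z \<le> q (z + x) + q (z - x)" for x
  proof -
    let ?a = "bridge_drift \<mu> t z * x"
    have tang: "q z * exp (bridge_drift \<mu> t z * y) \<le> q (z + y)" for y
    proof -
      have "exp (ln (q z) + bridge_drift \<mu> t z * y) \<le> exp (ln (q (z + y)))"
        using bridge_density_tangent[OF _ t(3) mono, of z "z + y"] t by (simp add: q_def)
      then show ?thesis using q0 by (simp add: exp_add)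
    qed
    \<comment> \<open>The tangent bound for the logarithm, used at \<open>x\<close> and at
      \<open>- x\<close>, reduces midpoint convexity of \<open>q\<close> to this inequality.\<close>
    have "2 \<le> exp ?a + exp (- ?a)" using exp_ge_add_one_self[of ?a] exp_ge_add_one_self[of "- ?a"] by linarith
    then have "q z * 2 \<le> q z * (exp ?a + exp (- ?a))" using q0[of z] by (intro mult_left_mono) auto
    then show ?thesis using tang[of x] tang[of "- x"] by (simp add: distrib_left)
  qed
  have "ennreal (2 * q z) = ennreal (2 * q z) * (\<integral>\<^sup>+x. ennreal (n x) \<partial>lborel)"
    using t by (simp add: n_def nn_integral_normal_density)
  also have "\<dots> = (\<integral>\<^sup>+x. ennreal (2 * q z) * ennreal (n x) \<partial>lborel)"
    by (rule nn_integral_cmult[symmetric]) measurable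
  also have "\<dots> \<le> (\<integral>\<^sup>+x. ennreal (q (z + x) * n x) + ennreal (q (z - x) * n x) \<partial>lborel)"
  proof (rule nn_integral_mono)
    fix x
    have "2 * q z * n x \<le> (q (z + x) + q (z - x)) * n x" using two n0 by (intro mult_right_mono) auto
    then show "ennreal (2 * q z) * ennreal (n x) \<le> ennreal (q (z + x) * n x) + ennreal (q (z - x) * n x)"
      using q0 n0 by (simp add: ennreal_mult'[symmetric] ennreal_plus[symmetric] less_imp_le distrib_right ennreal_leI del: ennreal_plus)
  qed
  also have "\<dots> = ennreal (bridge_density \<mu> t0 z) + ennreal (bridge_density \<mu> t0 z)"
    by (subst nn_integral_add) (auto simp: conv conv')
  also have "\<dots> = ennreal (2 * bridge_density \<mu> t0 z)"
    using bridge_density_pos[of t0 z] t by (simp add: ennreal_plus[symmetric] del: ennreal_plus)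
  finally show ?thesis using bridge_density_pos[of t0 z] t by (subst (asm) ennreal_le_iff) (auto simp: q_def)
qed

text \<open>The integral of the density over \<open>{-R..R}\<close> is at least 1/4: more than half
  of the mass of \<open>\<mu>\<close> lies in \<open>{- real n..real n}\<close>, the kernel leaves
  at least half of it in the window since \<open>1 - t < 1 / 2\<close>, and the weight
  \<open>?w\<close> is at least 1.\<close>

lemma bridge_density_lower_bound:
  obtains R c where "0 < R" "0 < c" "\<And>t. 1 / 2 < t \<Longrightarrow> t < 1 \<Longrightarrow> \<exists>x\<in>{-R..R}. c \<le> bridge_density \<mu> t x"
proof -
  have "(\<lambda>n. prob {- real n..real n}) \<longlonglongrightarrow> prob (\<Union>n. {- real n..real n})"
    by (rule finite_Lim_measure_incseq) (auto simp: incseq_def)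
  also have "(\<Union>n. {- real n..real n}) = UNIV"
  proof -
    have "x \<in> (\<Union>n. {- real n..real n})" for x :: real
    proof -
      obtain n :: nat where "\<bar>x\<bar> \<le> real n" using real_arch_simple by blast
      then show ?thesis by (auto simp: abs_le_iff intro!: exI[of _ n])
    qed
    then show ?thesis by auto
  qed
  also have "prob UNIV = 1" using prob_space by simp
  finally have "eventually (\<lambda>n. 1 / 2 < prob {- real n..real n}) sequentially"
    by (rule order_tendstoD) simp
  then obtain n :: nat where n: "1 / 2 < prob {- real n..real n}" by (auto simp: eventually_sequentially)
  define R where "R = real n + 1"
  \<comment> \<open>A density of at most \<open>c\<close> on the window of length
    \<open>2 * R\<close> would integrate to at most 1/8, less than 1/4.\<close>
  define c where "c = 1 / (16 * R)"
  have R: "0 < R" by (simp add: R_def)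
  then have c: "0 < c" by (simp add: c_def)
  have "\<exists>x\<in>{-R..R}. c \<le> bridge_density \<mu> t x" if t: "1 / 2 < t" "t < 1" for t
  proof (rule ccontr)
    assume "\<not> ?thesis"
    then have less: "bridge_density \<mu> t x \<le> c" if "x \<in> {-R..R}" for x using that by force
    let ?n = "normal_density 0 (sqrt (1 - t))"
    let ?w = "\<lambda>u. sqrt (2 * pi) * exp (u\<^sup>2 / 2) :: real"
    interpret lb: sigma_finite_measure "lborel :: real measure" by (rule sigma_finite_lborel)
    interpret pair_sigma_finite "lborel :: real measure" \<mu> ..
    have "ennreal (1 / 4) \<le> ennreal (1 / 2 * prob {- real n..real n})"
      using n by (intro ennreal_leI) simp
    also have "\<dots> = ennreal (1 / 2) * ennreal (prob {- real n..real n})"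
      by (rule ennreal_mult) auto
    also have "\<dots> = (\<integral>\<^sup>+u. ennreal (1 / 2) * indicator {- real n..real n} u \<partial>\<mu>)"
      by (subst nn_integral_cmult) (auto simp: emeasure_eq_measure)
    also have "\<dots> \<le> (\<integral>\<^sup>+u. \<integral>\<^sup>+x. indicator {-R..R} x * ennreal (?n (u - x) * ?w u) \<partial>lborel \<partial>\<mu>)"
    proof (rule nn_integral_mono)
      fix u
      show "ennreal (1 / 2) * indicator {- real n..real n} u \<le> (\<integral>\<^sup>+x. indicator {-R..R} x * ennreal (?n (u - x) * ?w u) \<partial>lborel)"
      proof (cases "u \<in> {- real n..real n}")
        case True
        have w1: "1 \<le> ?w u"
        proof -
          have "1 \<le> sqrt (2 * pi)" using pi_gt3 by simp
          moreover have "1 \<le> exp (u\<^sup>2 / 2)" by simp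
          ultimately show ?thesis by (rule mult_ge1_I)
        qed
        have sym: "?n (u - x) = normal_density u (sqrt (1 - t)) x" for x
          by (simp add: normal_density_def power2_commute)
        have "ennreal (1 / 2) \<le> (\<integral>\<^sup>+x. indicator {-R..R} x * ennreal (normal_density u (sqrt (1 - t)) x) \<partial>lborel)"
          using True t by (intro normal_window_mass) (auto simp: R_def)
        also have "\<dots> \<le> (\<integral>\<^sup>+x. indicator {-R..R} x * ennreal (?n (u - x) * ?w u) \<partial>lborel)"
        proof (intro nn_integral_mono mult_left_mono ennreal_leI)
          fix x show "normal_density u (sqrt (1 - t)) x \<le> ?n (u - x) * ?w u"
            unfolding sym using mult_left_mono[OF w1, of "normal_density u (sqrt (1 - t)) x"] by simp
        qed auto
        finally show ?thesis using True by simp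
      qed auto
    qed
    also have "\<dots> = (\<integral>\<^sup>+x. \<integral>\<^sup>+u. indicator {-R..R} x * ennreal (?n (u - x) * ?w u) \<partial>\<mu> \<partial>lborel)"
      by (rule Fubini') measurable
    also have "\<dots> = (\<integral>\<^sup>+x. indicator {-R..R} x * ennreal (bridge_density \<mu> t x) \<partial>lborel)"
      using t by (intro nn_integral_cong) (simp add: bridge_density_nn_integral nn_integral_cmult)
    also have "\<dots> \<le> (\<integral>\<^sup>+x. ennreal c * indicator {-R..R} x \<partial>lborel)"
      using less by (intro nn_integral_mono) (auto simp: indicator_def ennreal_leI)
    also have "\<dots> = ennreal (c * (2 * R))"
      using R c by (subst nn_integral_cmult) (auto simp: ennreal_mult[symmetric])
    also have "c * (2 * R) = 1 / 8" using R by (simp add: c_def)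
    finally show False by (subst (asm) ennreal_le_iff) auto
  qed
  with R c show thesis by (rule that)
qed

text \<open>At \<open>z = 0\<close> the weight is at most 1, so the numerator is bounded by the
  first absolute moment of \<open>\<mu>\<close>. For \<open>t \<le> 1 / 2\<close> the tilt is at
  most 1, so the denominator is at least its value at tilt 1.\<close>

lemma bridge_h_0_bounded:
  assumes int: "integrable \<mu> (\<lambda>u. u)"
  obtains B where "\<And>t. 0 < t \<Longrightarrow> t \<le> 1 / 2 \<Longrightarrow> \<bar>bridge_h \<mu> t 0\<bar> \<le> B"
proof -
  define B where "B = (\<integral>u. \<bar>u\<bar> \<partial>\<mu>) / tilted_moment \<mu> 0 1 0"
  have "\<bar>bridge_h \<mu> t 0\<bar> \<le> B" if t: "0 < t" "t \<le> 1 / 2" for t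
  proof -
    let ?s = "t / (1 - t)"
    have s: "0 < ?s" "?s \<le> 1" using t by auto
    have "\<bar>tilted_moment \<mu> 1 ?s 0\<bar> \<le> (\<integral>u. \<bar>u\<bar> \<partial>\<mu>)"
      unfolding tilted_moment_def
    proof (rule integral_abs_bound_integral)
      show "integrable \<mu> (\<lambda>u. u ^ 1 * exp (u * 0 - u\<^sup>2 * ?s / 2))" by (rule integrable_tilted[OF \<mu> s(1)])
      show "integrable \<mu> (\<lambda>u. \<bar>u\<bar>)" using int by simp
      fix u :: real
      have "0 \<le> u\<^sup>2 * ?s / 2" using t by (intro divide_nonneg_nonneg mult_nonneg_nonneg) auto
      then have "exp (u * 0 - u\<^sup>2 * ?s / 2) \<le> 1" by simp
      then show "\<bar>u ^ 1 * exp (u * 0 - u\<^sup>2 * ?s / 2)\<bar> \<le> \<bar>u\<bar>" by (simp add: abs_mult mult_left_le)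
    qed
    moreover have "tilted_moment \<mu> 0 1 0 \<le> tilted_moment \<mu> 0 ?s 0"
      unfolding tilted_moment_def
    proof (rule integral_mono)
      show "integrable \<mu> (\<lambda>u. u ^ 0 * exp (u * 0 - u\<^sup>2 * 1 / 2))" by (rule integrable_tilted[OF \<mu>]) simp
      show "integrable \<mu> (\<lambda>u. u ^ 0 * exp (u * 0 - u\<^sup>2 * ?s / 2))" by (rule integrable_tilted[OF \<mu> s(1)])
      fix u :: real
      have exp_anti: "exp (u * 0 - b / 2) \<le> exp (u * 0 - a / 2)" if "a \<le> b" for a b :: real
        using that by simp
      have "u\<^sup>2 * ?s \<le> u\<^sup>2 * 1" using s by (intro mult_left_mono) auto
      then show "u ^ 0 * exp (u * 0 - u\<^sup>2 * 1 / 2) \<le> u ^ 0 * exp (u * 0 - u\<^sup>2 * ?s / 2)"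
        unfolding power_0 mult_1 by (rule exp_anti)
    qed
    moreover have "0 < tilted_moment \<mu> 0 1 0" by (rule tilted_moment_0_pos[OF \<mu>]) simp
    ultimately have "\<bar>tilted_moment \<mu> 1 ?s 0\<bar> / tilted_moment \<mu> 0 ?s 0 \<le> B"
      unfolding B_def by (intro frac_le) auto
    moreover have "0 < tilted_moment \<mu> 0 ?s 0" by (rule tilted_moment_0_pos[OF \<mu> s(1)])
    ultimately show ?thesis using t by (simp add: bridge_h_eq_f[OF \<mu>] bridge_f_eq[OF \<mu>] abs_divide)
  qed
  then show thesis by (rule that)
qed

text \<open>
  The bound is uniform up to time 1: if the drift is increasing, then \<open>ln (bridge_density \<mu> t)\<close> is
  convex and decreasing in \<open>t\<close>, so it lies below its value at time 1/2, which grows quadratically.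
\<close>

lemma bridge_drift_linear_growth:
  assumes int: "integrable \<mu> (\<lambda>u. u)"
    and var: "\<And>t z. 0 < t \<Longrightarrow> t \<le> 1 / 2 \<Longrightarrow> prob_space.variance (posterior \<mu> t z) (\<lambda>u. u) \<le> C"
    and mono: "\<And>t. 0 < t \<Longrightarrow> t < 1 \<Longrightarrow> mono (\<lambda>z. bridge_h \<mu> t z - z)"
  obtains K where "0 \<le> K" "\<And>t z. 0 < t \<Longrightarrow> t < 1 \<Longrightarrow> \<bar>bridge_drift \<mu> t z\<bar> \<le> K * (1 + \<bar>z\<bar>)"
proof -
  obtain B where B: "\<And>t. 0 < t \<Longrightarrow> t \<le> 1 / 2 \<Longrightarrow> \<bar>bridge_h \<mu> t 0\<bar> \<le> B"
    using bridge_h_0_bounded[OF int] by blast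
  have B0: "0 \<le> B" using B[of "1 / 2"] by simp
  have C0: "0 \<le> C" by (rule order_trans[OF _ var[of "1 / 2" 0]]) auto
  \<comment> \<open>\<open>B\<close> bounds \<open>bridge_h\<close> at 0, \<open>2 * C\<close> its
    Lipschitz constant up to time 1/2, and 1 accounts for the term \<open>z\<close>; the outer
    factor bounds \<open>1 / (1 - t)\<close>.\<close>
  define K1 where "K1 = 2 * (B + 2 * C + 1)"
  have K1: "0 \<le> K1" using B0 C0 by (simp add: K1_def)
  have early: "\<bar>bridge_drift \<mu> t z\<bar> \<le> K1 * (1 + \<bar>z\<bar>)" if t: "0 < t" "t \<le> 1 / 2" for t z
  proof -
    have "\<bar>bridge_h \<mu> t z - bridge_h \<mu> t 0\<bar> \<le> C / (1 - t) * \<bar>z - 0\<bar>"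
      using t by (intro bridge_h_lipschitz[OF \<mu>] var) auto
    also have "\<dots> \<le> C / (1 / 2) * \<bar>z\<bar>" using t C0 unfolding diff_zero by (intro mult_right_mono divide_left_mono) auto
    also have "\<dots> = 2 * C * \<bar>z\<bar>" by simp
    finally have "\<bar>bridge_h \<mu> t z - z\<bar> \<le> B + 2 * C * \<bar>z\<bar> + \<bar>z\<bar>" using B[OF t] by linarith
    also have "\<dots> \<le> (B + 2 * C + 1) * (1 + \<bar>z\<bar>)" using B0 C0 by (simp add: algebra_simps)
    finally have "\<bar>bridge_h \<mu> t z - z\<bar> / (1 - t) \<le> (B + 2 * C + 1) * (1 + \<bar>z\<bar>) / (1 / 2)"
      using t by (intro frac_le) auto
    then show ?thesis using t by (simp add: bridge_drift_def K1_def abs_divide algebra_simps)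
  qed
  let ?q = "\<lambda>x. ln (bridge_density \<mu> (1 / 2) x)"
  \<comment> \<open>Integrating the linear bound on the drift at time 1/2 gives quadratic growth of
    the logarithm of the density.\<close>
  define A where "A = \<bar>?q 0\<bar> + K1"
  have upper: "?q x \<le> A * (1 + \<bar>x\<bar>)\<^sup>2" for x
  proof -
    have "norm (?q x - ?q 0) \<le> K1 * (1 + \<bar>x\<bar>) * norm (x - 0)"
    proof (rule field_differentiable_bound[of "{- \<bar>x\<bar>..\<bar>x\<bar>}"])
      fix z assume "z \<in> {- \<bar>x\<bar>..\<bar>x\<bar>}"
      then have "\<bar>z\<bar> \<le> \<bar>x\<bar>" by auto
      then have "K1 * (1 + \<bar>z\<bar>) \<le> K1 * (1 + \<bar>x\<bar>)" using K1 by (intro mult_left_mono) auto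
      then show "norm (bridge_drift \<mu> (1 / 2) z) \<le> K1 * (1 + \<bar>x\<bar>)" using early[of "1 / 2" z] by simp
      show "(?q has_real_derivative bridge_drift \<mu> (1 / 2) z) (at z within {- \<bar>x\<bar>..\<bar>x\<bar>})"
        by (rule has_field_derivative_at_within, rule ln_bridge_density_derivative) simp_all
    qed (use abs_ge_self[of x] abs_ge_minus_self[of x] in auto)
    also have "\<dots> \<le> K1 * (1 + \<bar>x\<bar>) * (1 + \<bar>x\<bar>)" using K1 by (intro mult_left_mono) auto
    finally have "?q x \<le> \<bar>?q 0\<bar> + K1 * (1 + \<bar>x\<bar>)\<^sup>2" unfolding power2_eq_square real_norm_def mult.assoc by linarith
    moreover have "\<bar>?q 0\<bar> * 1 \<le> \<bar>?q 0\<bar> * (1 + \<bar>x\<bar>)\<^sup>2" by (intro mult_left_mono one_le_power) auto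
    ultimately show ?thesis unfolding A_def by (simp add: distrib_right)
  qed
  obtain R c where R: "0 < R" and c: "0 < c"
    and low: "\<And>t. 1 / 2 < t \<Longrightarrow> t < 1 \<Longrightarrow> \<exists>x\<in>{-R..R}. c \<le> bridge_density \<mu> t x"
    using bridge_density_lower_bound by blast
  define K2 where "K2 = 4 * A + \<bar>ln c\<bar> + (A * (2 + R)\<^sup>2 + \<bar>ln c\<bar>) * (1 + R)"
  have A0: "0 \<le> A" using K1 by (simp add: A_def)
  have late: "\<bar>bridge_drift \<mu> t z\<bar> \<le> K2 * (1 + \<bar>z\<bar>)" if t: "1 / 2 < t" "t < 1" for t z
  proof -
    obtain x0 where x0: "x0 \<in> {-R..R}" "c \<le> bridge_density \<mu> t x0" using low[OF t] by blast
    have t0: "0 < t" using t by simp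
    show ?thesis unfolding K2_def
    proof (rule quadratic_convex_imp_linear_growth)
      show "ln (bridge_density \<mu> t z) + bridge_drift \<mu> t z * (x - z) \<le> ln (bridge_density \<mu> t x)" for x z
        by (rule bridge_density_tangent[OF t0 t(2) mono[OF t0 t(2)]])
      show "ln (bridge_density \<mu> t x) \<le> A * (1 + \<bar>x\<bar>)\<^sup>2" for x
      proof -
        have "bridge_density \<mu> t x \<le> bridge_density \<mu> (1 / 2) x"
          by (rule bridge_density_decreasing[OF _ t mono[OF t0 t(2)]]) simp
        then have "ln (bridge_density \<mu> t x) \<le> ?q x"
          using bridge_density_pos[OF t0 t(2)] by (intro ln_mono) auto
        with upper[of x] show ?thesis by linarith
      qed
      show "\<bar>x0\<bar> \<le> R" using x0 by auto
      have "ln c \<le> ln (bridge_density \<mu> t x0)" using c x0 by (intro ln_mono) auto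
      then show "- \<bar>ln c\<bar> \<le> ln (bridge_density \<mu> t x0)" by linarith
    qed (use A0 R in auto)
  qed
  have K2: "0 \<le> K2" using A0 R by (auto simp: K2_def intro!: add_nonneg_nonneg mult_nonneg_nonneg)
  have "\<bar>bridge_drift \<mu> t z\<bar> \<le> (K1 + K2) * (1 + \<bar>z\<bar>)" if t: "0 < t" "t < 1" for t z
  proof (cases "t \<le> 1 / 2")
    case True
    have "0 \<le> K2 * (1 + \<bar>z\<bar>)" using K2 by simp
    then show ?thesis using early[OF t(1) True, of z] by (simp add: distrib_right)
  next
    case False
    have "0 \<le> K1 * (1 + \<bar>z\<bar>)" using K1 by simp
    then show ?thesis using late[of t z] t False by (simp add: distrib_right)
  qed
  then show thesis using K1 K2 by (intro that[of "K1 + K2"]) auto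
qed

end

section \<open>Picard iteration and natural filtrations\<close>

text \<open>Time is rounded down to a dyadic grid, where only countably many values occur, and path
  continuity gives the limit. Time integrals of the process thus stay measurable for the given
  \<open>F\<close>.\<close>

lemma jointly_measurable_continuous:
  fixes X :: "real \<Rightarrow> 'w \<Rightarrow> real"
  assumes meas: "\<And>u. X u \<in> borel_measurable F"
    and cont: "\<And>\<omega>. \<omega> \<in> space F \<Longrightarrow> continuous_on UNIV (\<lambda>u. X u \<omega>)"
  shows "(\<lambda>p. X (fst p) (snd p)) \<in> borel_measurable (borel \<Otimes>\<^sub>M F)"
proof (rule borel_measurable_LIMSEQ_real)
  let ?q = "\<lambda>n (u::real). real_of_int \<lfloor>u * 2 ^ n\<rfloor> / 2 ^ n"
  fix p :: "real \<times> 'w" assume p: "p \<in> space (borel \<Otimes>\<^sub>M F)"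
  have q: "(\<lambda>n. ?q n (fst p)) \<longlonglongrightarrow> fst p" by (rule dyadic_floor_tendsto)
  have "continuous_on UNIV (\<lambda>u. X u (snd p))" using p by (intro cont) (auto simp: space_pair_measure)
  from continuous_on_tendsto_compose[OF this q]
  show "(\<lambda>n. X (?q n (fst p)) (snd p)) \<longlonglongrightarrow> X (fst p) (snd p)" by simp
next
  fix n :: nat
  have "(\<lambda>p. X (real_of_int i / 2 ^ n) (snd p)) \<in> borel_measurable (borel \<Otimes>\<^sub>M F)" for i
    by (rule measurable_compose[OF measurable_snd meas])
  moreover have "(\<lambda>p :: real \<times> 'w. \<lfloor>fst p * 2 ^ n\<rfloor>) \<in> borel \<Otimes>\<^sub>M F \<rightarrow>\<^sub>M count_space UNIV" by measurable
  ultimately show "(\<lambda>p :: real \<times> 'w. X (real_of_int \<lfloor>fst p * 2 ^ n\<rfloor> / 2 ^ n) (snd p)) \<in> borel_measurable (borel \<Otimes>\<^sub>M F)"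
    by (rule measurable_compose_countable)
qed

text \<open>Iterates for the equation with initial value \<open>c\<close> and right-hand side
  \<open>a u \<omega> x\<close>. The integral is a Lebesgue integral with an indicator, so that
  measurability in the upper limit and in \<open>\<omega>\<close> follows from measurability of
  parameter integrals.\<close>

primrec picard :: "(real \<Rightarrow> 'w \<Rightarrow> real \<Rightarrow> real) \<Rightarrow> real \<Rightarrow> nat \<Rightarrow> real \<Rightarrow> 'w \<Rightarrow> real" where
  "picard a c 0 = (\<lambda>r \<omega>. 0)"
| "picard a c (Suc n) = (\<lambda>r \<omega>. c + (LINT u|lborel. indicator {0..r} u * a u \<omega> (picard a c n u \<omega>)))"

lemma picard_measurable:
  assumes a: "(\<lambda>p. a (fst p) (fst (snd p)) (snd (snd p))) \<in> borel_measurable (borel \<Otimes>\<^sub>M (F \<Otimes>\<^sub>M borel))"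
  shows "(\<lambda>p. picard a c n (fst p) (snd p)) \<in> borel_measurable (borel \<Otimes>\<^sub>M F)"
proof (induction n)
  case (Suc n)
  have "(\<lambda>q. (snd q, snd (fst q))) \<in> (borel \<Otimes>\<^sub>M F) \<Otimes>\<^sub>M lborel \<rightarrow>\<^sub>M borel \<Otimes>\<^sub>M F" by measurable
  from measurable_compose[OF this Suc]
  have P: "(\<lambda>q. picard a c n (snd q) (snd (fst q))) \<in> borel_measurable ((borel \<Otimes>\<^sub>M F) \<Otimes>\<^sub>M lborel)" by simp
  have "(\<lambda>q. (snd q, (snd (fst q), picard a c n (snd q) (snd (fst q))))) \<in> (borel \<Otimes>\<^sub>M F) \<Otimes>\<^sub>M lborel \<rightarrow>\<^sub>M borel \<Otimes>\<^sub>M (F \<Otimes>\<^sub>M borel)"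
    using P by measurable
  from measurable_compose[OF this a]
  have A[measurable]: "(\<lambda>q. a (snd q) (snd (fst q)) (picard a c n (snd q) (snd (fst q)))) \<in> borel_measurable ((borel \<Otimes>\<^sub>M F) \<Otimes>\<^sub>M lborel)"
    by simp
  have ind: "indicator {0..fst (fst q)} (snd q) = (if 0 \<le> snd q \<and> snd q \<le> fst (fst q) then 1 else 0 :: real)"
    for q :: "(real \<times> 'a) \<times> real" by (auto simp: indicator_def)
  have "(\<lambda>q. indicator {0..fst (fst q)} (snd q) * a (snd q) (snd (fst q)) (picard a c n (snd q) (snd (fst q))))
      \<in> borel_measurable ((borel \<Otimes>\<^sub>M F) \<Otimes>\<^sub>M lborel)"
    unfolding ind by measurable
  then have "case_prod (\<lambda>p u. indicator {0..fst p} u * a u (snd p) (picard a c n u (snd p)))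
      \<in> borel_measurable ((borel \<Otimes>\<^sub>M F) \<Otimes>\<^sub>M lborel)"
    by (simp add: case_prod_beta')
  from lborel.borel_measurable_lebesgue_integral[OF this]
  show ?case by simp
qed simp

text \<open>A solution \<open>\<delta>\<close> is given; the point is to exhibit it as a limit of
  measurable iterates. The iteration starts at 0, so the first error is at most the bound
  \<open>B\<close> of \<open>\<bar>\<delta>\<bar>\<close>, and each step integrates the error and
  multiplies it by \<open>L\<close>, which produces the factorial.\<close>

lemma picard_converges:
  fixes \<delta> :: "real \<Rightarrow> real"
  assumes a: "(\<lambda>p. a (fst p) (fst (snd p)) (snd (snd p))) \<in> borel_measurable (borel \<Otimes>\<^sub>M (F \<Otimes>\<^sub>M borel))"
    and L: "0 \<le> L" "\<And>u x y. \<bar>a u \<omega> x - a u \<omega> y\<bar> \<le> L * \<bar>x - y\<bar>" and a0: "\<And>u. a u \<omega> 0 = 0"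
    and \<omega>: "\<omega> \<in> space F" and cont: "continuous_on UNIV \<delta>"
    and \<delta>: "\<And>r. r \<in> {0..s} \<Longrightarrow> ((\<lambda>u. a u \<omega> (\<delta> u)) has_integral \<delta> r - c) {0..r}"
    and r: "r \<in> {0..s}"
  shows "(\<lambda>n. picard a c n r \<omega>) \<longlonglongrightarrow> \<delta> r"
proof -
  have am: "(\<lambda>u. a u \<omega> (g u)) \<in> borel_measurable borel" if "g \<in> borel_measurable borel" for g
  proof -
    have "(\<lambda>u. (u, (\<omega>, g u))) \<in> borel \<rightarrow>\<^sub>M borel \<Otimes>\<^sub>M (F \<Otimes>\<^sub>M borel)" using that \<omega> by measurable
    from measurable_compose[OF this a] show ?thesis by simp
  qed
  have pm: "(\<lambda>u. picard a c n u \<omega>) \<in> borel_measurable borel" for n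
  proof -
    have "(\<lambda>u. (u, \<omega>)) \<in> borel \<rightarrow>\<^sub>M borel \<Otimes>\<^sub>M F" using \<omega> by measurable
    from measurable_compose[OF this picard_measurable[OF a]] show ?thesis by simp
  qed
  have \<delta>m: "\<delta> \<in> borel_measurable borel" using cont by (rule borel_measurable_continuous_onI)
  have "bounded (\<delta> ` {0..s})"
    by (intro compact_imp_bounded compact_continuous_image continuous_on_subset[OF cont]) auto
  then obtain B where "\<forall>u\<in>{0..s}. \<bar>\<delta> u\<bar> \<le> B" by (auto simp: bounded_iff)
  then have B: "\<And>u. u \<in> {0..s} \<Longrightarrow> \<bar>\<delta> u\<bar> \<le> B" by blast
  have B0: "0 \<le> B" using B[OF r] by linarith
  have int: "integrable lborel (\<lambda>u. indicator {0..r} u * a u \<omega> (g u))"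
    if gm: "g \<in> borel_measurable borel" and gb: "\<And>u. u \<in> {0..s} \<Longrightarrow> \<bar>g u\<bar> \<le> G" and r: "r \<in> {0..s}" for g G r
  proof (rule Bochner_Integration.integrable_bound)
    show "integrable lborel (\<lambda>u. indicator {0..r} u * (L * G))"
      by (intro integrable_mult_left integrable_real_indicator) (auto simp: emeasure_lborel_Icc_eq)
    show "(\<lambda>u. indicator {0..r} u * a u \<omega> (g u)) \<in> borel_measurable lborel" using am[OF gm] by measurable
    have "\<bar>a u \<omega> (g u)\<bar> \<le> L * G" if "u \<in> {0..r}" for u
      using L(2)[of u "g u" 0] a0[of u] gb[of u] mult_left_mono[OF gb[of u] L(1)] that r by auto
    then show "AE u in lborel. norm (indicator {0..r} u * a u \<omega> (g u)) \<le> norm (indicator {0..r} u * (L * G))"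
      by (intro AE_I2) (fastforce simp: indicator_def)
  qed
  have \<delta>eq: "\<delta> r = c + (LINT u|lborel. indicator {0..r} u * a u \<omega> (\<delta> u))" if r: "r \<in> {0..s}" for r
  proof -
    have "set_integrable lborel {0..r} (\<lambda>u. a u \<omega> (\<delta> u))"
      unfolding set_integrable_def using int[OF \<delta>m B r] by simp
    from set_borel_integral_eq_integral(2)[OF this] integral_unique[OF \<delta>[OF r]]
    show ?thesis by (simp add: set_lebesgue_integral_def)
  qed
  have bound: "\<bar>picard a c n r \<omega> - \<delta> r\<bar> \<le> B * ((L * r) ^ n / fact n)" if "r \<in> {0..s}" for n r
    using that
  proof (induction n arbitrary: r)
    case 0
    then show ?case using B[of r] by simp
  next
    case (Suc n)
    let ?P = "\<lambda>u. picard a c n u \<omega>"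
    have Pb: "\<bar>?P u\<bar> \<le> B + B * ((L * s) ^ n / fact n)" if "u \<in> {0..s}" for u
    proof -
      have "(L * u) ^ n / fact n \<le> (L * s) ^ n / fact n"
        using that L by (intro divide_right_mono power_mono mult_left_mono) auto
      then have "B * ((L * u) ^ n / fact n) \<le> B * ((L * s) ^ n / fact n)" using B0 by (rule mult_left_mono)
      then show ?thesis using Suc.IH[OF that] B[OF that] by linarith
    qed
    have i1: "integrable lborel (\<lambda>u. indicator {0..r} u * a u \<omega> (?P u))" by (rule int[OF pm Pb Suc.prems])
    have i2: "integrable lborel (\<lambda>u. indicator {0..r} u * a u \<omega> (\<delta> u))" by (rule int[OF \<delta>m B Suc.prems])
    have r0: "0 \<le> r" using Suc.prems by simp
    have ftc: "has_bochner_integral lborel (\<lambda>u. (L * B * L ^ n / fact n * u ^ n) * indicator {0..r} u)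
        (L * B * L ^ n / fact n * (r ^ Suc n / real (Suc n)) - L * B * L ^ n / fact n * (0 ^ Suc n / real (Suc n)))"
    proof (rule has_bochner_integral_FTC_Icc_real[OF r0])
      fix x :: real
      show "((\<lambda>x. L * B * L ^ n / fact n * (x ^ Suc n / real (Suc n))) has_real_derivative L * B * L ^ n / fact n * x ^ n) (at x)"
        by (auto intro!: derivative_eq_intros simp del: of_nat_Suc power_Suc)
      show "isCont (\<lambda>u. L * B * L ^ n / fact n * u ^ n) x" by (intro continuous_intros) auto
    qed
    have diff: "picard a c (Suc n) r \<omega> - \<delta> r
      = (LINT u|lborel. indicator {0..r} u * a u \<omega> (?P u) - indicator {0..r} u * a u \<omega> (\<delta> u))"
      using i1 i2 by (subst \<delta>eq[OF Suc.prems]) simp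
    have "\<bar>picard a c (Suc n) r \<omega> - \<delta> r\<bar> \<le> (LINT u|lborel. (L * B * L ^ n / fact n * u ^ n) * indicator {0..r} u)"
      unfolding diff
    proof (rule integral_abs_bound_integral)
      show "integrable lborel (\<lambda>u. (L * B * L ^ n / fact n * u ^ n) * indicator {0..r} u)"
        using ftc by (rule integrable.intros)
      show "integrable lborel (\<lambda>u. indicator {0..r} u * a u \<omega> (?P u) - indicator {0..r} u * a u \<omega> (\<delta> u))"
        by (rule Bochner_Integration.integrable_diff[OF i1 i2])
      fix u :: real
      show "\<bar>indicator {0..r} u * a u \<omega> (?P u) - indicator {0..r} u * a u \<omega> (\<delta> u)\<bar>
        \<le> (L * B * L ^ n / fact n * u ^ n) * indicator {0..r} u"
      proof (cases "u \<in> {0..r}")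
        case True
        then have "\<bar>a u \<omega> (?P u) - a u \<omega> (\<delta> u)\<bar> \<le> L * \<bar>?P u - \<delta> u\<bar>" by (intro L)
        also have "\<dots> \<le> L * (B * ((L * u) ^ n / fact n))"
          using True Suc.prems by (intro mult_left_mono Suc.IH L) auto
        finally show ?thesis using True by (simp add: power_mult_distrib mult_ac)
      qed auto
    qed
    also have "\<dots> = B * ((L * r) ^ Suc n / fact (Suc n))"
    proof -
      have "L * B * p / f * (R / N) - L * B * p / f * (0 / N) = B * (L * p * R / (N * f))" for p f R N :: real
        by (simp add: mult_ac)
      from this[of "L ^ n" "fact n" "r ^ Suc n" "real (Suc n)"] show ?thesis
        unfolding has_bochner_integral_integral_eq[OF ftc]
        by (simp only: power_0_Suc fact_Suc power_mult_distrib power_Suc[of L])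
    qed
    finally show ?case .
  qed
  have "(\<lambda>n. inverse (fact n) * (L * r) ^ n) \<longlonglongrightarrow> 0" by (rule summable_LIMSEQ_zero[OF summable_exp])
  then have "(\<lambda>n. B * ((L * r) ^ n / fact n)) \<longlonglongrightarrow> 0"
    using tendsto_mult_right_zero[of _ _ B] by (simp add: divide_inverse mult.commute)
  then have "(\<lambda>n. picard a c n r \<omega> - \<delta> r) \<longlonglongrightarrow> 0"
    by (rule Lim_null_comparison[rotated]) (use bound[OF r] in auto)
  then show ?thesis by (rule LIM_zero_cancel)
qed

section \<open>Natural filtrations up to null sets\<close>

lemma space_natural_filtration [simp]: "space (natural_filtration M I X s) = space M"
  unfolding natural_filtration_def by (rule space_measure_of) auto

lemma sets_natural_filtration:
  "sets (natural_filtration M I X s) =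
    sigma_sets (space M) (\<Union>r\<in>{r\<in>I. r \<le> s}. {X r -` B \<inter> space M |B. B \<in> sets borel})"
  unfolding natural_filtration_def by (rule sets_measure_of) auto

lemma natural_filtration_measurable:
  assumes "r \<in> I" "r \<le> s"
  shows "X r \<in> borel_measurable (natural_filtration M I X s)"
  by (rule measurableI) (use assms in \<open>auto simp: sets_natural_filtration intro!: sigma_sets.Basic\<close>)

lemma natural_filtration_mono:
  "s \<le> s' \<Longrightarrow> sets (natural_filtration M I X s) \<subseteq> sets (natural_filtration M I X s')"
  unfolding sets_natural_filtration by (rule sigma_sets_mono', rule UN_mono) auto

lemma natural_filtration_subset:
  assumes "\<And>r. r \<in> I \<Longrightarrow> X r \<in> borel_measurable M"
  shows "sets (natural_filtration M I X s) \<subseteq> sets M"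
  unfolding sets_natural_filtration
  by (rule sets.sigma_sets_subset) (use assms in \<open>auto intro: measurable_sets\<close>)

text \<open>The sets that agree almost everywhere with a member of \<open>F\<close> are closed under
  complement and countable union, and by assumption they include the generators.\<close>

lemma natural_filtration_AE_transfer:
  assumes Y: "\<And>r. r \<in> I \<Longrightarrow> r \<le> s \<Longrightarrow> \<exists>Y\<in>borel_measurable F. AE \<omega> in M. Y \<omega> = X r \<omega>"
    and F: "space F = space M"
    and A: "A \<in> sets (natural_filtration M I X s)"
  shows "\<exists>B\<in>sets F. AE \<omega> in M. \<omega> \<in> A \<longleftrightarrow> \<omega> \<in> B"
  using A unfolding sets_natural_filtration
proof induction
  case (Basic A)
  then obtain r C where r: "r \<in> I" "r \<le> s" and C: "C \<in> sets borel" and A: "A = X r -` C \<inter> space M" by auto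
  obtain Y where Ym: "Y \<in> borel_measurable F" and YX: "AE \<omega> in M. Y \<omega> = X r \<omega>" using Y[OF r] by blast
  have "Y -` C \<inter> space M \<in> sets F" using measurable_sets[OF Ym C] F by simp
  moreover have "AE \<omega> in M. \<omega> \<in> A \<longleftrightarrow> \<omega> \<in> Y -` C \<inter> space M" using YX by eventually_elim (auto simp: A)
  ultimately show ?case by blast
next
  case Empty
  show ?case by (rule bexI[of _ "{}"]) auto
next
  case (Compl A)
  then obtain B where B: "B \<in> sets F" "AE \<omega> in M. \<omega> \<in> A \<longleftrightarrow> \<omega> \<in> B" by blast
  have "space M - B \<in> sets F" using sets.compl_sets[OF B(1)] F by simp
  moreover have "AE \<omega> in M. \<omega> \<in> space M - A \<longleftrightarrow> \<omega> \<in> space M - B" using B(2) by eventually_elim auto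
  ultimately show ?case by blast
next
  case (Union A)
  then have "\<forall>i. \<exists>B. B \<in> sets F \<and> (AE \<omega> in M. \<omega> \<in> A i \<longleftrightarrow> \<omega> \<in> B)" by blast
  then obtain B where B: "\<And>i. B i \<in> sets F" "\<And>i. AE \<omega> in M. \<omega> \<in> A i \<longleftrightarrow> \<omega> \<in> B i" by metis
  have "(\<Union>i. B i) \<in> sets F" using B(1) by blast
  moreover have "AE \<omega> in M. \<forall>i. \<omega> \<in> A i \<longleftrightarrow> \<omega> \<in> B i" using B(2) by (simp add: AE_all_countable)
  then have "AE \<omega> in M. \<omega> \<in> (\<Union>i. A i) \<longleftrightarrow> \<omega> \<in> (\<Union>i. B i)" by eventually_elim auto
  ultimately show ?case by blast
qed

section \<open>Grid-valued stopping times\<close>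

text \<open>The alternative \<open>k = m\<close> guarantees that the least index exists; it means
  stopping at the last grid point whatever \<open>A m\<close> is.\<close>

definition grid_index :: "nat \<Rightarrow> (nat \<Rightarrow> 'w set) \<Rightarrow> 'w \<Rightarrow> nat" where
  "grid_index m A \<omega> = (LEAST k. k = m \<or> \<omega> \<in> A k)"

text \<open>The denominator is \<open>Suc m\<close> while the index is at most \<open>m\<close>, so
  a grid time with \<open>0 < T\<close> is always strictly less than \<open>T\<close>.\<close>

definition grid_time :: "real \<Rightarrow> nat \<Rightarrow> (nat \<Rightarrow> 'w set) \<Rightarrow> 'w \<Rightarrow> real" where
  "grid_time T m A \<omega> = real (grid_index m A \<omega>) * T / real (Suc m)"

lemma grid_index_le: "grid_index m A \<omega> \<le> m"
  unfolding grid_index_def by (rule Least_le) simp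

lemma grid_index_le_if: "\<omega> \<in> A k \<Longrightarrow> grid_index m A \<omega> \<le> k"
  unfolding grid_index_def by (rule Least_le) simp

lemma grid_index_cases: "grid_index m A \<omega> = m \<or> \<omega> \<in> A (grid_index m A \<omega>)"
  unfolding grid_index_def by (rule LeastI[of _ m]) simp

lemma grid_index_notin: "k < grid_index m A \<omega> \<Longrightarrow> \<omega> \<notin> A k"
  using grid_index_le_if[of \<omega> A k m] by linarith

lemma grid_time_range:
  assumes "0 \<le> T"
  shows "0 \<le> grid_time T m A \<omega>" "grid_time T m A \<omega> \<le> real m * T / real (Suc m)"
  unfolding grid_time_def using assms grid_index_le[of m A \<omega>]
  by (auto intro!: divide_right_mono mult_right_mono simp del: of_nat_Suc)

lemma grid_time_less:
  assumes "0 < T"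
  shows "real m * T / real (Suc m) < T"
  using assms by (simp add: field_simps)

lemma grid_time_stopping:
  assumes T: "0 \<le> T"
    and F: "\<And>s s'. s \<le> s' \<Longrightarrow> sets (F s) \<subseteq> sets (F s')" "\<And>s. space (F s) = \<Omega>"
    and A: "\<And>k. k < m \<Longrightarrow> A k \<in> sets (F (real k * T / real (Suc m)))"
  shows "stopping_time F (grid_time T m A)"
proof
  fix t
  let ?I = "{k. k \<le> m \<and> real k * T / real (Suc m) \<le> t}"
  have "{\<omega> \<in> space (F t). grid_time T m A \<omega> \<le> t} = (\<Union>k\<in>?I. if k = m then space (F t) else A k)"
  proof (intro set_eqI iffI)
    fix \<omega> assume \<omega>: "\<omega> \<in> {\<omega> \<in> space (F t). grid_time T m A \<omega> \<le> t}"
    then have "grid_index m A \<omega> \<in> ?I" using grid_index_le[of m A \<omega>] by (simp add: grid_time_def)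
    moreover have "\<omega> \<in> (if grid_index m A \<omega> = m then space (F t) else A (grid_index m A \<omega>))"
      using \<omega> grid_index_cases[of m A \<omega>] by auto
    ultimately show "\<omega> \<in> (\<Union>k\<in>?I. if k = m then space (F t) else A k)" by (rule UN_I)
  next
    fix \<omega> assume "\<omega> \<in> (\<Union>k\<in>?I. if k = m then space (F t) else A k)"
    then obtain k where "k \<in> ?I" and \<omega>: "\<omega> \<in> (if k = m then space (F t) else A k)" by (rule UN_E)
    then have k: "k \<le> m" "real k * T / real (Suc m) \<le> t" by auto
    have "grid_index m A \<omega> \<le> k" using \<omega> grid_index_le_if[of \<omega> A k m] grid_index_le[of m A \<omega>] by (auto split: if_splits)
    then have "grid_time T m A \<omega> \<le> real k * T / real (Suc m)"
      unfolding grid_time_def using T by (intro divide_right_mono mult_right_mono) auto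
    moreover have "\<omega> \<in> space (F t)"
      using \<omega> k(1) A[of k] sets.sets_into_space[of "A k"] F(2) by (auto split: if_splits)
    ultimately show "\<omega> \<in> {\<omega> \<in> space (F t). grid_time T m A \<omega> \<le> t}" using k by auto
  qed
  also have "\<dots> \<in> sets (F t)"
  proof (rule sets.finite_UN)
    show "finite ?I" by (rule finite_subset[of _ "{..m}"]) auto
    fix k assume k: "k \<in> ?I"
    then show "(if k = m then space (F t) else A k) \<in> sets (F t)"
      using A[of k] F(1)[of "real k * T / real (Suc m)" t] by auto
  qed
  finally show "Measurable.pred (F t) (\<lambda>\<omega>. grid_time T m A \<omega> \<le> t)" by (simp add: pred_def)
qed

text \<open>The time \<tau> is rounded up to the next grid point, except beyond the last one, where
  it is rounded down; either error is at most the mesh.\<close>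

lemma grid_time_approx:
  assumes T: "0 < T" and \<tau>: "0 \<le> \<tau> \<omega>" "\<tau> \<omega> \<le> T" and \<omega>: "\<omega> \<in> \<Omega>"
  shows "\<bar>grid_time T m (\<lambda>k. {\<omega> \<in> \<Omega>. \<tau> \<omega> \<le> real k * T / real (Suc m)}) \<omega> - \<tau> \<omega>\<bar> \<le> T / real (Suc m)"
proof -
  define A where "A = (\<lambda>k. {\<omega> \<in> \<Omega>. \<tau> \<omega> \<le> real k * T / real (Suc m)})"
  define k where "k = grid_index m A \<omega>"
  have up: "\<tau> \<omega> \<le> real k * T / real (Suc m) + T / real (Suc m)"
  proof (cases "k = m")
    case True
    have "real m * T / real (Suc m) + T / real (Suc m) = T"
      unfolding add_divide_distrib[symmetric] by (simp add: field_simps)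
    then show ?thesis using True \<tau> by simp
  next
    case False
    then have "\<omega> \<in> A k" using grid_index_cases[of m A \<omega>] by (auto simp: k_def)
    then have "\<tau> \<omega> \<le> real k * T / real (Suc m)" by (simp add: A_def)
    moreover have "0 \<le> T / real (Suc m)" using T by simp
    ultimately show ?thesis by linarith
  qed
  have low: "real k * T / real (Suc m) - T / real (Suc m) \<le> \<tau> \<omega>"
  proof (cases k)
    case 0
    have "0 \<le> T / real (Suc m)" using T by simp
    moreover have "real k * T / real (Suc m) = 0" using 0 by simp
    ultimately show ?thesis using \<tau> by linarith
  next
    case (Suc j)
    then have "\<omega> \<notin> A j" by (intro grid_index_notin[of j m]) (simp add: k_def[symmetric])
    then have "real j * T / real (Suc m) < \<tau> \<omega>" using \<omega> by (simp add: A_def)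
    moreover have "real k * T / real (Suc m) - T / real (Suc m) = real j * T / real (Suc m)"
      unfolding Suc diff_divide_distrib[symmetric] by (simp add: algebra_simps)
    ultimately show ?thesis by linarith
  qed
  show ?thesis using up low unfolding A_def[symmetric] grid_time_def k_def[symmetric] by linarith
qed

text \<open>Dominated convergence. Where \<open>\<tau> \<omega> < T\<close> the path is continuous
  at \<tau>; where \<open>\<tau> \<omega> = T\<close> the grid times approach \<open>T\<close>
  strictly from the left, so the left limit applies.\<close>

lemma (in prob_space) grid_time_expectation:
  fixes X :: "real \<Rightarrow> 'a \<Rightarrow> real"
  assumes T: "0 < T" and X: "\<And>s. s \<in> {0..T} \<Longrightarrow> X s \<in> borel_measurable M"
    and cont: "\<And>\<omega>. \<omega> \<in> space M \<Longrightarrow> continuous_on {0..<T} (\<lambda>s. X s \<omega>)"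
    and lim: "AE \<omega> in M. ((\<lambda>s. X s \<omega>) \<longlongrightarrow> X T \<omega>) (at_left T)"
    and g: "integrable M g" "AE \<omega> in M. \<forall>s\<in>{0..<T}. \<bar>X s \<omega>\<bar> \<le> g \<omega>"
    and \<tau>m[measurable]: "\<tau> \<in> borel_measurable M" and \<tau>: "\<And>\<omega>. \<omega> \<in> space M \<Longrightarrow> \<tau> \<omega> \<in> {0..T}"
  shows "(\<lambda>m. expectation (\<lambda>\<omega>. X (grid_time T m (\<lambda>k. {\<omega> \<in> space M. \<tau> \<omega> \<le> real k * T / real (Suc m)}) \<omega>) \<omega>))
    \<longlonglongrightarrow> expectation (\<lambda>\<omega>. X (\<tau> \<omega>) \<omega>)"
proof -
  define \<sigma> where "\<sigma> m = grid_time T m (\<lambda>k. {\<omega> \<in> space M. \<tau> \<omega> \<le> real k * T / real (Suc m)})" for m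
  have less: "\<sigma> m \<omega> < T" and nonneg: "0 \<le> \<sigma> m \<omega>" for m \<omega>
    using grid_time_range[of T m _ \<omega>] grid_time_less[OF T, of m] T unfolding \<sigma>_def
    by (auto intro: le_less_trans less_imp_le)
  have \<sigma>lim: "(\<lambda>m. \<sigma> m \<omega>) \<longlonglongrightarrow> \<tau> \<omega>" if \<omega>: "\<omega> \<in> space M" for \<omega>
  proof -
    have "(\<lambda>m. T / real (Suc m)) \<longlonglongrightarrow> 0"
      using tendsto_mult[OF tendsto_const[of T] LIMSEQ_inverse_real_of_nat] by (simp add: divide_inverse)
    then have "(\<lambda>m. \<sigma> m \<omega> - \<tau> \<omega>) \<longlonglongrightarrow> 0"
    proof (rule Lim_null_comparison[rotated])
      have "norm (\<sigma> m \<omega> - \<tau> \<omega>) \<le> T / real (Suc m)" for m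
        unfolding \<sigma>_def real_norm_def using \<tau>[OF \<omega>] \<omega> T by (intro grid_time_approx) auto
      then show "\<forall>\<^sub>F m in sequentially. norm (\<sigma> m \<omega> - \<tau> \<omega>) \<le> T / real (Suc m)" by simp
    qed
    then show ?thesis by (rule LIM_zero_cancel)
  qed
  have meas: "(\<lambda>\<omega>. X (\<sigma> m \<omega>) \<omega>) \<in> borel_measurable M" for m
  proof -
    let ?i = "grid_index m (\<lambda>k. {\<omega> \<in> space M. \<tau> \<omega> \<le> real k * T / real (Suc m)})"
    have idx: "?i \<in> M \<rightarrow>\<^sub>M count_space UNIV"
    proof -
      have "(\<lambda>\<omega>. LEAST k. k = m \<or> \<tau> \<omega> \<le> real k * T / real (Suc m)) \<in> M \<rightarrow>\<^sub>M count_space UNIV" by measurable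
      then show ?thesis by (rule measurable_cong[THEN iffD1, rotated]) (simp add: grid_index_def)
    qed
    \<comment> \<open>The minimum keeps the time in \<open>{0..T}\<close> for every natural
      \<open>i\<close>; it has no effect at the indices that occur.\<close>
    have "(\<lambda>\<omega>. X (min (real i * T / real (Suc m)) T) \<omega>) \<in> borel_measurable M" for i :: nat
      using T by (intro X) auto
    from measurable_compose_countable[OF this idx]
    have "(\<lambda>\<omega>. X (min (\<sigma> m \<omega>) T) \<omega>) \<in> borel_measurable M" by (simp add: \<sigma>_def grid_time_def)
    then show ?thesis using less[of m] by (simp add: min_absorb1 less_imp_le)
  qed
  have inner: "(\<lambda>m. X (\<sigma> m \<omega>) \<omega>) \<longlonglongrightarrow> X (\<tau> \<omega>) \<omega>" if "\<omega> \<in> space M" "\<tau> \<omega> < T" for \<omega>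
    by (rule continuous_on_tendsto_compose[OF cont[OF that(1)] \<sigma>lim[OF that(1)]])
       (use \<tau>[OF that(1)] that less nonneg in auto)
  have limmeas: "(\<lambda>\<omega>. X (\<tau> \<omega>) \<omega>) \<in> borel_measurable M"
  proof (rule borel_measurable_LIMSEQ_real)
    fix m
    have [measurable]: "X T \<in> borel_measurable M" using T by (intro X) auto
    note meas[of m, measurable]
    \<comment> \<open>The left limit at \<open>T\<close> exists only almost everywhere. Using
      \<open>X T\<close> itself on the event \<open>\<tau> \<omega> = T\<close> gives convergence at
      every point, as measurability requires.\<close>
    show "(\<lambda>\<omega>. if \<tau> \<omega> < T then X (\<sigma> m \<omega>) \<omega> else X T \<omega>) \<in> borel_measurable M" by measurable
  next
    fix \<omega> assume \<omega>: "\<omega> \<in> space M"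
    show "(\<lambda>m. if \<tau> \<omega> < T then X (\<sigma> m \<omega>) \<omega> else X T \<omega>) \<longlonglongrightarrow> X (\<tau> \<omega>) \<omega>"
    proof (cases "\<tau> \<omega> < T")
      case False
      then have "\<tau> \<omega> = T" using \<tau>[OF \<omega>] by auto
      then show ?thesis by simp
    qed (use inner[OF \<omega>] in simp)
  qed
  have "(\<lambda>m. expectation (\<lambda>\<omega>. X (\<sigma> m \<omega>) \<omega>)) \<longlonglongrightarrow> expectation (\<lambda>\<omega>. X (\<tau> \<omega>) \<omega>)"
  proof (rule integral_dominated_convergence[OF limmeas meas g(1)])
    show "AE \<omega> in M. (\<lambda>m. X (\<sigma> m \<omega>) \<omega>) \<longlonglongrightarrow> X (\<tau> \<omega>) \<omega>"
      using lim AE_space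
    proof eventually_elim
      case (elim \<omega>)
      show ?case
      proof (cases "\<tau> \<omega> < T")
        case True
        then show ?thesis using inner elim by blast
      next
        case False
        then have \<tau>T: "\<tau> \<omega> = T" using \<tau>[OF elim(2)] by auto
        have "filterlim (\<lambda>m. \<sigma> m \<omega>) (at_left T) sequentially"
        proof (rule filterlim_at_withinI)
          show "(\<lambda>m. \<sigma> m \<omega>) \<longlonglongrightarrow> T" using \<sigma>lim[OF elim(2)] unfolding \<tau>T .
          have "\<sigma> m \<omega> \<in> {..<T} - {T}" for m using less[of m \<omega>] by simp
          then show "\<forall>\<^sub>F m in sequentially. \<sigma> m \<omega> \<in> {..<T} - {T}" by simp
        qed
        from filterlim_compose[OF elim(1) this] show ?thesis using \<tau>T by simp
      qed
    qed
    show "AE \<omega> in M. norm (X (\<sigma> m \<omega>) \<omega>) \<le> g \<omega>" for m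
      using g(2) by eventually_elim (use less nonneg in auto)
  qed
  then show ?thesis unfolding \<sigma>_def .
qed

text \<open>A down-closed set without a greatest element is an open half-line. The supremum in the
  extended reals also covers the empty set and the whole line.\<close>

lemma lower_boundary:
  fixes S :: "real set"
  assumes down: "\<And>x y. y \<in> S \<Longrightarrow> x < y \<Longrightarrow> x \<in> S" and op: "\<And>x. x \<in> S \<Longrightarrow> \<exists>y\<in>S. x < y"
  shows "z \<in> S \<longleftrightarrow> ereal z < (SUP x\<in>S. ereal x)"
  using assms by (auto simp: less_SUP_iff)

lemma upper_boundary:
  fixes S :: "real set"
  assumes up: "\<And>x y. y \<in> S \<Longrightarrow> y < x \<Longrightarrow> x \<in> S" and op: "\<And>x. x \<in> S \<Longrightarrow> \<exists>y\<in>S. y < x"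
  shows "z \<in> S \<longleftrightarrow> (INF x\<in>S. ereal x) < ereal z"
  using assms by (auto simp: INF_less_iff)

section \<open>The bridge with unknown pinning point\<close>

locale bridge_stopping =
  fixes \<mu> :: "real measure" and M :: "'w measure"
    and W :: "real \<Rightarrow> 'w \<Rightarrow> real"
    and Z :: "real \<Rightarrow> real \<Rightarrow> real \<Rightarrow> 'w \<Rightarrow> real"
  assumes \<mu>: "real_distribution \<mu>"
    and mean: "integrable \<mu> (\<lambda>u. u)"
    and var: "\<forall>t\<^sub>0\<in>{0..<1}. \<exists>C. \<forall>t\<in>{0..t\<^sub>0}. \<forall>z. prob_space.variance (posterior \<mu> t z) (\<lambda>u. u) \<le> C"
    and bm: "standard_brownian_motion M W"
    and Z: "\<forall>t\<in>{0..<1}. \<forall>z. bridge_process \<mu> M W t z (Z t z)"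
begin

sublocale prob_space M using bm by (simp add: standard_brownian_motion_def)

section \<open>Pathwise solutions and their comparison\<close>

lemma Z_measurable: "t \<in> {0..<1} \<Longrightarrow> s \<in> {0..1 - t} \<Longrightarrow> Z t z s \<in> borel_measurable M"
  using Z by (auto simp: bridge_process_def)

lemma Z_continuous: "t \<in> {0..<1} \<Longrightarrow> \<omega> \<in> space M \<Longrightarrow> continuous_on {0..<1 - t} (\<lambda>s. Z t z s \<omega>)"
  using Z by (auto simp: bridge_process_def)

lemma Z_terminal: "t \<in> {0..<1} \<Longrightarrow> AE \<omega> in M. ((\<lambda>s. Z t z s \<omega>) \<longlongrightarrow> Z t z (1 - t) \<omega>) (at_left (1 - t))"
  using Z by (auto simp: bridge_process_def)

text \<open>The requirements on a single path, so that comparisons are deterministic and may involve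
  two sample points. Continuity is included so that membership in \<open>space M\<close> need not be
  carried along.\<close>

definition solves :: "real \<Rightarrow> real \<Rightarrow> 'w \<Rightarrow> bool" where
  "solves t z \<omega> \<longleftrightarrow> continuous_on {0..<1 - t} (\<lambda>s. Z t z s \<omega>) \<and>
    (\<forall>s\<in>{0..<1 - t}. ((\<lambda>r. bridge_drift \<mu> (t + r) (Z t z r \<omega>)) has_integral
       (Z t z s \<omega> - z - (W (t + s) \<omega> - W t \<omega>))) {0..s})"

lemma AE_solves: "t \<in> {0..<1} \<Longrightarrow> AE \<omega> in M. solves t z \<omega>"
proof -
  assume t: "t \<in> {0..<1}"
  then have "AE \<omega> in M. \<forall>s\<in>{0..<1 - t}. ((\<lambda>r. bridge_drift \<mu> (t + r) (Z t z r \<omega>)) has_integral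
       (Z t z s \<omega> - z - (W (t + s) \<omega> - W t \<omega>))) {0..s}"
    using Z by (simp add: bridge_process_def bridge_drift_def)
  with AE_space show ?thesis by eventually_elim (use t in \<open>auto simp: solves_def intro: Z_continuous\<close>)
qed

lemma solves_start: "t \<in> {0..<1} \<Longrightarrow> solves t z \<omega> \<Longrightarrow> Z t z 0 \<omega> = z"
proof -
  assume t: "t \<in> {0..<1}" and sol: "solves t z \<omega>"
  have "0 \<in> {0..<1 - t}" using t by simp
  with sol have "((\<lambda>r. bridge_drift \<mu> (t + r) (Z t z r \<omega>)) has_integral
       (Z t z 0 \<omega> - z - (W (t + 0) \<omega> - W t \<omega>))) {0..0}" unfolding solves_def by (elim conjE bspec)
  from integral_unique[OF this] show ?thesis by simp
qed

text \<open>Two sample points are allowed because the domination argument compares paths with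
  different noise; for a common sample point the noise terms cancel.\<close>

lemma solves_difference:
  assumes t: "t \<in> {0..<1}" and sol: "solves t z1 \<omega>1" "solves t z2 \<omega>2" and r: "r < 1 - t"
  shows "continuous_on {0..r} (\<lambda>s. Z t z2 s \<omega>2 - Z t z1 s \<omega>1)"
    and "s \<in> {0..r} \<Longrightarrow> ((\<lambda>u. bridge_drift \<mu> (t + u) (Z t z2 u \<omega>2) - bridge_drift \<mu> (t + u) (Z t z1 u \<omega>1))
      has_integral (Z t z2 s \<omega>2 - Z t z1 s \<omega>1) - (Z t z2 0 \<omega>2 - Z t z1 0 \<omega>1)
        - ((W (t + s) \<omega>2 - W t \<omega>2) - (W (t + s) \<omega>1 - W t \<omega>1))) {0..s}"
proof -
  have "{0..r} \<subseteq> {0..<1 - t}" using r by auto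
  then show "continuous_on {0..r} (\<lambda>s. Z t z2 s \<omega>2 - Z t z1 s \<omega>1)"
    using sol unfolding solves_def by (intro continuous_on_diff; blast intro: continuous_on_subset)
  assume s: "s \<in> {0..r}"
  then have s': "s \<in> {0..<1 - t}" using r by auto
  have "((\<lambda>u. bridge_drift \<mu> (t + u) (Z t z2 u \<omega>2) - bridge_drift \<mu> (t + u) (Z t z1 u \<omega>1))
      has_integral (Z t z2 s \<omega>2 - z2 - (W (t + s) \<omega>2 - W t \<omega>2)) - (Z t z1 s \<omega>1 - z1 - (W (t + s) \<omega>1 - W t \<omega>1))) {0..s}"
    using sol s' unfolding solves_def by (intro has_integral_diff) blast+
  then show "((\<lambda>u. bridge_drift \<mu> (t + u) (Z t z2 u \<omega>2) - bridge_drift \<mu> (t + u) (Z t z1 u \<omega>1))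
      has_integral (Z t z2 s \<omega>2 - Z t z1 s \<omega>1) - (Z t z2 0 \<omega>2 - Z t z1 0 \<omega>1)
        - ((W (t + s) \<omega>2 - W t \<omega>2) - (W (t + s) \<omega>1 - W t \<omega>1))) {0..s}"
    unfolding solves_start[OF t sol(1)] solves_start[OF t sol(2)] by (simp add: algebra_simps)
qed

lemma drift_lipschitz:
  assumes t0: "t0 < 1"
  obtains L where "0 \<le> L" "\<And>u z z'. 0 < u \<Longrightarrow> u \<le> t0 \<Longrightarrow> \<bar>bridge_drift \<mu> u z - bridge_drift \<mu> u z'\<bar> \<le> L * \<bar>z - z'\<bar>"
proof -
  obtain C where C: "\<forall>t\<in>{0..max t0 0}. \<forall>z. prob_space.variance (posterior \<mu> t z) (\<lambda>u. u) \<le> C"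
    using bspec[OF var, of "max t0 0"] t0 by auto
  define L where "L = (\<bar>C\<bar> / (1 - t0) + 1) / (1 - t0)"
  have "\<bar>bridge_drift \<mu> u z - bridge_drift \<mu> u z'\<bar> \<le> L * \<bar>z - z'\<bar>" if u: "0 < u" "u \<le> t0" for u z z'
  proof -
    have "\<bar>bridge_h \<mu> u z - bridge_h \<mu> u z'\<bar> \<le> C / (1 - u) * \<bar>z - z'\<bar>"
      using u t0 C by (intro bridge_h_lipschitz[OF \<mu>]) auto
    also have "\<dots> \<le> \<bar>C\<bar> / (1 - t0) * \<bar>z - z'\<bar>"
      using u t0 by (intro mult_right_mono frac_le) auto
    finally have "\<bar>(bridge_h \<mu> u z - z) - (bridge_h \<mu> u z' - z')\<bar> \<le> (\<bar>C\<bar> / (1 - t0) + 1) * \<bar>z - z'\<bar>"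
      using abs_triangle_ineq4[of "bridge_h \<mu> u z - bridge_h \<mu> u z'" "z - z'"]
      by (simp add: distrib_right algebra_simps)
    then have "\<bar>(bridge_h \<mu> u z - z) - (bridge_h \<mu> u z' - z')\<bar> / (1 - u) \<le> ((\<bar>C\<bar> / (1 - t0) + 1) * \<bar>z - z'\<bar>) / (1 - t0)"
      using u t0 by (intro frac_le) auto
    moreover have "\<bar>bridge_drift \<mu> u z - bridge_drift \<mu> u z'\<bar> = \<bar>(bridge_h \<mu> u z - z) - (bridge_h \<mu> u z' - z')\<bar> / (1 - u)"
      using u t0 unfolding bridge_drift_def diff_divide_distrib[symmetric] abs_divide by simp
    ultimately show ?thesis by (simp add: L_def)
  qed
  moreover have "0 \<le> L" using t0 by (simp add: L_def)
  ultimately show thesis by (intro that)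
qed

text \<open>Gronwall's inequality for the difference of two paths. The constant is the same for all
  \<omega>, so it passes to expectations.\<close>

lemma solves_lipschitz:
  assumes t: "t \<in> {0..<1}" and s1: "s1 < 1 - t"
  obtains K where "0 \<le> K" "\<And>\<omega> z1 z2 s. solves t z1 \<omega> \<Longrightarrow> solves t z2 \<omega> \<Longrightarrow> s \<in> {0..s1} \<Longrightarrow>
    \<bar>Z t z2 s \<omega> - Z t z1 s \<omega>\<bar> \<le> K * \<bar>z2 - z1\<bar>"
proof -
  obtain L where L: "0 \<le> L"
    "\<And>u z z'. 0 < u \<Longrightarrow> u \<le> t + s1 \<Longrightarrow> \<bar>bridge_drift \<mu> u z - bridge_drift \<mu> u z'\<bar> \<le> L * \<bar>z - z'\<bar>"
    using drift_lipschitz[of "t + s1"] s1 by auto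
  have "\<bar>Z t z2 s \<omega> - Z t z1 s \<omega>\<bar> \<le> exp (L * s1) * \<bar>z2 - z1\<bar>"
    if sol: "solves t z1 \<omega>" "solves t z2 \<omega>" and s: "s \<in> {0..s1}" for \<omega> z1 z2 s
  proof -
    have s': "s < 1 - t" using s s1 by auto
    note D = solves_difference[OF t sol s']
    have "\<bar>Z t z2 s \<omega> - Z t z1 s \<omega>\<bar> \<le> (0 + \<bar>Z t z2 0 \<omega> - Z t z1 0 \<omega>\<bar> + 0) * exp (L * s)"
    proof (rule linear_growth_bound[OF _ L(1) _ D])
      fix u assume u: "0 < u" "u \<le> s"
      then show "\<bar>bridge_drift \<mu> (t + u) (Z t z2 u \<omega>) - bridge_drift \<mu> (t + u) (Z t z1 u \<omega>)\<bar>
        \<le> L * (0 + \<bar>Z t z2 u \<omega> - Z t z1 u \<omega>\<bar>)" using L(2) t s by simp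
    qed (use s in auto)
    also have "\<dots> = exp (L * s) * \<bar>z2 - z1\<bar>" using solves_start[OF t sol(1)] solves_start[OF t sol(2)] by simp
    also have "\<dots> \<le> exp (L * s1) * \<bar>z2 - z1\<bar>"
      using s L(1) by (intro mult_right_mono) (auto intro: mult_left_mono)
    finally show ?thesis .
  qed
  then show thesis by (rule that[rotated]) auto
qed

lemma drift_antimono:
  assumes "\<forall>t\<in>{0..<1}. antimono (\<lambda>z. bridge_h \<mu> t z - z)" "t \<in> {0..<1}" "x \<le> y"
  shows "bridge_drift \<mu> t y \<le> bridge_drift \<mu> t x"
  using assms unfolding bridge_drift_def antimono_def by (intro divide_right_mono) auto

lemma drift_mono:
  assumes "\<forall>t\<in>{0..<1}. mono (\<lambda>z. bridge_h \<mu> t z - z)" "t \<in> {0..<1}" "x \<le> y"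
  shows "bridge_drift \<mu> t x \<le> bridge_drift \<mu> t y"
  using assms unfolding bridge_drift_def mono_def by (intro divide_right_mono) auto

lemma antimono_pathwise_bound:
  assumes anti: "\<forall>t\<in>{0..<1}. antimono (\<lambda>z. bridge_h \<mu> t z - z)"
    and t: "t \<in> {0..<1}" and sol: "solves t z1 \<omega>1" "solves t z2 \<omega>2" and s: "s \<in> {0..<1 - t}"
    and m: "\<And>r. r \<in> {0..s} \<Longrightarrow> \<bar>(W (t + r) \<omega>2 - W t \<omega>2) - (W (t + r) \<omega>1 - W t \<omega>1)\<bar> \<le> m"
  shows "Z t z2 s \<omega>2 - Z t z1 s \<omega>1 \<le> max (z2 - z1) 0 + 2 * m"
proof -
  have s': "s < 1 - t" using s by auto
  note D = solves_difference[OF t sol s']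
  have "Z t z2 s \<omega>2 - Z t z1 s \<omega>1 \<le> max (Z t z2 0 \<omega>2 - Z t z1 0 \<omega>1) 0 + 2 * m"
  proof (rule contractive_drift_bound[OF _ D m])
    fix u assume "u \<in> {0..s}" "0 < Z t z2 u \<omega>2 - Z t z1 u \<omega>1"
    then show "bridge_drift \<mu> (t + u) (Z t z2 u \<omega>2) - bridge_drift \<mu> (t + u) (Z t z1 u \<omega>1) \<le> 0"
      using drift_antimono[OF anti, of "t + u" "Z t z1 u \<omega>1" "Z t z2 u \<omega>2"] t s by auto
  qed (use s in auto)
  then show ?thesis using solves_start[OF t sol(1)] solves_start[OF t sol(2)] by simp
qed

text \<open>Both inequalities are the contraction bound with zero noise difference, the first with
  the two paths exchanged.\<close>

lemma antimono_comparison: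
  assumes anti: "\<forall>t\<in>{0..<1}. antimono (\<lambda>z. bridge_h \<mu> t z - z)"
    and t: "t \<in> {0..<1}" and sol: "solves t z1 \<omega>" "solves t z2 \<omega>" and s: "s \<in> {0..<1 - t}" and "z1 \<le> z2"
  shows "Z t z1 s \<omega> \<le> Z t z2 s \<omega>" "Z t z2 s \<omega> - Z t z1 s \<omega> \<le> z2 - z1"
  using antimono_pathwise_bound[OF anti t sol s, of 0] antimono_pathwise_bound[OF anti t sol(2,1) s, of 0] \<open>z1 \<le> z2\<close>
  by auto

lemma mono_comparison:
  assumes mono: "\<forall>t\<in>{0..<1}. mono (\<lambda>z. bridge_h \<mu> t z - z)"
    and t: "t \<in> {0..<1}" and sol: "solves t z1 \<omega>" "solves t z2 \<omega>" and s: "s \<in> {0..<1 - t}" and "z1 < z2"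
  shows "z2 - z1 \<le> Z t z2 s \<omega> - Z t z1 s \<omega>"
proof -
  have s': "s < 1 - t" using s by auto
  note D = solves_difference[OF t sol s']
  have "Z t z2 0 \<omega> - Z t z1 0 \<omega> \<le> Z t z2 s \<omega> - Z t z1 s \<omega>"
  proof (rule expansive_drift_bound[OF _ D(1)])
    show "((\<lambda>u. bridge_drift \<mu> (t + u) (Z t z2 u \<omega>) - bridge_drift \<mu> (t + u) (Z t z1 u \<omega>))
      has_integral (Z t z2 r \<omega> - Z t z1 r \<omega>) - (Z t z2 0 \<omega> - Z t z1 0 \<omega>)) {0..r}" if "r \<in> {0..s}" for r
      using D(2)[OF that] by simp
    fix u assume "u \<in> {0..s}" "0 < Z t z2 u \<omega> - Z t z1 u \<omega>"
    then show "0 \<le> bridge_drift \<mu> (t + u) (Z t z2 u \<omega>) - bridge_drift \<mu> (t + u) (Z t z1 u \<omega>)"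
      using drift_mono[OF mono, of "t + u" "Z t z1 u \<omega>" "Z t z2 u \<omega>"] t s by auto
  qed (use s solves_start[OF t sol(1)] solves_start[OF t sol(2)] \<open>z1 < z2\<close> in auto)
  then show ?thesis using solves_start[OF t sol(1)] solves_start[OF t sol(2)] by simp
qed

section \<open>An integrable bound on the path up to time 1\<close>

lemma solution_bounded:
  assumes t: "t \<in> {0..<1}" and sol: "solves t z \<omega>"
    and lim: "((\<lambda>s. Z t z s \<omega>) \<longlongrightarrow> Z t z (1 - t) \<omega>) (at_left (1 - t))"
  obtains K where "\<And>s. s \<in> {0..<1 - t} \<Longrightarrow> \<bar>Z t z s \<omega>\<bar> \<le> K"
proof -
  have "eventually (\<lambda>s. dist (Z t z s \<omega>) (Z t z (1 - t) \<omega>) < 1) (at_left (1 - t))"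
    by (rule tendstoD[OF lim]) simp
  then obtain b where b: "b < 1 - t" "\<And>s. b < s \<Longrightarrow> s < 1 - t \<Longrightarrow> dist (Z t z s \<omega>) (Z t z (1 - t) \<omega>) < 1"
    unfolding eventually_at_left_field by blast
  have "continuous_on {0..b} (\<lambda>s. Z t z s \<omega>)"
    using sol b(1) unfolding solves_def by (auto elim: continuous_on_subset)
  then have "bounded ((\<lambda>s. Z t z s \<omega>) ` {0..b})" by (intro compact_imp_bounded compact_continuous_image) auto
  then obtain B where B: "\<forall>s\<in>{0..b}. \<bar>Z t z s \<omega>\<bar> \<le> B" by (auto simp: bounded_iff)
  have "\<bar>Z t z s \<omega>\<bar> \<le> max B (\<bar>Z t z (1 - t) \<omega>\<bar> + 1)" if s: "s \<in> {0..<1 - t}" for s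
  proof (cases "s \<le> b")
    case True
    then have "\<bar>Z t z s \<omega>\<bar> \<le> B" using B s by simp
    then show ?thesis by simp
  next
    case False
    then have "dist (Z t z s \<omega>) (Z t z (1 - t) \<omega>) < 1" using s by (intro b) auto
    then show ?thesis unfolding dist_real_def by linarith
  qed
  then show thesis by (rule that)
qed

definition monotone_drift :: bool where
  "monotone_drift \<longleftrightarrow> (\<forall>t\<in>{0..<1}. antimono (\<lambda>z. bridge_h \<mu> t z - z)) \<or> (\<forall>t\<in>{0..<1}. mono (\<lambda>z. bridge_h \<mu> t z - z))"

text \<open>
  A decreasing drift need not be bounded near time 1, but it contracts: the distance between two
  paths of the process is at most twice that of the driving noises, so it suffices to compare
  almost every path with a single fixed one.
\<close>

lemma Z_dominated:
  assumes "monotone_drift" and t: "t \<in> {0..<1}"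
  obtains g where "integrable M g" "AE \<omega> in M. \<forall>s\<in>{0..<1 - t}. \<bar>Z t z s \<omega>\<bar> \<le> g \<omega>"
proof -
  obtain V where V: "integrable M V" "AE \<omega> in M. \<forall>r\<in>{0..1}. \<bar>W r \<omega>\<bar> \<le> V \<omega>"
    using brownian_sup_integrable[OF bm] by blast
  show thesis
  proof (cases "\<forall>t\<in>{0..<1}. antimono (\<lambda>z. bridge_h \<mu> t z - z)")
    case True
    have "AE \<omega> in M. solves t z \<omega> \<and> (\<forall>r\<in>{0..1}. \<bar>W r \<omega>\<bar> \<le> V \<omega>) \<and>
        ((\<lambda>s. Z t z s \<omega>) \<longlongrightarrow> Z t z (1 - t) \<omega>) (at_left (1 - t))"
      using AE_solves[OF t, of z] V(2) Z_terminal[OF t, of z] by eventually_elim auto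
    from eventually_happens'[OF ae_filter_bot this] obtain \<omega>0 where \<omega>0: "solves t z \<omega>0" "\<forall>r\<in>{0..1}. \<bar>W r \<omega>0\<bar> \<le> V \<omega>0"
        "((\<lambda>s. Z t z s \<omega>0) \<longlongrightarrow> Z t z (1 - t) \<omega>0) (at_left (1 - t))" by blast
    obtain K where K: "\<And>s. s \<in> {0..<1 - t} \<Longrightarrow> \<bar>Z t z s \<omega>0\<bar> \<le> K"
      using solution_bounded[OF t \<omega>0(1,3)] by blast
    show thesis
    proof (rule that)
      \<comment> \<open>For the fixed path, \<open>K\<close> and \<open>V \<omega>0\<close> are
        constants. The noise increments of the two paths differ by at most
        \<open>2 * (V \<omega> + V \<omega>0)\<close>, and the contraction bound doubles
        this.\<close>
      show "integrable M (\<lambda>\<omega>. K + 4 * (V \<omega> + V \<omega>0))" using V(1) by simp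
      show "AE \<omega> in M. \<forall>s\<in>{0..<1 - t}. \<bar>Z t z s \<omega>\<bar> \<le> K + 4 * (V \<omega> + V \<omega>0)"
        using AE_solves[OF t, of z] V(2)
      proof eventually_elim
        case (elim \<omega>)
        show ?case
        proof
          fix s assume s: "s \<in> {0..<1 - t}"
          have w: "\<bar>(W (t + r) \<omega> - W t \<omega>) - (W (t + r) \<omega>0 - W t \<omega>0)\<bar> \<le> 2 * (V \<omega> + V \<omega>0)" if "r \<in> {0..s}" for r
          proof -
            have "t \<in> {0..1}" "t + r \<in> {0..1}" using t s that by auto
            then have "\<bar>W t \<omega>\<bar> \<le> V \<omega>" "\<bar>W (t + r) \<omega>\<bar> \<le> V \<omega>" "\<bar>W t \<omega>0\<bar> \<le> V \<omega>0" "\<bar>W (t + r) \<omega>0\<bar> \<le> V \<omega>0"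
              using elim(2) \<omega>0(2) by blast+
            moreover have "\<bar>(b - a) - (d - c)\<bar> \<le> 2 * (v + w)" if "\<bar>a\<bar> \<le> v" "\<bar>b\<bar> \<le> v" "\<bar>c\<bar> \<le> w" "\<bar>d\<bar> \<le> w" for a b c d v w :: real
              using that by argo
            ultimately show ?thesis by blast
          qed
          then have w': "\<bar>(W (t + r) \<omega>0 - W t \<omega>0) - (W (t + r) \<omega> - W t \<omega>)\<bar> \<le> 2 * (V \<omega> + V \<omega>0)" if "r \<in> {0..s}" for r
            using that by (subst abs_minus_commute)
          show "\<bar>Z t z s \<omega>\<bar> \<le> K + 4 * (V \<omega> + V \<omega>0)"
            using antimono_pathwise_bound[OF True t \<omega>0(1) elim(1) s w]
              antimono_pathwise_bound[OF True t elim(1) \<omega>0(1) s w'] K[OF s]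
            by (simp add: abs_le_iff)
        qed
      qed
    qed
  next
    case False
    then have mono: "\<forall>t\<in>{0..<1}. mono (\<lambda>z. bridge_h \<mu> t z - z)" using assms(1) unfolding monotone_drift_def by blast
    obtain C where C: "\<forall>t\<in>{0..1/2}. \<forall>z. prob_space.variance (posterior \<mu> t z) (\<lambda>u. u) \<le> C"
      using bspec[OF var, of "1/2"] by auto
    obtain K where K: "0 \<le> K" "\<And>t z. 0 < t \<Longrightarrow> t < 1 \<Longrightarrow> \<bar>bridge_drift \<mu> t z\<bar> \<le> K * (1 + \<bar>z\<bar>)"
    proof (rule bridge_drift_linear_growth[OF \<mu> mean])
      show "prob_space.variance (posterior \<mu> t z) (\<lambda>u. u) \<le> C" if "0 < t" "t \<le> 1/2" for t z using C that by simp
      show "mono (\<lambda>z. bridge_h \<mu> t z - z)" if "0 < t" "t < 1" for t using mono that by simp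
    qed blast
    show thesis
    proof (rule that)
      show "integrable M (\<lambda>\<omega>. (1 + \<bar>z\<bar> + 2 * V \<omega>) * exp K)" using V(1) by simp
      show "AE \<omega> in M. \<forall>s\<in>{0..<1 - t}. \<bar>Z t z s \<omega>\<bar> \<le> (1 + \<bar>z\<bar> + 2 * V \<omega>) * exp K"
        using AE_solves[OF t, of z] V(2)
      proof eventually_elim
        case (elim \<omega>)
        note start = solves_start[OF t elim(1)]
        show ?case
        proof
          fix s assume s: "s \<in> {0..<1 - t}"
          have "\<bar>Z t z s \<omega>\<bar> \<le> (1 + \<bar>Z t z 0 \<omega>\<bar> + 2 * V \<omega>) * exp (K * s)"
          proof (rule linear_growth_bound[OF _ K(1)])
            show "continuous_on {0..s} (\<lambda>s. Z t z s \<omega>)"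
              using elim(1) s unfolding solves_def by (auto elim: continuous_on_subset)
            show "((\<lambda>u. bridge_drift \<mu> (t + u) (Z t z u \<omega>)) has_integral
              Z t z r \<omega> - Z t z 0 \<omega> - (W (t + r) \<omega> - W t \<omega>)) {0..r}" if "r \<in> {0..s}" for r
              using elim(1) s that unfolding solves_def start by auto
            show "\<bar>W (t + r) \<omega> - W t \<omega>\<bar> \<le> 2 * V \<omega>" if "r \<in> {0..s}" for r
            proof -
              have "t \<in> {0..1}" "t + r \<in> {0..1}" using t s that by auto
              then have "\<bar>W t \<omega>\<bar> \<le> V \<omega>" "\<bar>W (t + r) \<omega>\<bar> \<le> V \<omega>" using elim(2) by blast+
              then show ?thesis by linarith
            qed
            show "\<bar>bridge_drift \<mu> (t + u) (Z t z u \<omega>)\<bar> \<le> K * (1 + \<bar>Z t z u \<omega>\<bar>)" if "0 < u" "u \<le> s" for u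
              using t s that by (intro K) auto
          qed (use s in auto)
          also have "\<dots> \<le> (1 + \<bar>z\<bar> + 2 * V \<omega>) * exp (K * 1)"
          proof -
            have "0 \<le> V \<omega>" using elim(2)[rule_format, of 0] by simp
            moreover have "K * s \<le> K * 1" using K(1) s t by (intro mult_left_mono) auto
            ultimately show ?thesis unfolding start by (intro mult_left_mono) auto
          qed
          finally show "\<bar>Z t z s \<omega>\<bar> \<le> (1 + \<bar>z\<bar> + 2 * V \<omega>) * exp K" by simp
        qed
      qed
    qed
  qed
qed

text \<open>
  Up to null sets the processes started from different points generate the same filtration: their
  difference solves an ordinary differential equation whose coefficients depend on one of them only.
\<close>

lemma Z_adapted_to_other_start:
  assumes t: "t \<in> {0..<1}" and s: "s \<in> {0..<1 - t}" and r: "r \<in> {0..s}"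
  shows "\<exists>Y\<in>borel_measurable (natural_filtration M {0..1 - t} (Z t z1) s). AE \<omega> in M. Y \<omega> = Z t z2 r \<omega>"
proof -
  define F where "F = natural_filtration M {0..1 - t} (Z t z1) s"
  have spF: "space F = space M" by (simp add: F_def)
  \<comment> \<open>Clamping time to \<open>{0..s}\<close> makes \<open>X u\<close> measurable for
    \<open>F\<close> and its paths continuous at every real time.\<close>
  define cl where "cl u = max 0 (min u s)" for u
  have cl: "cl u \<in> {0..s}" for u using s by (auto simp: cl_def)
  have cl_id: "cl u = u" if "u \<in> {0..s}" for u using that by (auto simp: cl_def)
  have cl_cont: "continuous_on UNIV cl" unfolding cl_def by (intro continuous_intros)
  have clZ: "continuous_on UNIV (\<lambda>u. Z t z (cl u) \<omega>)" if "continuous_on {0..<1 - t} (\<lambda>s. Z t z s \<omega>)" for z \<omega>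
  proof (rule continuous_on_compose2[OF that cl_cont])
    show "range cl \<subseteq> {0..<1 - t}"
    proof
      fix x assume "x \<in> range cl"
      then obtain u where "x = cl u" by blast
      then show "x \<in> {0..<1 - t}" using cl[of u] s by auto
    qed
  qed
  define X where "X u = Z t z1 (cl u)" for u
  have Xm: "X u \<in> borel_measurable F" for u
    unfolding X_def F_def using cl[of u] s by (intro natural_filtration_measurable) auto
  have Xj: "(\<lambda>p. X (fst p) (snd p)) \<in> borel_measurable (borel \<Otimes>\<^sub>M F)"
    by (rule jointly_measurable_continuous[OF Xm]) (use clZ Z_continuous[OF t] spF in \<open>simp add: X_def\<close>)
  \<comment> \<open>The drift as a quotient of tilted moments, whose joint measurability in time and
    space is known.\<close>
  define \<phi> where "\<phi> p = (tilted_moment \<mu> 1 (fst p / (1 - fst p)) (snd p / (1 - fst p))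
      / tilted_moment \<mu> 0 (fst p / (1 - fst p)) (snd p / (1 - fst p)) - snd p) / (1 - fst p)" for p :: "real \<times> real"
  have \<phi>: "bridge_drift \<mu> u z = \<phi> (u, z)" if "u < 1" for u z
    using that by (simp add: bridge_drift_def \<phi>_def bridge_h_eq_f[OF \<mu>] bridge_f_eq[OF \<mu>])
  have tm: "(\<lambda>p. tilted_moment \<mu> k (fst p / (1 - fst p)) (snd p / (1 - fst p))) \<in> borel_measurable (borel \<Otimes>\<^sub>M borel)" for k
  proof -
    have "(\<lambda>p. (fst p / (1 - fst p), snd p / (1 - fst p))) \<in> borel \<Otimes>\<^sub>M borel \<rightarrow>\<^sub>M borel \<Otimes>\<^sub>M (borel :: real measure)"
      by measurable
    from measurable_compose[OF this tilted_moment_measurable[OF \<mu>]] show ?thesis by simp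
  qed
  have \<phi>m: "\<phi> \<in> borel_measurable (borel \<Otimes>\<^sub>M borel)"
    unfolding \<phi>_def[abs_def] by (intro borel_measurable_divide borel_measurable_diff tm) measurable
  \<comment> \<open>The right-hand side of the equation for the gap \<open>x\<close> to the path
    from \<open>z1\<close>; it depends on \<omega> only through that path. Time \<open>u = 0\<close>
    is excluded because the Lipschitz bound covers only positive times.\<close>
  define a where "a u \<omega> x = (if 0 < u \<and> u \<le> s then \<phi> (t + u, X u \<omega> + x) - \<phi> (t + u, X u \<omega>) else 0)" for u \<omega> x
  have am: "(\<lambda>p. a (fst p) (fst (snd p)) (snd (snd p))) \<in> borel_measurable (borel \<Otimes>\<^sub>M (F \<Otimes>\<^sub>M borel))"
  proof -
    have "(\<lambda>p. (fst p, fst (snd p))) \<in> borel \<Otimes>\<^sub>M (F \<Otimes>\<^sub>M borel) \<rightarrow>\<^sub>M borel \<Otimes>\<^sub>M F" by measurable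
    from measurable_compose[OF this Xj]
    have [measurable]: "(\<lambda>p. X (fst p) (fst (snd p))) \<in> borel_measurable (borel \<Otimes>\<^sub>M (F \<Otimes>\<^sub>M (borel :: real measure)))" by simp
    have "(\<lambda>p. \<phi> (t + fst p, X (fst p) (fst (snd p)) + snd (snd p))) \<in> borel_measurable (borel \<Otimes>\<^sub>M (F \<Otimes>\<^sub>M borel))"
      by (rule measurable_compose[OF _ \<phi>m]) measurable
    moreover have "(\<lambda>p. \<phi> (t + fst p, X (fst p) (fst (snd p)))) \<in> borel_measurable (borel \<Otimes>\<^sub>M (F \<Otimes>\<^sub>M (borel :: real measure)))"
      by (rule measurable_compose[OF _ \<phi>m]) measurable
    ultimately show ?thesis unfolding a_def by measurable
  qed
  obtain L where L: "0 \<le> L"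
    "\<And>u z z'. 0 < u \<Longrightarrow> u \<le> t + s \<Longrightarrow> \<bar>bridge_drift \<mu> u z - bridge_drift \<mu> u z'\<bar> \<le> L * \<bar>z - z'\<bar>"
    using drift_lipschitz[of "t + s"] s by auto
  have aL: "\<bar>a u \<omega> x - a u \<omega> y\<bar> \<le> L * \<bar>x - y\<bar>" for u \<omega> x y
  proof (cases "0 < u \<and> u \<le> s")
    case True
    then have u: "t + u < 1" "0 < t + u" "t + u \<le> t + s" using s t by auto
    have "a u \<omega> x - a u \<omega> y = bridge_drift \<mu> (t + u) (X u \<omega> + x) - bridge_drift \<mu> (t + u) (X u \<omega> + y)"
      using True u by (simp add: a_def \<phi>)
    then show ?thesis using L(2)[OF u(2,3), of "X u \<omega> + x" "X u \<omega> + y"] by simp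
  qed (use L(1) in \<open>auto simp: a_def\<close>)
  \<comment> \<open>A limit of measurable iterates is measurable even where they fail to converge;
    almost everywhere it equals the true gap.\<close>
  define Y where "Y \<omega> = X r \<omega> + lim (\<lambda>n. picard a (z2 - z1) n r \<omega>)" for \<omega>
  have "Y \<in> borel_measurable F"
  proof -
    have "(\<lambda>\<omega>. picard a (z2 - z1) n r \<omega>) \<in> borel_measurable F" for n
    proof -
      have "(\<lambda>\<omega>. (r, \<omega>)) \<in> F \<rightarrow>\<^sub>M borel \<Otimes>\<^sub>M F" by measurable
      from measurable_compose[OF this picard_measurable[OF am]] show ?thesis by simp
    qed
    then show ?thesis unfolding Y_def by (intro borel_measurable_add Xm borel_measurable_lim_metric)
  qed
  moreover have "AE \<omega> in M. Y \<omega> = Z t z2 r \<omega>"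
    using AE_solves[OF t, of z1] AE_solves[OF t, of z2] AE_space
  proof eventually_elim
    case (elim \<omega>)
    define \<delta> where "\<delta> u = Z t z2 (cl u) \<omega> - Z t z1 (cl u) \<omega>" for u
    have "(\<lambda>n. picard a (z2 - z1) n r \<omega>) \<longlonglongrightarrow> \<delta> r"
    proof (rule picard_converges[OF am L(1) aL])
      show "a u \<omega> 0 = 0" for u by (simp add: a_def)
      show "\<omega> \<in> space F" using elim spF by simp
      show "continuous_on UNIV \<delta>" unfolding \<delta>_def
        using elim by (intro continuous_on_diff clZ Z_continuous t)
      show "((\<lambda>u. a u \<omega> (\<delta> u)) has_integral \<delta> v - (z2 - z1)) {0..v}" if v: "v \<in> {0..s}" for v
      proof -
        have s': "s < 1 - t" using s by auto
        have "((\<lambda>u. bridge_drift \<mu> (t + u) (Z t z2 u \<omega>) - bridge_drift \<mu> (t + u) (Z t z1 u \<omega>)) has_integral \<delta> v - (z2 - z1)) {0..v}"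
          using solves_difference(2)[OF t elim(1,2) s' v] solves_start[OF t elim(1)] solves_start[OF t elim(2)] v
          by (simp add: \<delta>_def cl_id)
        note eq = this
        have pw: "a u \<omega> (\<delta> u) = bridge_drift \<mu> (t + u) (Z t z2 u \<omega>) - bridge_drift \<mu> (t + u) (Z t z1 u \<omega>)"
          if "u \<in> {0..v} - {0}" for u
          using that v s t by (auto simp: a_def \<phi> \<delta>_def X_def cl_id)
        show ?thesis by (rule has_integral_spike_finite[of "{0}", OF _ _ eq]) (simp_all add: pw)
      qed
    qed (use r in auto)
    then have "lim (\<lambda>n. picard a (z2 - z1) n r \<omega>) = \<delta> r" by (rule limI)
    then show ?case using r by (simp add: Y_def \<delta>_def X_def cl_id)
  qed
  ultimately show ?thesis unfolding F_def by blast
qed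

text \<open>Each of the finitely many events \<open>A k\<close> is replaced by an almost surely
  equal event for the path from \<open>z2\<close>. The grid points lie strictly before the horizon,
  as \<open>Z_adapted_to_other_start\<close> requires.\<close>

lemma grid_time_transfer:
  assumes t: "t \<in> {0..<1}"
    and A: "\<And>k. k < m \<Longrightarrow> A k \<in> sets (natural_filtration M {0..1 - t} (Z t z1) (real k * (1 - t) / real (Suc m)))"
  obtains B where "\<And>k. k < m \<Longrightarrow> B k \<in> sets M" "grid_time (1 - t) m B \<in> stopping_times M (Z t z2) (1 - t)"
    "AE \<omega> in M. grid_time (1 - t) m B \<omega> = grid_time (1 - t) m A \<omega>"
proof -
  let ?F = "\<lambda>z. natural_filtration M {0..1 - t} (Z t z)"
  have "\<exists>B\<in>sets (?F z2 (real k * (1 - t) / real (Suc m))). AE \<omega> in M. \<omega> \<in> A k \<longleftrightarrow> \<omega> \<in> B" if k: "k < m" for k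
  proof (rule natural_filtration_AE_transfer[OF _ _ A[OF k]])
    have "real k * (1 - t) / real (Suc m) \<le> real m * (1 - t) / real (Suc m)"
      using k t by (intro divide_right_mono mult_right_mono) auto
    also have "\<dots> < 1 - t" using t by (intro grid_time_less) auto
    finally have s: "real k * (1 - t) / real (Suc m) \<in> {0..<1 - t}" using t by auto
    fix r assume "r \<in> {0..1 - t}" "r \<le> real k * (1 - t) / real (Suc m)"
    then show "\<exists>Y\<in>borel_measurable (?F z2 (real k * (1 - t) / real (Suc m))). AE \<omega> in M. Y \<omega> = Z t z1 r \<omega>"
      by (intro Z_adapted_to_other_start[OF t s]) auto
  qed simp
  then have "\<forall>k. \<exists>B. k < m \<longrightarrow> B \<in> sets (?F z2 (real k * (1 - t) / real (Suc m))) \<and> (AE \<omega> in M. \<omega> \<in> A k \<longleftrightarrow> \<omega> \<in> B)"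
    by blast
  then obtain B where B: "\<And>k. k < m \<Longrightarrow> B k \<in> sets (?F z2 (real k * (1 - t) / real (Suc m)))"
    "\<And>k. k < m \<Longrightarrow> AE \<omega> in M. \<omega> \<in> A k \<longleftrightarrow> \<omega> \<in> B k" by metis
  have T: "0 \<le> 1 - t" "0 < 1 - t" using t by auto
  have "stopping_time (?F z2) (grid_time (1 - t) m B)"
    by (rule grid_time_stopping[where F="?F z2", OF T(1) natural_filtration_mono space_natural_filtration B(1)])
  moreover have "grid_time (1 - t) m B \<omega> \<in> {0..1 - t}" for \<omega>
    using grid_time_range[OF T(1), of m B \<omega>] grid_time_less[OF T(2), of m] by auto
  ultimately have "grid_time (1 - t) m B \<in> stopping_times M (Z t z2) (1 - t)" by (simp add: stopping_times_def)
  moreover have "AE \<omega> in M. \<forall>k\<in>{..<m}. \<omega> \<in> A k \<longleftrightarrow> \<omega> \<in> B k"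
    using B(2) by (subst AE_ball_countable) auto
  then have "AE \<omega> in M. grid_time (1 - t) m B \<omega> = grid_time (1 - t) m A \<omega>"
  proof eventually_elim
    case (elim \<omega>)
    then have "(LEAST k. k = m \<or> \<omega> \<in> B k) = (LEAST k. k = m \<or> \<omega> \<in> A k)"
    proof -
      have le: "(LEAST k. k = m \<or> \<omega> \<in> B k) \<le> (LEAST k. k = m \<or> \<omega> \<in> A k)"
        if "\<forall>k\<in>{..<m}. \<omega> \<in> A k \<longrightarrow> \<omega> \<in> B k" for A B :: "nat \<Rightarrow> 'w set"
        using grid_index_cases[of m A \<omega>] grid_index_le[of m A \<omega>] that
        unfolding grid_index_def by (intro Least_le) (metis lessThan_iff order_le_less)
      from elim show ?thesis by (intro antisym le) auto
    qed
    then show ?case by (simp add: grid_time_def grid_index_def)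
  qed
  moreover have "B k \<in> sets M" if "k < m" for k
    using B(1)[OF that] natural_filtration_subset[of "{0..1 - t}" "Z t z2" M, OF Z_measurable[OF t]] by blast
  ultimately show thesis by (intro that)
qed

lemma Z_grid_time_integrable:
  assumes "monotone_drift" and t: "t \<in> {0..<1}"
    and \<sigma>: "\<sigma> = grid_time (1 - t) m A" and A: "\<And>k. k < m \<Longrightarrow> A k \<in> sets M"
  shows "integrable M (\<lambda>\<omega>. Z t z (\<sigma> \<omega>) \<omega>)"
proof -
  obtain g where g: "integrable M g" "AE \<omega> in M. \<forall>s\<in>{0..<1 - t}. \<bar>Z t z s \<omega>\<bar> \<le> g \<omega>"
    using Z_dominated[OF assms(1) t] by blast
  have T: "0 \<le> 1 - t" "0 < 1 - t" using t by auto
  have range: "real i * (1 - t) / real (Suc m) \<in> {0..<1 - t}" if "i \<le> m" for i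
  proof -
    have "real i * (1 - t) / real (Suc m) \<le> real m * (1 - t) / real (Suc m)"
      using that T by (intro divide_right_mono mult_right_mono) auto
    also have "\<dots> < 1 - t" using T by (intro grid_time_less) auto
    finally show ?thesis using T by auto
  qed
  have eq: "Z t z (\<sigma> \<omega>) \<omega> = Z t z (real (min (grid_index m A \<omega>) m) * (1 - t) / real (Suc m)) \<omega>" for \<omega>
    unfolding \<sigma> grid_time_def using grid_index_le[of m A \<omega>] by (simp add: min_absorb1)
  have idx: "grid_index m A \<in> M \<rightarrow>\<^sub>M count_space UNIV"
  proof -
    \<comment> \<open>Only the sets \<open>A k\<close> with \<open>k < m\<close> are known to be
      measurable. The guard leaves the least index unchanged, since \<open>k = m\<close> always
      qualifies.\<close>
    have "Measurable.pred M (\<lambda>\<omega>. k = m \<or> (k < m \<and> \<omega> \<in> A k))" for k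
    proof (cases "k < m")
      case True
      have "{\<omega> \<in> space M. k = m \<or> (k < m \<and> \<omega> \<in> A k)} = A k" using True sets.sets_into_space[OF A[OF True]] by auto
      then show ?thesis using A[OF True] by (simp add: pred_def)
    qed simp
    then have "(\<lambda>\<omega>. LEAST k. k = m \<or> (k < m \<and> \<omega> \<in> A k)) \<in> M \<rightarrow>\<^sub>M count_space UNIV" by (rule measurable_Least)
    moreover have "grid_index m A = (\<lambda>\<omega>. LEAST k. k = m \<or> (k < m \<and> \<omega> \<in> A k))"
    proof
      fix \<omega>
      have 1: "grid_index m A \<omega> = m \<or> (grid_index m A \<omega> < m \<and> \<omega> \<in> A (grid_index m A \<omega>))"
        using grid_index_cases[of m A \<omega>] grid_index_le[of m A \<omega>] by auto
      show "grid_index m A \<omega> = (LEAST k. k = m \<or> (k < m \<and> \<omega> \<in> A k))"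
      proof (rule Least_equality[symmetric])
        show "grid_index m A \<omega> = m \<or> (grid_index m A \<omega> < m \<and> \<omega> \<in> A (grid_index m A \<omega>))" by (rule 1)
        fix y assume "y = m \<or> y < m \<and> \<omega> \<in> A y"
        then show "grid_index m A \<omega> \<le> y" using grid_index_le[of m A \<omega>] grid_index_le_if[of \<omega> A y m] by auto
      qed
    qed
    ultimately show ?thesis by (simp only:)
  qed
  have "(\<lambda>\<omega>. Z t z (real (min i m) * (1 - t) / real (Suc m)) \<omega>) \<in> borel_measurable M" for i
    using range[of "min i m"] by (intro Z_measurable[OF t]) auto
  from measurable_compose_countable[OF this idx]
  have meas: "(\<lambda>\<omega>. Z t z (\<sigma> \<omega>) \<omega>) \<in> borel_measurable M" unfolding eq by simp
  show ?thesis
  proof (rule Bochner_Integration.integrable_bound[OF g(1) meas])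
    show "AE \<omega> in M. norm (Z t z (\<sigma> \<omega>) \<omega>) \<le> norm (g \<omega>)"
      using g(2)
    proof eventually_elim
      case (elim \<omega>)
      have "\<sigma> \<omega> \<in> {0..<1 - t}" unfolding \<sigma> grid_time_def using range[OF grid_index_le[of m A \<omega>]] .
      with elim have "\<bar>Z t z (\<sigma> \<omega>) \<omega>\<bar> \<le> g \<omega>" by blast
      then show ?case by simp
    qed
  qed
qed

text \<open>
  The last inequality holds because, up to null sets, \<open>\<sigma>\<close> is a stopping time for the process started
  from any other point; the filtrations are not completed, so this is only achieved for
  grid-valued approximations of a stopping time.
\<close>

lemma nearly_optimal_time:
  assumes mon: "monotone_drift" and t: "t \<in> {0..<1}" and z: "ereal c < value_function M Z t z"
  obtains \<sigma> s1 where "s1 < 1 - t" "\<And>\<omega>. \<sigma> \<omega> \<in> {0..s1}" "c < expectation (\<lambda>\<omega>. Z t z (\<sigma> \<omega>) \<omega>)"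
    "\<And>z'. integrable M (\<lambda>\<omega>. Z t z' (\<sigma> \<omega>) \<omega>)"
    "\<And>z'. ereal (expectation (\<lambda>\<omega>. Z t z' (\<sigma> \<omega>) \<omega>)) \<le> value_function M Z t z'"
proof -
  have T: "0 \<le> 1 - t" "0 < 1 - t" using t by auto
  let ?F = "natural_filtration M {0..1 - t} (Z t z)"
  obtain \<tau> where \<tau>: "\<tau> \<in> stopping_times M (Z t z) (1 - t)" "c < expectation (\<lambda>\<omega>. Z t z (\<tau> \<omega>) \<omega>)"
    using z by (auto simp: value_function_def less_SUP_iff)
  have st: "stopping_time ?F \<tau>" and range: "\<And>\<omega>. \<omega> \<in> space M \<Longrightarrow> \<tau> \<omega> \<in> {0..1 - t}"
    using \<tau>(1) by (auto simp: stopping_times_def)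
  have FM: "sets (?F s) \<subseteq> sets M" for s by (rule natural_filtration_subset) (rule Z_measurable[OF t])
  have \<tau>F: "{\<omega> \<in> space M. \<tau> \<omega> \<le> s} \<in> sets (?F s)" for s
    using stopping_timeD[OF st, of s] by (simp add: pred_def)
  have \<tau>m: "\<tau> \<in> borel_measurable M"
    by (rule borel_measurableI_le) (use \<tau>F FM in blast)
  obtain g where g: "integrable M g" "AE \<omega> in M. \<forall>s\<in>{0..<1 - t}. \<bar>Z t z s \<omega>\<bar> \<le> g \<omega>"
    using Z_dominated[OF mon t] by blast
  have "(\<lambda>m. expectation (\<lambda>\<omega>. Z t z (grid_time (1 - t) m (\<lambda>k. {\<omega> \<in> space M. \<tau> \<omega> \<le> real k * (1 - t) / real (Suc m)}) \<omega>) \<omega>))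
    \<longlonglongrightarrow> expectation (\<lambda>\<omega>. Z t z (\<tau> \<omega>) \<omega>)"
    by (rule grid_time_expectation[OF T(2) Z_measurable[OF t] Z_continuous[OF t] Z_terminal[OF t] g \<tau>m range])
  from order_tendstoD(1)[OF this \<tau>(2)] obtain m where
    m: "c < expectation (\<lambda>\<omega>. Z t z (grid_time (1 - t) m (\<lambda>k. {\<omega> \<in> space M. \<tau> \<omega> \<le> real k * (1 - t) / real (Suc m)}) \<omega>) \<omega>)"
    by (auto simp: eventually_sequentially)
  define A where "A = (\<lambda>k. {\<omega> \<in> space M. \<tau> \<omega> \<le> real k * (1 - t) / real (Suc m)})"
  define \<sigma> where "\<sigma> = grid_time (1 - t) m A"
  have AF: "A k \<in> sets (?F (real k * (1 - t) / real (Suc m)))" for k unfolding A_def by (rule \<tau>F)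
  show thesis
  proof (rule that)
    show "real m * (1 - t) / real (Suc m) < 1 - t" by (rule grid_time_less[OF T(2)])
    show "\<sigma> \<omega> \<in> {0..real m * (1 - t) / real (Suc m)}" for \<omega>
      using grid_time_range[OF T(1), of m A \<omega>] by (simp add: \<sigma>_def)
    show "c < expectation (\<lambda>\<omega>. Z t z (\<sigma> \<omega>) \<omega>)" using m by (simp add: \<sigma>_def A_def)
    show "integrable M (\<lambda>\<omega>. Z t z' (\<sigma> \<omega>) \<omega>)" for z'
      by (rule Z_grid_time_integrable[OF mon t \<sigma>_def]) (use AF FM in blast)
    show "ereal (expectation (\<lambda>\<omega>. Z t z' (\<sigma> \<omega>) \<omega>)) \<le> value_function M Z t z'" for z'
    proof -
      obtain B where BM: "\<And>k. k < m \<Longrightarrow> B k \<in> sets M"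
        and stop: "grid_time (1 - t) m B \<in> stopping_times M (Z t z') (1 - t)"
        and eq: "AE \<omega> in M. grid_time (1 - t) m B \<omega> = \<sigma> \<omega>"
        unfolding \<sigma>_def using grid_time_transfer[where A=A, OF t AF] by blast
      have "integrable M (\<lambda>\<omega>. Z t z' (grid_time (1 - t) m B \<omega>) \<omega>)"
        by (rule Z_grid_time_integrable[OF mon t refl BM])
      moreover have "integrable M (\<lambda>\<omega>. Z t z' (\<sigma> \<omega>) \<omega>)"
        by (rule Z_grid_time_integrable[OF mon t \<sigma>_def]) (use AF FM in blast)
      ultimately have "expectation (\<lambda>\<omega>. Z t z' (grid_time (1 - t) m B \<omega>) \<omega>) = expectation (\<lambda>\<omega>. Z t z' (\<sigma> \<omega>) \<omega>)"
        using eq by (intro integral_cong_AE) auto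
      then show ?thesis unfolding value_function_def using stop by (intro SUP_upper2[OF stop]) simp
    qed
  qed
qed

section \<open>Shape of the continuation region\<close>

text \<open>The time that is good from \<open>z2\<close> is also used from \<open>z1\<close>: the
  gap between the paths is at most \<open>z2 - z1\<close>, so the expected gain over the starting
  point is no smaller.\<close>

lemma continuation_region_down:
  assumes anti: "\<forall>t\<in>{0..<1}. antimono (\<lambda>z. bridge_h \<mu> t z - z)" and t: "t \<in> {0..<1}"
    and C: "ereal z2 < value_function M Z t z2" and le: "z1 < z2"
  shows "ereal z1 < value_function M Z t z1"
proof -
  have mon: monotone_drift using anti by (simp add: monotone_drift_def)
  obtain \<sigma> s1 where \<sigma>: "s1 < 1 - t" "\<And>\<omega>. \<sigma> \<omega> \<in> {0..s1}" "z2 < expectation (\<lambda>\<omega>. Z t z2 (\<sigma> \<omega>) \<omega>)"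
    "\<And>z'. integrable M (\<lambda>\<omega>. Z t z' (\<sigma> \<omega>) \<omega>)"
    "\<And>z'. ereal (expectation (\<lambda>\<omega>. Z t z' (\<sigma> \<omega>) \<omega>)) \<le> value_function M Z t z'"
    by (rule nearly_optimal_time[OF mon t C]) (rule that; assumption)
  have "expectation (\<lambda>\<omega>. Z t z2 (\<sigma> \<omega>) \<omega> - (z2 - z1)) \<le> expectation (\<lambda>\<omega>. Z t z1 (\<sigma> \<omega>) \<omega>)"
  proof (rule integral_mono_AE)
    show "AE \<omega> in M. Z t z2 (\<sigma> \<omega>) \<omega> - (z2 - z1) \<le> Z t z1 (\<sigma> \<omega>) \<omega>"
      using AE_solves[OF t, of z1] AE_solves[OF t, of z2]
    proof eventually_elim
      case (elim \<omega>)
      have "\<sigma> \<omega> \<in> {0..<1 - t}" using \<sigma>(1) \<sigma>(2)[of \<omega>] by auto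
      from antimono_comparison(2)[OF anti t elim this] le show ?case by simp
    qed
  qed (use \<sigma>(4) in simp_all)
  then have "z1 < expectation (\<lambda>\<omega>. Z t z1 (\<sigma> \<omega>) \<omega>)" using \<sigma>(3) \<sigma>(4)[of z2] by (simp add: prob_space)
  then show ?thesis using \<sigma>(5)[of z1] by (meson ereal_less(2) less_ereal.simps(1) less_le_trans)
qed

text \<open>Starting higher does not lower the path, so every \<open>z'\<close> between
  \<open>z\<close> and the expected payoff from \<open>z\<close> works.\<close>

lemma continuation_region_right_open:
  assumes anti: "\<forall>t\<in>{0..<1}. antimono (\<lambda>z. bridge_h \<mu> t z - z)" and t: "t \<in> {0..<1}"
    and C: "ereal z < value_function M Z t z"
  shows "\<exists>z'>z. ereal z' < value_function M Z t z'"
proof -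
  have mon: monotone_drift using anti by (simp add: monotone_drift_def)
  obtain \<sigma> s1 where \<sigma>: "s1 < 1 - t" "\<And>\<omega>. \<sigma> \<omega> \<in> {0..s1}" "z < expectation (\<lambda>\<omega>. Z t z (\<sigma> \<omega>) \<omega>)"
    "\<And>z'. integrable M (\<lambda>\<omega>. Z t z' (\<sigma> \<omega>) \<omega>)"
    "\<And>z'. ereal (expectation (\<lambda>\<omega>. Z t z' (\<sigma> \<omega>) \<omega>)) \<le> value_function M Z t z'"
    by (rule nearly_optimal_time[OF mon t C]) (rule that; assumption)
  obtain z' where z': "z < z'" "z' < expectation (\<lambda>\<omega>. Z t z (\<sigma> \<omega>) \<omega>)" using dense[OF \<sigma>(3)] by blast
  have "expectation (\<lambda>\<omega>. Z t z (\<sigma> \<omega>) \<omega>) \<le> expectation (\<lambda>\<omega>. Z t z' (\<sigma> \<omega>) \<omega>)"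
  proof (rule integral_mono_AE)
    show "AE \<omega> in M. Z t z (\<sigma> \<omega>) \<omega> \<le> Z t z' (\<sigma> \<omega>) \<omega>"
      using AE_solves[OF t, of z] AE_solves[OF t, of z']
    proof eventually_elim
      case (elim \<omega>)
      have "\<sigma> \<omega> \<in> {0..<1 - t}" using \<sigma>(1) \<sigma>(2)[of \<omega>] by auto
      from antimono_comparison(1)[OF anti t elim this] z' show ?case by simp
    qed
  qed (use \<sigma>(4) in simp_all)
  then have "ereal z' < ereal (expectation (\<lambda>\<omega>. Z t z' (\<sigma> \<omega>) \<omega>))" using z'(2) by simp
  then show ?thesis using z'(1) less_le_trans[OF _ \<sigma>(5)[of z']] by blast
qed

text \<open>The gap never falls below \<open>z2 - z1\<close>, so the time that is good from
  \<open>z1\<close> gains at least as much from \<open>z2\<close>.\<close>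

lemma continuation_region_up:
  assumes mono: "\<forall>t\<in>{0..<1}. mono (\<lambda>z. bridge_h \<mu> t z - z)" and t: "t \<in> {0..<1}"
    and C: "ereal z1 < value_function M Z t z1" and le: "z1 < z2"
  shows "ereal z2 < value_function M Z t z2"
proof -
  have mon: monotone_drift using mono by (simp add: monotone_drift_def)
  obtain \<sigma> s1 where \<sigma>: "s1 < 1 - t" "\<And>\<omega>. \<sigma> \<omega> \<in> {0..s1}" "z1 < expectation (\<lambda>\<omega>. Z t z1 (\<sigma> \<omega>) \<omega>)"
    "\<And>z'. integrable M (\<lambda>\<omega>. Z t z' (\<sigma> \<omega>) \<omega>)"
    "\<And>z'. ereal (expectation (\<lambda>\<omega>. Z t z' (\<sigma> \<omega>) \<omega>)) \<le> value_function M Z t z'"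
    by (rule nearly_optimal_time[OF mon t C]) (rule that; assumption)
  have "expectation (\<lambda>\<omega>. Z t z1 (\<sigma> \<omega>) \<omega> + (z2 - z1)) \<le> expectation (\<lambda>\<omega>. Z t z2 (\<sigma> \<omega>) \<omega>)"
  proof (rule integral_mono_AE)
    show "AE \<omega> in M. Z t z1 (\<sigma> \<omega>) \<omega> + (z2 - z1) \<le> Z t z2 (\<sigma> \<omega>) \<omega>"
      using AE_solves[OF t, of z1] AE_solves[OF t, of z2]
    proof eventually_elim
      case (elim \<omega>)
      have "\<sigma> \<omega> \<in> {0..<1 - t}" using \<sigma>(1) \<sigma>(2)[of \<omega>] by auto
      from mono_comparison[OF mono t elim this le] show ?case by simp
    qed
  qed (use \<sigma>(4) in simp_all)
  then have "ereal z2 < ereal (expectation (\<lambda>\<omega>. Z t z2 (\<sigma> \<omega>) \<omega>))" using \<sigma>(3) \<sigma>(4)[of z1] by (simp add: prob_space)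
  then show ?thesis using \<sigma>(5)[of z2] by (rule less_le_trans)
qed

text \<open>Lowering the starting point may now lower the payoff by more than the shift; the
  Lipschitz constant up to the last grid point limits the loss.\<close>

lemma continuation_region_left_open:
  assumes mono: "\<forall>t\<in>{0..<1}. mono (\<lambda>z. bridge_h \<mu> t z - z)" and t: "t \<in> {0..<1}"
    and C: "ereal z < value_function M Z t z"
  shows "\<exists>z'<z. ereal z' < value_function M Z t z'"
proof -
  have mon: monotone_drift using mono by (simp add: monotone_drift_def)
  obtain \<sigma> s1 where \<sigma>: "s1 < 1 - t" "\<And>\<omega>. \<sigma> \<omega> \<in> {0..s1}" "z < expectation (\<lambda>\<omega>. Z t z (\<sigma> \<omega>) \<omega>)"
    "\<And>z'. integrable M (\<lambda>\<omega>. Z t z' (\<sigma> \<omega>) \<omega>)"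
    "\<And>z'. ereal (expectation (\<lambda>\<omega>. Z t z' (\<sigma> \<omega>) \<omega>)) \<le> value_function M Z t z'"
    by (rule nearly_optimal_time[OF mon t C]) (rule that; assumption)
  obtain K where K: "0 \<le> K" "\<And>\<omega> z1 z2 s. solves t z1 \<omega> \<Longrightarrow> solves t z2 \<omega> \<Longrightarrow> s \<in> {0..s1} \<Longrightarrow>
      \<bar>Z t z2 s \<omega> - Z t z1 s \<omega>\<bar> \<le> K * \<bar>z2 - z1\<bar>"
    using solves_lipschitz[OF t \<sigma>(1)] by blast
  \<comment> \<open>With this choice the payoff from \<open>z - \<epsilon>\<close> is at least
    \<open>z + \<epsilon>\<close> after subtracting the loss \<open>K * \<epsilon>\<close>; dividing
    by \<open>K + 1\<close> also covers \<open>K = 0\<close>.\<close>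
  define \<epsilon> where "\<epsilon> = (expectation (\<lambda>\<omega>. Z t z (\<sigma> \<omega>) \<omega>) - z) / (K + 1)"
  have \<epsilon>: "0 < \<epsilon>" unfolding \<epsilon>_def using K(1) \<sigma>(3) by (intro divide_pos_pos) auto
  have \<epsilon>K: "\<epsilon> * (K + 1) = expectation (\<lambda>\<omega>. Z t z (\<sigma> \<omega>) \<omega>) - z" unfolding \<epsilon>_def using K(1) by simp
  have "expectation (\<lambda>\<omega>. Z t z (\<sigma> \<omega>) \<omega> - K * \<epsilon>) \<le> expectation (\<lambda>\<omega>. Z t (z - \<epsilon>) (\<sigma> \<omega>) \<omega>)"
  proof (rule integral_mono_AE)
    show "AE \<omega> in M. Z t z (\<sigma> \<omega>) \<omega> - K * \<epsilon> \<le> Z t (z - \<epsilon>) (\<sigma> \<omega>) \<omega>"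
      using AE_solves[OF t, of z] AE_solves[OF t, of "z - \<epsilon>"]
    proof eventually_elim
      case (elim \<omega>)
      from K(2)[OF elim \<sigma>(2)[of \<omega>]] \<epsilon> show ?case by (simp add: abs_le_iff)
    qed
  qed (use \<sigma>(4) in simp_all)
  then have "expectation (\<lambda>\<omega>. Z t z (\<sigma> \<omega>) \<omega>) - K * \<epsilon> \<le> expectation (\<lambda>\<omega>. Z t (z - \<epsilon>) (\<sigma> \<omega>) \<omega>)"
    using \<sigma>(4)[of z] by (simp add: prob_space)
  moreover have "expectation (\<lambda>\<omega>. Z t z (\<sigma> \<omega>) \<omega>) - K * \<epsilon> = z + \<epsilon>" using \<epsilon>K by (simp add: algebra_simps)
  ultimately have "ereal (z - \<epsilon>) < ereal (expectation (\<lambda>\<omega>. Z t (z - \<epsilon>) (\<sigma> \<omega>) \<omega>))" using \<epsilon> by simp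
  then have "ereal (z - \<epsilon>) < value_function M Z t (z - \<epsilon>)" using \<sigma>(5)[of "z - \<epsilon>"] by (rule less_le_trans)
  then show ?thesis using \<epsilon> by (intro exI[of _ "z - \<epsilon>"]) simp
qed

lemma antimono_boundary:
  assumes anti: "\<forall>t\<in>{0..<1}. antimono (\<lambda>z. bridge_h \<mu> t z - z)"
  shows "\<exists>b::real \<Rightarrow> ereal. continuation_region M Z = {(t, z). t \<in> {0..<1} \<and> ereal z < b t}"
proof -
  define S where "S t = {z. ereal z < value_function M Z t z}" for t
  have "z \<in> S t \<longleftrightarrow> ereal z < (SUP x\<in>S t. ereal x)" if t: "t \<in> {0..<1}" for t z
  proof (rule lower_boundary)
    show "x \<in> S t" if "y \<in> S t" "x < y" for x y
      using continuation_region_down[OF anti t, of y x] that by (simp add: S_def)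
    show "\<exists>y\<in>S t. x < y" if "x \<in> S t" for x
      using continuation_region_right_open[OF anti t, of x] that by (auto simp: S_def)
  qed
  then show ?thesis by (intro exI[of _ "\<lambda>t. SUP x\<in>S t. ereal x"]) (auto simp: continuation_region_def S_def)
qed

lemma mono_boundary:
  assumes mono: "\<forall>t\<in>{0..<1}. mono (\<lambda>z. bridge_h \<mu> t z - z)"
  shows "\<exists>b::real \<Rightarrow> ereal. continuation_region M Z = {(t, z). t \<in> {0..<1} \<and> ereal z > b t}"
proof -
  define S where "S t = {z. ereal z < value_function M Z t z}" for t
  have "z \<in> S t \<longleftrightarrow> (INF x\<in>S t. ereal x) < ereal z" if t: "t \<in> {0..<1}" for t z
  proof (rule upper_boundary)
    show "x \<in> S t" if "y \<in> S t" "y < x" for x y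
      using continuation_region_up[OF mono t, of y x] that by (simp add: S_def)
    show "\<exists>y\<in>S t. y < x" if "x \<in> S t" for x
      using continuation_region_left_open[OF mono t, of x] that by (auto simp: S_def)
  qed
  then show ?thesis by (intro exI[of _ "\<lambda>t. INF x\<in>S t. ereal x"]) (auto simp: continuation_region_def S_def)
qed

end

theorem theorem3p2:
  fixes \<mu> :: "real measure" and M :: "'w measure"
    and W :: "real \<Rightarrow> 'w \<Rightarrow> real"
    and Z :: "real \<Rightarrow> real \<Rightarrow> real \<Rightarrow> 'w \<Rightarrow> real"
  assumes "real_distribution \<mu>"
    and "integrable \<mu> (\<lambda>u. u)"
    and "\<forall>t\<^sub>0\<in>{0..<1}. \<exists>C. \<forall>t\<in>{0..t\<^sub>0}. \<forall>z. prob_space.variance (posterior \<mu> t z) (\<lambda>u. u) \<le> C"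
    and "standard_brownian_motion M W"
    and "\<forall>t\<in>{0..<1}. \<forall>z. bridge_process \<mu> M W t z (Z t z)"
  shows
    "(((\<forall>t\<in>{0..<1}. antimono (\<lambda>z. bridge_h \<mu> t z - z)) \<longleftrightarrow>
         (\<forall>t\<ge>0. antimono (\<lambda>y. bridge_f \<mu> t y - y / (1 + t)))) \<and>
      ((\<forall>t\<in>{0..<1}. antimono (\<lambda>z. bridge_h \<mu> t z - z)) \<longrightarrow>
         (\<exists>b::real \<Rightarrow> ereal. continuation_region M Z = {(t, z). t \<in> {0..<1} \<and> ereal z < b t}))) \<and>
     (((\<forall>t\<in>{0..<1}. mono (\<lambda>z. bridge_h \<mu> t z - z)) \<longleftrightarrow>
         (\<forall>t\<ge>0. mono (\<lambda>y. bridge_f \<mu> t y - y / (1 + t)))) \<and>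
      ((\<forall>t\<in>{0..<1}. mono (\<lambda>z. bridge_h \<mu> t z - z)) \<longrightarrow>
         (\<exists>b::real \<Rightarrow> ereal. continuation_region M Z = {(t, z). t \<in> {0..<1} \<and> ereal z > b t})))"
proof -
  interpret bridge_stopping \<mu> M W Z by (rule bridge_stopping.intro[OF assms])
  have "(\<forall>t\<in>{0..<1}. antimono (\<lambda>z. bridge_h \<mu> t z - z)) \<longleftrightarrow> (\<forall>t\<ge>0. antimono (\<lambda>y. bridge_f \<mu> t y - y / (1 + t)))"
    by (rule f_monotone_iff_h_monotone[OF assms(1)]) simp
  moreover have "(\<forall>t\<in>{0..<1}. mono (\<lambda>z. bridge_h \<mu> t z - z)) \<longleftrightarrow> (\<forall>t\<ge>0. mono (\<lambda>y. bridge_f \<mu> t y - y / (1 + t)))"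
    by (rule f_monotone_iff_h_monotone[OF assms(1)]) simp
  ultimately show ?thesis by (intro conjI impI antimono_boundary mono_boundary)
qed

end
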